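(* Let $J\subsetneq I$ be monomial ideals in $S=k[x_1,\dots,x_n]$. For each $i\in\mathbb{Z}$ and $\mathbf a\in\mathbb{Z}^n$, there is an isomorphism of $k$-vector spaces $$H^i_{\mathfrak m}(I/J)_{\mathbf a}\;\cong\;\widetilde H^{\,i-|G_{\mathbf a}|-1}\big((\Delta_{\mathbf a}(J),\Delta_{\mathbf a}(I));k\big),$$ and $H^i_{\mathfrak m}(I/J)_{\mathbf a}=0$ if $G_{\mathbf a}\notin\Delta(\sqrt J)$.
   Context: $k$ is an arbitrary field, $S=k[x_1,\dots,x_n]$ with its standard $\mathbb{Z}^n$-grading, $\mathfrak m=(x_1,\dots,x_n)$, $[n]=\{1,\dots,n\}$, and $H^i_{\mathfrak m}(-)_{\mathbf a}$ is the degree-$\mathbf a$ component of local cohomology. A simplicial complex on $[n]$ is a collection of subsets of $[n]$ closed under taking subsets (it may be empty, or equal to $\{\varnothing\}$, and singletons need not be faces); $\dim F=|F|-1$. For $\mathbf a=(a_1,\dots,a_n)\in\mathbb{Z}^n$ put $G_{\mathbf a}=\{i : a_i<0\}$. For a monomial ideal $K\subseteq S$, the degree complex $\Delta_{\mathbf a}(K)$ consists of all $F\subseteq[n]$ such that (1) $F\cap G_{\mathbf a}=\varnothing$, and (2) for every minimal monomial generator $x^{\mathbf b}$ of $K$ there is an index $i\notin F\cup G_{\mathbf a}$ with $b_i>a_i$. For $J\subseteq I$ one has $\Delta_{\mathbf a}(I)\subseteq\Delta_{\mathbf a}(J)$. $\Delta(\sqrt J)$ is the Stanley-Reisner complex of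 $\sqrt J$, i.e. $\{F\subseteq[n] : \prod_{i\in F}x_i\notin\sqrt J\}$. For simplicial complexes $\Gamma\subseteq\Delta$, $\widetilde H^{j}((\Delta,\Gamma);k)$ is the reduced relative cohomology: the $j$-th cohomology of the $k$-dual of the quotient $\mathcal C(\Delta)_\bullet/\mathcal C(\Gamma)_\bullet$ of augmented oriented chain complexes (the empty face, if present, sits in degree $-1$). *)

theory Defs
  imports
    "HOL-Algebra.Algebra"
    "HOL-Algebra.Algebraic_Closure_Type"
    "HOL-Library.Poly_Mapping"
begin

text \<open>The index set $[n]$ is a finite linearly ordered type \<open>'n\<close>; the order is used only to orient
  simplices. Monomials are their exponent vectors, and a polynomial maps monomials to coefficients.\<close>

type_synonym 'n monomial = "'n \<Rightarrow>\<^sub>0 nat"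
type_synonym ('n, 'k) mpoly = "'n monomial \<Rightarrow>\<^sub>0 'k"

abbreviation base_field :: "'k::field ring" where
  "base_field \<equiv> ring_of_type_algebra"

abbreviation poly_ring :: "('n, 'k::field) mpoly ring" where
  "poly_ring \<equiv> ring_of_type_algebra"

definition term_of :: "'k::field \<Rightarrow> 'n monomial \<Rightarrow> ('n, 'k) mpoly" where
  "term_of c m = Poly_Mapping.single m c"

definition var :: "'n \<Rightarrow> ('n, 'k::field) mpoly" where
  "var i = term_of 1 (Poly_Mapping.single i 1)"

section \<open>Linear maps, quotients, and cohomology\<close>

definition module_hom ::
  "('r, 'p) ring_scheme \<Rightarrow> ('r, 'a, 'q) module_scheme \<Rightarrow> ('r, 'b, 's) module_scheme \<Rightarrow> ('a \<Rightarrow> 'b) set"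
  where
  "module_hom R M N = {f \<in> carrier M \<rightarrow> carrier N.
     (\<forall>x\<in>carrier M. \<forall>y\<in>carrier M. f (x \<oplus>\<^bsub>M\<^esub> y) = f x \<oplus>\<^bsub>N\<^esub> f y) \<and>
     (\<forall>r\<in>carrier R. \<forall>x\<in>carrier M. f (r \<odot>\<^bsub>M\<^esub> x) = r \<odot>\<^bsub>N\<^esub> f x)}"

definition module_iso ::
  "('r, 'p) ring_scheme \<Rightarrow> ('r, 'a, 'q) module_scheme \<Rightarrow> ('r, 'b, 's) module_scheme \<Rightarrow> bool" where
  "module_iso R M N \<longleftrightarrow> (\<exists>f\<in>module_hom R M N. bij_betw f (carrier M) (carrier N))"

text \<open>The fields \<^const>\<open>mult\<close> and \<^const>\<open>one\<close>, which the record type of modules inherits from rings,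
  play no role in a module.\<close>

definition quot_module :: "('r, 'a, 'q) module_scheme \<Rightarrow> 'a set \<Rightarrow> ('r, 'a set) module" where
  "quot_module M N = \<lparr>carrier = a_rcosets\<^bsub>M\<^esub> N, monoid.mult = undefined, one = undefined,
     ring.zero = N, ring.add = set_add M, module.smult = (\<lambda>r Q. \<Union>x\<in>Q. N +>\<^bsub>M\<^esub> (r \<odot>\<^bsub>M\<^esub> x))\<rparr>"

definition cocycles ::
  "(int \<Rightarrow> ('r, 'a, 'q) module_scheme) \<Rightarrow> (int \<Rightarrow> 'a \<Rightarrow> 'a) \<Rightarrow> int \<Rightarrow> 'a set" where
  "cocycles C d i = {x \<in> carrier (C i). d i x = \<zero>\<^bsub>C (i + 1)\<^esub>}"

definition coboundaries ::
  "(int \<Rightarrow> ('r, 'a, 'q) module_scheme) \<Rightarrow> (int \<Rightarrow> 'a \<Rightarrow> 'a) \<Rightarrow> int \<Rightarrow> 'a set" where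
  "coboundaries C d i = d (i - 1) ` carrier (C (i - 1))"

definition cohomology ::
  "(int \<Rightarrow> ('r, 'a, 'q) module_scheme) \<Rightarrow> (int \<Rightarrow> 'a \<Rightarrow> 'a) \<Rightarrow> int \<Rightarrow> ('r, 'a set) module" where
  "cohomology C d i = quot_module ((C i)\<lparr>carrier := cocycles C d i\<rparr>) (coboundaries C d i)"

section \<open>Multigraded modules\<close>

record ('r, 'm, 'n) gmodule = "('r, 'm) module" +
  degree_part :: "('n \<Rightarrow> int) \<Rightarrow> 'm set"

type_synonym ('n, 'k, 'm) multigraded = "(('n, 'k) mpoly, 'm, 'n) gmodule"

definition multigraded_module :: "('n, 'k::field, 'm) multigraded \<Rightarrow> bool" where
  "multigraded_module M \<longleftrightarrow>
     module poly_ring M \<and>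
     (\<forall>a. subgroup (degree_part M a) (add_monoid M)) \<and>
     (\<forall>x\<in>carrier M. \<exists>!f. (\<forall>a. f a \<in> degree_part M a) \<and> finite {a. f a \<noteq> \<zero>\<^bsub>M\<^esub>} \<and>
        x = finsum M f {a. f a \<noteq> \<zero>\<^bsub>M\<^esub>}) \<and>
     (\<forall>c m a. \<forall>x\<in>degree_part M a.
        term_of c m \<odot>\<^bsub>M\<^esub> x \<in> degree_part M (\<lambda>i. a i + int (Poly_Mapping.lookup m i)))"

definition graded_hom ::
  "('n, 'k::field, 'm) multigraded \<Rightarrow> ('n, 'k, 'e) multigraded \<Rightarrow> ('m \<Rightarrow> 'e) set" where
  "graded_hom M N = {f \<in> module_hom poly_ring M N. \<forall>a. f ` degree_part M a \<subseteq> degree_part N a}"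

definition graded_sub :: "('n, 'k::field, 'm) multigraded \<Rightarrow> 'm set \<Rightarrow> ('n, 'k, 'm) multigraded" where
  "graded_sub M H = M\<lparr>carrier := H, degree_part := (\<lambda>a. H \<inter> degree_part M a)\<rparr>"

definition graded_quot ::
  "('n, 'k::field, 'm) multigraded \<Rightarrow> 'm set \<Rightarrow> ('n, 'k, 'm set) multigraded" where
  "graded_quot M N = module.extend (quot_module M N)
     (gmodule.fields (\<lambda>a. (\<lambda>x. N +>\<^bsub>M\<^esub> x) ` degree_part M a))"

definition graded_cohomology ::
  "(int \<Rightarrow> ('n, 'k::field, 'm) multigraded) \<Rightarrow> (int \<Rightarrow> 'm \<Rightarrow> 'm) \<Rightarrow> int \<Rightarrow> ('n, 'k, 'm set) multigraded"
  where
  "graded_cohomology C d i = graded_quot (graded_sub (C i) (cocycles C d i)) (coboundaries C d i)"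

definition component :: "('n, 'k::field, 'm) multigraded \<Rightarrow> ('n \<Rightarrow> int) \<Rightarrow> ('k, 'm) module" where
  "component M a = \<lparr>carrier = degree_part M a, monoid.mult = undefined, one = undefined,
     ring.zero = \<zero>\<^bsub>M\<^esub>, ring.add = ring.add M, module.smult = (\<lambda>c x. term_of c 0 \<odot>\<^bsub>M\<^esub> x)\<rparr>"

definition poly_module :: "('n, 'k::field, ('n, 'k) mpoly) multigraded" where
  "poly_module = \<lparr>carrier = UNIV, monoid.mult = (*), one = 1, ring.zero = 0, ring.add = (+), module.smult = (*),
     degree_part = (\<lambda>a. {f. \<forall>m\<in>Poly_Mapping.keys f. \<forall>i. int (Poly_Mapping.lookup m i) = a i})\<rparr>"

definition ideal_quotient ::
  "('n, 'k::field) mpoly set \<Rightarrow> ('n, 'k) mpoly set \<Rightarrow> ('n, 'k, ('n, 'k) mpoly set) multigraded" where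
  "ideal_quotient I J = graded_quot (graded_sub poly_module I) J"

section \<open>Local cohomology\<close>

text \<open>Local cohomology is the right derived functor of the torsion functor $\Gamma_{\mathfrak m}$ on the
  category of $\mathbb{Z}^n$-graded modules with homogeneous maps of degree zero, hence it is
  computed from an injective resolution in that category.

  A definition cannot quantify over all types, so the extension property of an injective object is
  asked for the graded modules carried by the fixed type of sequences of polynomials. That type
  carries the polynomial ring with all its shifts and ideals, so by the graded version of Baer's
  criterion this is the same as injectivity with respect to graded modules on arbitrary types.\<close>

definition graded_injective :: "('n, 'k::field, 'e) multigraded \<Rightarrow> bool" where
  "graded_injective E \<longleftrightarrow> multigraded_module E \<and>
     (\<forall>(A :: ('n, 'k, nat \<Rightarrow> ('n, 'k) mpoly) multigraded)
       (B :: ('n, 'k, nat \<Rightarrow> ('n, 'k) mpoly) multigraded) u f.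
        multigraded_module A \<and> multigraded_module B \<and>
        u \<in> graded_hom A B \<and> inj_on u (carrier A) \<and> f \<in> graded_hom A E \<longrightarrow>
        (\<exists>g\<in>graded_hom B E. \<forall>x\<in>carrier A. g (u x) = f x))"

definition injective_resolution ::
  "('n, 'k::field, 'm) multigraded \<Rightarrow> ('m \<Rightarrow> 'e) \<Rightarrow>
   (int \<Rightarrow> ('n, 'k, 'e) multigraded) \<Rightarrow> (int \<Rightarrow> 'e \<Rightarrow> 'e) \<Rightarrow> bool" where
  "injective_resolution M \<epsilon> E d \<longleftrightarrow>
     (\<forall>q. graded_injective (E q)) \<and> (\<forall>q. d q \<in> graded_hom (E q) (E (q + 1))) \<and>
     (\<forall>q<0. carrier (E q) = {\<zero>\<^bsub>E q\<^esub>}) \<and>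
     \<epsilon> \<in> graded_hom M (E 0) \<and> inj_on \<epsilon> (carrier M) \<and> \<epsilon> ` carrier M = cocycles E d 0 \<and>
     (\<forall>q>0. coboundaries E d q = cocycles E d q)"

definition irrelevant_ideal :: "('n, 'k::field) mpoly set" where
  "irrelevant_ideal = genideal poly_ring (range var)"

primrec ideal_power :: "('a, 'p) ring_scheme \<Rightarrow> 'a set \<Rightarrow> nat \<Rightarrow> 'a set" where
  "ideal_power R I 0 = carrier R"
| "ideal_power R I (Suc t) = ideal_prod R (ideal_power R I t) I"

definition torsion :: "('n, 'k::field, 'm) multigraded \<Rightarrow> ('n, 'k, 'm) multigraded" where
  "torsion M = graded_sub M
     {x \<in> carrier M. \<exists>t. \<forall>f\<in>ideal_power poly_ring irrelevant_ideal t. f \<odot>\<^bsub>M\<^esub> x = \<zero>\<^bsub>M\<^esub>}"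

text \<open>The arguments are an injective resolution of the module whose local cohomology is taken.\<close>

definition local_cohomology ::
  "(int \<Rightarrow> ('n, 'k::field, 'e) multigraded) \<Rightarrow> (int \<Rightarrow> 'e \<Rightarrow> 'e) \<Rightarrow> int \<Rightarrow> ('n, 'k, 'e set) multigraded"
  where
  "local_cohomology E d i = graded_cohomology (\<lambda>q. torsion (E q)) d i"

section \<open>Relative simplicial cohomology\<close>

text \<open>Chains are functions on faces; the face $F = \{v_0 < \dots < v_j\}$ carries the orientation
  $[v_0, \dots, v_j]$. The coefficient of $\partial c$ at $G$ collects
  $(-1)^s\, c(G \cup \{v\})$, where $s$ is the position of $v$ in $G \cup \{v\}$.\<close>

definition chains :: "'n::{finite, linorder} set set \<Rightarrow> int \<Rightarrow> ('k::field, 'n set \<Rightarrow> 'k) module" where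
  "chains \<Delta> j = \<lparr>carrier = {c. \<forall>F. c F \<noteq> 0 \<longrightarrow> F \<in> \<Delta> \<and> int (card F) - 1 = j},
     monoid.mult = undefined, one = undefined, ring.zero = (\<lambda>F. 0), ring.add = (\<lambda>c c' F. c F + c' F),
     module.smult = (\<lambda>r c F. r * c F)\<rparr>"

definition boundary :: "('n::{finite, linorder} set \<Rightarrow> 'k::field) \<Rightarrow> 'n set \<Rightarrow> 'k" where
  "boundary c = (\<lambda>G. \<Sum>v\<in>- G. (- 1) ^ card {w \<in> G. w < v} * c (insert v G))"

definition relative_chains ::
  "'n::{finite, linorder} set set \<Rightarrow> 'n set set \<Rightarrow> int \<Rightarrow> ('k::field, ('n set \<Rightarrow> 'k) set) module" where
  "relative_chains \<Delta> \<Gamma> j = quot_module (chains \<Delta> j) (carrier (chains \<Gamma> j))"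

definition relative_boundary ::
  "'n::{finite, linorder} set set \<Rightarrow> 'n set set \<Rightarrow> int \<Rightarrow>
   ('n set \<Rightarrow> 'k::field) set \<Rightarrow> ('n set \<Rightarrow> 'k) set" where
  "relative_boundary \<Delta> \<Gamma> j Q =
     (\<Union>c\<in>Q. carrier (chains \<Gamma> (j - 1)) +>\<^bsub>chains \<Delta> (j - 1)\<^esub> boundary c)"

definition field_module :: "('k::field, 'k) module" where
  "field_module = \<lparr>carrier = UNIV, monoid.mult = (*), one = 1, ring.zero = 0, ring.add = (+), module.smult = (*)\<rparr>"

definition dual :: "('k::field, 'a, 'q) module_scheme \<Rightarrow> ('k, 'a \<Rightarrow> 'k) module" where
  "dual V = \<lparr>carrier = module_hom base_field V field_module \<inter> extensional (carrier V),
     monoid.mult = undefined, one = undefined, ring.zero = (\<lambda>x\<in>carrier V. 0),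
     ring.add = (\<lambda>\<phi> \<psi>. \<lambda>x\<in>carrier V. \<phi> x + \<psi> x), module.smult = (\<lambda>r \<phi>. \<lambda>x\<in>carrier V. r * \<phi> x)\<rparr>"

definition relative_coboundary ::
  "'n::{finite, linorder} set set \<Rightarrow> 'n set set \<Rightarrow> int \<Rightarrow>
   (('n set \<Rightarrow> 'k::field) set \<Rightarrow> 'k) \<Rightarrow> ('n set \<Rightarrow> 'k) set \<Rightarrow> 'k" where
  "relative_coboundary \<Delta> \<Gamma> j \<phi> =
     (\<lambda>Q\<in>carrier (relative_chains \<Delta> \<Gamma> (j + 1)). \<phi> (relative_boundary \<Delta> \<Gamma> (j + 1) Q))"

definition relative_cohomology ::
  "'n::{finite, linorder} set set \<Rightarrow> 'n set set \<Rightarrow> int \<Rightarrow>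
   ('k::field, (('n set \<Rightarrow> 'k) set \<Rightarrow> 'k) set) module" where
  "relative_cohomology \<Delta> \<Gamma> =
     cohomology (\<lambda>j. dual (relative_chains \<Delta> \<Gamma> j)) (relative_coboundary \<Delta> \<Gamma>)"

section \<open>Monomial ideals and their degree complexes\<close>

definition monomial_ideal :: "('n, 'k::field) mpoly set \<Rightarrow> bool" where
  "monomial_ideal K \<longleftrightarrow> (\<exists>B. K = genideal poly_ring (term_of 1 ` B))"

definition minimal_generators :: "('n, 'k::field) mpoly set \<Rightarrow> 'n monomial set" where
  "minimal_generators K =
     {b. term_of (1::'k) b \<in> K \<and> (\<forall>c. term_of (1::'k) c \<in> K \<and>
        (\<forall>i. Poly_Mapping.lookup c i \<le> Poly_Mapping.lookup b i) \<longrightarrow> c = b)}"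

definition negative_support :: "('n \<Rightarrow> int) \<Rightarrow> 'n set" where
  "negative_support a = {i. a i < 0}"

definition degree_complex :: "('n \<Rightarrow> int) \<Rightarrow> ('n, 'k::field) mpoly set \<Rightarrow> 'n set set" where
  "degree_complex a K = {F. F \<inter> negative_support a = {} \<and>
     (\<forall>b\<in>minimal_generators K. \<exists>i. i \<notin> F \<union> negative_support a \<and> int (Poly_Mapping.lookup b i) > a i)}"

definition ideal_radical :: "('n, 'k::field) mpoly set \<Rightarrow> ('n, 'k) mpoly set" where
  "ideal_radical K = {f. \<exists>t. f ^ t \<in> K}"

definition stanley_reisner_complex :: "('n::finite, 'k::field) mpoly set \<Rightarrow> 'n set set" where
  "stanley_reisner_complex K = {F. (\<Prod>i\<in>F. var i) \<notin> K}"

end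

theory Submission
  imports Defs "HOL-Library.Function_Algebras"
begin

text \<open>Write $M = I/J$, let $E$ be the injective resolution, and for a set $F$ of variables let $e_F$ be
  the sum of the unit vectors $e_j$, $j \in F$. For an exponent $t$ consider the Koszul double
  complex with the space $E^q_{a + t e_F}$ in the place $(F, q)$; its differentials are $d$ and the
  multiplications by the powers $x_j^t$. Its total complex is compared with two smaller complexes.

  Corner. If $l \notin A$, then $x_l^t$ is a nonzerodivisor on $S/(x_j^t : j \in A)$, so in a graded
  injective module every element killed by all $x_j^t$, $j \in A$, is $x_l^t$ times such an element
  (\<open>graded_injective_divide\<close>). This removes one variable after the other: the total complex has the
  cohomology of its corner $F = \emptyset$, which in degree $a$ is the submodule of $E$ killed by
  $x_1^t, \dots, x_n^t$ (\<open>into_corner\<close>).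

  Edge. The columns are resolutions of the spaces $M_{a + t e_F}$, so the total complex also has the
  cohomology of the Koszul complex of $M$ (\<open>into_edge\<close>). The space $M_{a + t e_F}$ is $k$ or $0$, and
  for large $t$ it is $k$ exactly if $G_a \subseteq F$ and $F - G_a$ is a face of $\Delta_a(J)$ but not of
  $\Delta_a(I)$ (\<open>exponents_stable\<close>). Up to signs (\<open>twist\<close>) and the shift by $|G_a|$, the edge is the
  complex of relative simplicial cochains.

  The comparison is the relation \<open>linked\<close> between corner cocycles and edge cochains that are
  cohomologous in the total complex. It is linear, total, surjective, and matches coboundaries with
  coboundaries, so it induces an isomorphism on cohomology. The relation for $t$ implies the one
  for $t + 1$ (\<open>link_Suc\<close>), and every element of $\Gamma_{\mathfrak m}(E)$ is killed by
  $x_1^t, \dots, x_n^t$ for some $t$. The union of the relations over all large $t$ therefore compares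
  the relative cochains with the whole of $\Gamma_{\mathfrak m}(E)_a$.

  If $G_a$ is not a face of $\Delta(\sqrt J)$, a power of $\prod_{i \in G_a} x_i$ lies in $J$. Then
  $\Delta_a(J)$ is empty, there are no nonzero cochains, and the cohomology vanishes.

  The modules $E^q$ live on a type without algebraic structure. Their components are first embedded
  linearly into a type of vectors (\<open>vector_space_embedding\<close>), on which $d$ and the $x_i$ become total
  commuting linear operators; the double complex is then studied for such operators only.\<close>

abbreviation "lookup \<equiv> Poly_Mapping.lookup"
abbreviation "keys \<equiv> Poly_Mapping.keys"
abbreviation "single \<equiv> Poly_Mapping.single"

section \<open>Signs and cochains on a set of faces\<close>

lemma sum_alternating_eq_0:
  fixes g :: "'n::linorder \<Rightarrow> 'n \<Rightarrow> 'w::ab_group_add"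
  assumes fin: "finite F" and alt: "\<And>j l. j \<in> F \<Longrightarrow> l \<in> F \<Longrightarrow> j \<noteq> l \<Longrightarrow> g j l = - g l j"
  shows "(\<Sum>j\<in>F. \<Sum>l\<in>F - {j}. g j l) = 0"
proof -
  have split: "(\<Sum>l\<in>F - {j}. g j l) = (\<Sum>l\<in>{l\<in>F. l < j}. g j l) + (\<Sum>l\<in>{l\<in>F. j < l}. g j l)" for j
  proof -
    have "F - {j} = {l\<in>F. l < j} \<union> {l\<in>F. j < l}" by auto
    moreover have "{l\<in>F. l < j} \<inter> {l\<in>F. j < l} = {}" by auto
    ultimately show ?thesis using fin by (simp add: sum.union_disjoint)
  qed
  have "(\<Sum>j\<in>F. \<Sum>l\<in>{l\<in>F. j < l}. g j l) = (\<Sum>l\<in>F. \<Sum>j\<in>{j\<in>F. j < l}. g j l)"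
    by (rule sum.swap_restrict) (use fin in auto)
  also have "\<dots> = (\<Sum>l\<in>F. \<Sum>j\<in>{j\<in>F. j < l}. - g l j)"
    using alt by (intro sum.cong refl) auto
  finally show ?thesis by (simp add: split sum.distrib sum_negf)
qed

definition incidence_sign :: "'n::linorder \<Rightarrow> 'n set \<Rightarrow> 'k::comm_ring_1" where
  "incidence_sign j F = (- 1) ^ card {l\<in>F. l < j}"

lemma incidence_sign_square [simp]: "incidence_sign j F * incidence_sign j F = 1"
  by (simp add: incidence_sign_def flip: power_add mult_2)

lemma incidence_sign_remove_self: "incidence_sign j (F - {j}) = incidence_sign j F"
proof -
  have "{l \<in> F - {j}. l < j} = {l\<in>F. l < j}" by auto
  then show ?thesis by (simp add: incidence_sign_def)
qed

lemma incidence_sign_remove: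
  assumes "finite F" "l \<in> F" "l < j"
  shows "incidence_sign j (F - {l}) = - incidence_sign j F"
proof -
  have "{i\<in>F. i < j} = insert l {i \<in> F - {l}. i < j}" using assms by auto
  then have "card {i\<in>F. i < j} = Suc (card {i \<in> F - {l}. i < j})" using assms by simp
  then show ?thesis by (simp add: incidence_sign_def)
qed

lemma incidence_sign_remove_ge:
  assumes "j \<le> l"
  shows "incidence_sign j (F - {l}) = incidence_sign j F"
proof -
  have "{i \<in> F - {l}. i < j} = {i\<in>F. i < j}" using assms by auto
  then show ?thesis by (simp add: incidence_sign_def)
qed

text \<open>The two ways of removing two elements from a face carry opposite signs; this is what makes the
  Koszul differential square to zero.\<close>

lemma incidence_sign_swap:
  assumes "finite F" "j \<in> F" "l \<in> F" "j \<noteq> l"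
  shows "incidence_sign j F * incidence_sign l (F - {j})
       = - (incidence_sign l F * incidence_sign j (F - {l}) :: 'k::comm_ring_1)"
proof (cases "j < l")
  case True
  then show ?thesis using assms
    by (simp add: incidence_sign_remove incidence_sign_remove_ge mult.commute)
next
  case False
  then have "l < j" using assms by auto
  then show ?thesis using assms
    by (simp add: incidence_sign_remove incidence_sign_remove_ge mult.commute)
qed

text \<open>The faces need not form a simplicial complex: for a relative cochain complex they are the faces of
  the larger complex outside the smaller one.\<close>

definition face_cochains :: "'n set set \<Rightarrow> int \<Rightarrow> ('n set \<Rightarrow> 'k::zero) set" where
  "face_cochains \<F> i = {c. \<forall>F. c F \<noteq> 0 \<longrightarrow> F \<in> \<F> \<and> int (card F) = i}"

definition face_coboundary :: "'n::linorder set set \<Rightarrow> ('n set \<Rightarrow> 'k::comm_ring_1) \<Rightarrow> 'n set \<Rightarrow> 'k" where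
  "face_coboundary \<F> c F = (if F \<in> \<F> then \<Sum>j\<in>F. incidence_sign j F * c (F - {j}) else 0)"

lemma face_coboundary_add: "face_coboundary \<F> (\<lambda>F. c F + c' F) = (\<lambda>F. face_coboundary \<F> c F + face_coboundary \<F> c' F)"
  by (rule ext) (simp add: face_coboundary_def sum.distrib ring_distribs)

lemma face_coboundary_scale: "face_coboundary \<F> (\<lambda>F. r * c F) = (\<lambda>F. r * face_coboundary \<F> c F)"
  by (rule ext) (simp add: face_coboundary_def sum_distrib_left mult.left_commute)

lemma face_cochains_closed:
  fixes c c' :: "'n set \<Rightarrow> 'k::comm_ring_1"
  shows "c \<in> face_cochains \<F> i \<Longrightarrow> c' \<in> face_cochains \<F> i \<Longrightarrow> (\<lambda>F. c F + c' F) \<in> face_cochains \<F> i"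
    "c \<in> face_cochains \<F> i \<Longrightarrow> (\<lambda>F. r * c F) \<in> face_cochains \<F> i"
    "(\<lambda>F. 0) \<in> face_cochains \<F> i"
proof -
  show "(\<lambda>F. c F + c' F) \<in> face_cochains \<F> i" if "c \<in> face_cochains \<F> i" "c' \<in> face_cochains \<F> i"
  proof -
    have "c F \<noteq> 0 \<or> c' F \<noteq> 0" if "c F + c' F \<noteq> 0" for F using that by auto
    then show ?thesis using that unfolding face_cochains_def by blast
  qed
  show "(\<lambda>F. r * c F) \<in> face_cochains \<F> i" if "c \<in> face_cochains \<F> i"
  proof -
    have "c F \<noteq> 0" if "r * c F \<noteq> 0" for F using that by auto
    then show ?thesis using that unfolding face_cochains_def by blast
  qed
qed (simp add: face_cochains_def)

lemma linear_simps:
  assumes "Vector_Spaces.linear s1 s2 f"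
  shows "f 0 = 0" "f (x + y) = f x + f y" "f (x - y) = f x - f y" "f (- x) = - f x"
    "f (s1 c x) = s2 c (f x)" "f (sum h A) = (\<Sum>a\<in>A. f (h a))"
proof -
  interpret l: Vector_Spaces.linear s1 s2 f by (rule assms)
  show "f 0 = 0" "f (x + y) = f x + f y" "f (x - y) = f x - f y" "f (- x) = - f x"
    "f (s1 c x) = s2 c (f x)" "f (sum h A) = (\<Sum>a\<in>A. f (h a))"
    by (simp_all add: l.zero l.add l.diff l.neg l.scale l.sum)
qed

section \<open>The Koszul double complex\<close>

text \<open>The double complex for a fixed exponent \<open>t\<close>. The space \<open>U q F\<close> stands for the component of $E^q$ in
  degree $a + t e_F$, the operator \<open>Y j\<close> for $x_j^t$, and \<open>\<eta> F\<close> for the image in $E^0$ of the monomial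
  of degree $a + t e_F$; \<open>\<F>\<close> is the set of those \<open>F\<close> for which this monomial is nonzero in $I/J$. The
  last assumption is what remains of the injectivity of $E$.\<close>

locale koszul = vector_space sc for sc :: "'k::field \<Rightarrow> 'w::ab_group_add \<Rightarrow> 'w" +
  fixes \<delta> :: "'w \<Rightarrow> 'w" and Y :: "'n::{finite, linorder} \<Rightarrow> 'w \<Rightarrow> 'w"
    and U :: "int \<Rightarrow> 'n set \<Rightarrow> 'w set" and \<eta> :: "'n set \<Rightarrow> 'w" and \<F> :: "'n set set"
  assumes lin_\<delta>: "Vector_Spaces.linear sc sc \<delta>" and lin_Y: "\<And>j. Vector_Spaces.linear sc sc (Y j)"
    and subspace_U: "\<And>q F. subspace (U q F)"
    and \<delta>_U: "\<And>q F x. x \<in> U q F \<Longrightarrow> \<delta> x \<in> U (q + 1) F"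
    and Y_U: "\<And>q F j x. x \<in> U q F \<Longrightarrow> j \<notin> F \<Longrightarrow> Y j x \<in> U q (insert j F)"
    and \<delta>_\<delta>: "\<And>x. \<delta> (\<delta> x) = 0" and \<delta>_Y: "\<And>j x. \<delta> (Y j x) = Y j (\<delta> x)"
    and Y_Y: "\<And>j l x. Y j (Y l x) = Y l (Y j x)"
    and U_neg: "\<And>q F. q < 0 \<Longrightarrow> U q F = {0}"
    and exact: "\<And>q F x. q > 0 \<Longrightarrow> x \<in> U q F \<Longrightarrow> \<delta> x = 0 \<Longrightarrow> \<exists>y\<in>U (q - 1) F. \<delta> y = x"
    and kernel_0: "\<And>F x. x \<in> U 0 F \<Longrightarrow> \<delta> x = 0 \<Longrightarrow> \<exists>c. x = sc c (\<eta> F)"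
    and \<eta>_U: "\<And>F. \<eta> F \<in> U 0 F" and \<delta>_\<eta>: "\<And>F. \<delta> (\<eta> F) = 0"
    and \<eta>_eq_0: "\<And>F. \<eta> F = 0 \<longleftrightarrow> F \<notin> \<F>"
    and Y_\<eta>: "\<And>F j. F \<in> \<F> \<Longrightarrow> j \<notin> F \<Longrightarrow> Y j (\<eta> F) = \<eta> (insert j F)"
    and divide: "\<And>q F l A y. l \<notin> F \<Longrightarrow> l \<notin> A \<Longrightarrow> y \<in> U q (insert l F) \<Longrightarrow> (\<forall>j\<in>A. Y j y = 0) \<Longrightarrow>
       \<exists>x\<in>U q F. Y l x = y \<and> (\<forall>j\<in>A. Y j x = 0)"
begin

lemmas \<delta>_simps = linear_simps[OF lin_\<delta>]
lemmas Y_simps = linear_simps[OF lin_Y]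

definition D :: "('n set \<Rightarrow> 'w) \<Rightarrow> 'n set \<Rightarrow> 'w" where
  "D w F = sc ((- 1) ^ card F) (\<delta> (w F)) + (\<Sum>j\<in>F. sc (incidence_sign j F) (Y j (w (F - {j}))))"

definition Tot :: "int \<Rightarrow> ('n set \<Rightarrow> 'w) set" where
  "Tot i = {w. \<forall>F. w F \<in> U (i - int (card F)) F}"

text \<open>The subcomplex on the subsets of \<open>A\<close> with values killed by the remaining variables. It interpolates
  between the corner (\<open>A = {}\<close>) and the total complex (\<open>A = UNIV\<close>).\<close>

definition T :: "'n set \<Rightarrow> int \<Rightarrow> ('n set \<Rightarrow> 'w) set" where
  "T A i = {w \<in> Tot i. (\<forall>F. \<not> F \<subseteq> A \<longrightarrow> w F = 0) \<and> (\<forall>F j. j \<notin> A \<longrightarrow> Y j (w F) = 0)}"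

definition incl :: "'w \<Rightarrow> 'n set \<Rightarrow> 'w" where
  "incl z F = (if F = {} then z else 0)"

abbreviation "Coch \<equiv> face_cochains \<F>"

abbreviation "cobd \<equiv> face_coboundary \<F>"

definition aug :: "('n set \<Rightarrow> 'k) \<Rightarrow> 'n set \<Rightarrow> 'w" where
  "aug c F = sc (c F) (\<eta> F)"

text \<open>A corner cocycle and an edge cocycle that differ by a coboundary of the total complex.\<close>

definition linked :: "int \<Rightarrow> 'w \<Rightarrow> ('n set \<Rightarrow> 'k) \<Rightarrow> bool" where
  "linked i z c \<longleftrightarrow> z \<in> U i {} \<and> \<delta> z = 0 \<and> (\<forall>j. Y j z = 0) \<and> c \<in> Coch i \<and> cobd c = (\<lambda>_. 0) \<and>
     (\<exists>v\<in>Tot (i - 1). incl z - aug c = D v)"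

lemma D_add: "D (v + w) = D v + D w"
  by (rule ext) (simp add: D_def \<delta>_simps Y_simps algebra_simps scale_right_distrib sum.distrib)

lemma D_diff: "D (v - w) = D v - D w"
  by (rule ext) (simp add: D_def \<delta>_simps Y_simps algebra_simps scale_right_diff_distrib sum_subtractf)

lemma D_scale: "D (\<lambda>F. sc r (w F)) = (\<lambda>F. sc r (D w F))"
  by (rule ext) (simp add: D_def \<delta>_simps Y_simps scale_right_distrib scale_sum_right mult.commute)

lemma D_zero: "D 0 = 0"
  by (rule ext) (simp add: D_def \<delta>_simps Y_simps)

lemma D_uminus: "D (- w) = - D w"
  using D_diff[of 0 w] by (simp add: D_zero)

lemma D_D: "D (D w) = 0"
proof (rule ext)
  fix F :: "'n set"
  let ?s = "\<lambda>j F. incidence_sign j F :: 'k"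
  have 1: "\<delta> (D w F) = (\<Sum>j\<in>F. sc (?s j F) (Y j (\<delta> (w (F - {j})))))"
    by (simp add: D_def \<delta>_simps \<delta>_\<delta> \<delta>_Y)
  have 2: "Y j (D w (F - {j})) = - sc ((- 1) ^ card F) (Y j (\<delta> (w (F - {j}))))
      + (\<Sum>l\<in>F - {j}. sc (?s l (F - {j})) (Y j (Y l (w (F - {j} - {l})))))" if "j \<in> F" for j
  proof -
    have "card F = Suc (card (F - {j}))" by (metis card_Suc_Diff1 finite that)
    then have "(- 1) ^ card (F - {j}) = (- ((- 1) ^ card F) :: 'k)" by simp
    then show ?thesis unfolding D_def by (simp add: Y_simps)
  qed
  have 3: "(\<Sum>j\<in>F. \<Sum>l\<in>F - {j}. sc (?s j F) (sc (?s l (F - {j})) (Y j (Y l (w (F - {j} - {l})))))) = 0"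
  proof (rule sum_alternating_eq_0)
    fix j l assume jl: "j \<in> F" "l \<in> F" "j \<noteq> l"
    have "F - {j} - {l} = F - {l} - {j}" by auto
    then show "sc (?s j F) (sc (?s l (F - {j})) (Y j (Y l (w (F - {j} - {l})))))
        = - sc (?s l F) (sc (?s j (F - {l})) (Y l (Y j (w (F - {l} - {j})))))"
      using jl by (simp add: incidence_sign_swap[of F j l] Y_Y[of j l])
  qed simp
  have "(\<Sum>j\<in>F. sc (?s j F) (Y j (D w (F - {j})))) =
     (\<Sum>j\<in>F. - sc (?s j F) (sc ((- 1) ^ card F) (Y j (\<delta> (w (F - {j}))))) +
        (\<Sum>l\<in>F - {j}. sc (?s j F) (sc (?s l (F - {j})) (Y j (Y l (w (F - {j} - {l})))))))"
    by (rule sum.cong) (simp_all add: 2 scale_right_distrib scale_right_diff_distrib scale_sum_right)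
  also have "\<dots> = - (\<Sum>j\<in>F. sc (?s j F) (sc ((- 1) ^ card F) (Y j (\<delta> (w (F - {j}))))))"
    unfolding sum.distrib 3 by (simp add: sum_negf)
  also have "\<dots> = - sc ((- 1) ^ card F) (\<delta> (D w F))"
    by (simp add: 1 scale_sum_right mult.commute)
  finally have "(\<Sum>j\<in>F. sc (?s j F) (Y j (D w (F - {j})))) = - sc ((- 1) ^ card F) (\<delta> (D w F))" .
  then show "D (D w) F = 0 F" unfolding D_def[of "D w"] by simp
qed

lemma U_simps [simp]: "0 \<in> U q F"
  using subspace_U subspace_0 by blast

lemma U_closed: "x \<in> U q F \<Longrightarrow> y \<in> U q F \<Longrightarrow> x + y \<in> U q F"
  "x \<in> U q F \<Longrightarrow> y \<in> U q F \<Longrightarrow> x - y \<in> U q F" "x \<in> U q F \<Longrightarrow> - x \<in> U q F"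
  "x \<in> U q F \<Longrightarrow> sc c x \<in> U q F" 
  using subspace_U subspace_add subspace_diff subspace_neg subspace_scale by blast+

lemma D_Tot: assumes "w \<in> Tot i" shows "D w \<in> Tot (i + 1)"
proof -
  have "sc (incidence_sign j F) (Y j (w (F - {j}))) \<in> U (i + 1 - int (card F)) F" if "j \<in> F" for j F
  proof -
    have "card F = Suc (card (F - {j}))" by (metis card_Suc_Diff1 finite that)
    then have "i + 1 - int (card F) = i - int (card (F - {j}))" by simp
    moreover have "Y j (w (F - {j})) \<in> U (i - int (card (F - {j}))) (insert j (F - {j}))"
      using assms by (intro Y_U) (auto simp: Tot_def)
    ultimately have "Y j (w (F - {j})) \<in> U (i + 1 - int (card F)) F"
      using that by (simp only: insert_Diff)
    then show ?thesis by (rule U_closed)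
  qed
  moreover have "\<delta> (w F) \<in> U (i + 1 - int (card F)) F" for F
    using \<delta>_U[of "w F" "i - int (card F)" F] assms by (simp add: Tot_def algebra_simps)
  ultimately have "D w F \<in> U (i + 1 - int (card F)) F" for F
    unfolding D_def by (metis (no_types, lifting) U_closed(1,4) subspace_sum[OF subspace_U])
  then show ?thesis by (simp add: Tot_def)
qed

lemma Tot_closed: "v \<in> Tot i \<Longrightarrow> w \<in> Tot i \<Longrightarrow> v + w \<in> Tot i"
  "v \<in> Tot i \<Longrightarrow> w \<in> Tot i \<Longrightarrow> v - w \<in> Tot i" "0 \<in> Tot i"
  "v \<in> Tot i \<Longrightarrow> - v \<in> Tot i" "v \<in> Tot i \<Longrightarrow> (\<lambda>F. sc r (v F)) \<in> Tot i"
  by (auto simp: Tot_def U_closed)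

lemma T_closed: "v \<in> T A i \<Longrightarrow> w \<in> T A i \<Longrightarrow> v + w \<in> T A i"
  "v \<in> T A i \<Longrightarrow> w \<in> T A i \<Longrightarrow> v - w \<in> T A i"
  by (auto simp: T_def Tot_closed Y_simps)

lemma T_UNIV: "T UNIV i = Tot i"
  by (auto simp: T_def)

lemma D_T:
  assumes w: "w \<in> T A i" shows "D w \<in> T A (i + 1)"
proof -
  have "D w F = 0" if F: "\<not> F \<subseteq> A" for F
  proof -
    have "Y j (w (F - {j})) = 0" if "j \<in> F" for j
    proof (cases "F - {j} \<subseteq> A")
      case True
      then have "j \<notin> A" using F that by auto
      then show ?thesis using w by (simp add: T_def)
    next
      case False
      then show ?thesis using w by (simp add: T_def Y_simps)
    qed
    then show ?thesis using F w by (simp add: D_def T_def \<delta>_simps)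
  qed
  moreover have "Y l (D w F) = 0" if "l \<notin> A" for l F
    using w that by (simp add: D_def T_def Y_simps \<delta>_Y[symmetric] Y_Y[of l] \<delta>_simps)
  ultimately show ?thesis using w D_Tot by (simp add: T_def)
qed

lemma D_insert_supported:
  assumes j: "j \<notin> A" and F: "F \<subseteq> A" and w: "\<And>F. F \<subseteq> A \<Longrightarrow> w (insert j F) = 0"
  shows "D w (insert j F) = sc (incidence_sign j (insert j F)) (Y j (w F))"
proof -
  have "finite F" "j \<notin> F" using j F by auto
  moreover have "w (insert j F - {l}) = 0" if "l \<in> F" for l
  proof -
    have "insert j F - {l} = insert j (F - {l})" using that j F by auto
    then show ?thesis using w[of "F - {l}"] F by auto
  qed
  ultimately show ?thesis by (simp add: D_def w[OF F] \<delta>_simps Y_simps)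
qed

text \<open>Modulo a coboundary, the values at all faces containing \<open>j\<close> can be made zero: the value at
  \<open>insert j F\<close> is \<open>Y j\<close> of something at \<open>F\<close>, by divisibility.\<close>

lemma clear_variable:
  assumes j: "j \<notin> A" and w: "w \<in> T (insert j A) i"
  shows "\<exists>u\<in>T (insert j A) (i - 1). \<forall>F\<subseteq>A. (w - D u) (insert j F) = 0"
proof -
  have "\<exists>x. x \<in> U (i - 1 - int (card F)) F \<and> Y j x = sc (incidence_sign j (insert j F)) (w (insert j F)) \<and>
      (\<forall>l\<in>- insert j A. Y l x = 0)" if F: "F \<subseteq> A" for F
  proof -
    have "j \<notin> F" using F j by auto
    moreover have "sc (incidence_sign j (insert j F)) (w (insert j F)) \<in> U (i - 1 - int (card F)) (insert j F)"
    proof -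
      have "w (insert j F) \<in> U (i - int (card (insert j F))) (insert j F)" using w by (simp add: T_def Tot_def)
      moreover have "i - int (card (insert j F)) = i - 1 - int (card F)" using \<open>j \<notin> F\<close> by simp
      ultimately show ?thesis by (simp add: U_closed)
    qed
    moreover have "\<forall>l\<in>- insert j A. Y l (sc (incidence_sign j (insert j F)) (w (insert j F))) = 0"
      using w by (auto simp: T_def Y_simps)
    ultimately show ?thesis using divide[of j F "- insert j A"] by blast
  qed
  then obtain h where h: "\<And>F. F \<subseteq> A \<Longrightarrow> h F \<in> U (i - 1 - int (card F)) F"
     "\<And>F. F \<subseteq> A \<Longrightarrow> Y j (h F) = sc (incidence_sign j (insert j F)) (w (insert j F))"
     "\<And>F l. F \<subseteq> A \<Longrightarrow> l \<notin> insert j A \<Longrightarrow> Y l (h F) = 0"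
    by (metis ComplI)
  define u where "u F = (if F \<subseteq> A then h F else 0)" for F
  have "u \<in> T (insert j A) (i - 1)"
    using h by (auto simp: u_def T_def Tot_def Y_simps)
  moreover have "(w - D u) (insert j F) = 0" if F: "F \<subseteq> A" for F
  proof -
    have "D u (insert j F) = sc (incidence_sign j (insert j F)) (Y j (u F))"
      by (rule D_insert_supported[OF j F]) (use j in \<open>auto simp: u_def\<close>)
    then show ?thesis using F h(2)[OF F] by (simp add: u_def)
  qed
  ultimately show ?thesis by blast
qed

text \<open>If both \<open>w\<close> and its differential vanish at the faces containing \<open>j\<close>, then the differential at
  \<open>insert j F\<close> is up to sign \<open>Y j (w F)\<close>, so \<open>w\<close> is killed by \<open>Y j\<close> and lies in the smaller subcomplex.\<close>

lemma T_insert_D: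
  assumes j: "j \<notin> A" and w: "w \<in> T (insert j A) i" and 0: "\<forall>F\<subseteq>A. w (insert j F) = 0"
    and D: "\<forall>F\<subseteq>A. D w (insert j F) = 0"
  shows "w \<in> T A i"
proof -
  have "w F = 0" if "\<not> F \<subseteq> A" for F
  proof (cases "F \<subseteq> insert j A")
    case True
    then have "F - {j} \<subseteq> A" "insert j (F - {j}) = F" using that by auto
    then show ?thesis using 0 by metis
  next
    case False
    then show ?thesis using w by (simp add: T_def)
  qed
  moreover have "Y j (w F) = 0" if "F \<subseteq> A" for F
    using D_insert_supported[OF j that, of w] D 0 that by (simp add: incidence_sign_def)
  ultimately show ?thesis using w unfolding T_def
    by (auto simp: Y_simps) (metis Y_simps(1))
qed

text \<open>The hypothesis on the differential covers two cases: for a cocycle the conclusion says that the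
  corner maps onto the cohomology of the total complex, and for \<open>w\<close> with \<open>D w\<close> in the corner it says
  that a corner element that is a coboundary is already the coboundary of a corner element.\<close>

lemma into_corner:
  assumes "w \<in> T A i" and "D w \<in> T {} (i + 1)"
  shows "\<exists>u\<in>T A (i - 1). w - D u \<in> T {} i"
proof -
  have "finite A" by simp
  then show ?thesis using assms
  proof (induction A arbitrary: w rule: finite_induct)
    case empty
    moreover have "0 \<in> T {} (i - 1)" by (simp add: T_def Tot_closed Y_simps)
    ultimately show ?case by (metis D_zero diff_zero)
  next
    case (insert j A)
    obtain u where u: "u \<in> T (insert j A) (i - 1)" "\<forall>F\<subseteq>A. (w - D u) (insert j F) = 0"
      using clear_variable insert.hyps insert.prems(1) by blast
    have Dw: "D (w - D u) = D w" by (simp add: D_diff D_D)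
    have "w - D u \<in> T (insert j A) i"
      using T_closed(2)[OF insert.prems(1)] D_T[OF u(1)] by simp
    moreover have "\<forall>F\<subseteq>A. D (w - D u) (insert j F) = 0"
      unfolding Dw using insert.prems(2) by (simp add: T_def)
    ultimately have "w - D u \<in> T A i"
      using T_insert_D[of j A "w - D u"] insert.hyps u(2) by blast
    then obtain u' where u': "u' \<in> T A (i - 1)" "w - D u - D u' \<in> T {} i"
      using insert.IH Dw insert.prems(2) by metis
    have "u' \<in> T (insert j A) (i - 1)" using u'(1) by (auto simp: T_def)
    then have "u + u' \<in> T (insert j A) (i - 1)" using u(1) T_closed by blast
    moreover have "w - D (u + u') \<in> T {} i" using u'(2) by (simp add: D_add algebra_simps)
    ultimately show ?case by blast
  qed
qed

lemma T_empty_incl: assumes "w \<in> T {} i"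
  shows "w = incl (w {})" "w {} \<in> U i {}" "Y j (w {}) = 0"
proof -
  show "w = incl (w {})" using assms by (auto simp: incl_def T_def)
  show "w {} \<in> U i {}" using assms unfolding T_def Tot_def by (auto dest: spec[of _ "{}"])
  show "Y j (w {}) = 0" using assms by (auto simp: T_def)
qed

lemma incl_Tot: "z \<in> U i {} \<Longrightarrow> incl z \<in> Tot i"
  by (auto simp: incl_def Tot_def)

lemma D_incl: assumes "\<And>j. Y j z = 0" shows "D (incl z) = incl (\<delta> z)"
proof (rule ext)
  fix F
  have "Y j (incl z F) = 0" for j F by (simp add: incl_def assms Y_simps)
  then show "D (incl z) F = incl (\<delta> z) F" by (simp add: D_def) (simp add: incl_def \<delta>_simps)
qed

text \<open>Exactness of the columns, used for \<open>card F = 0, 1, 2, \<dots>\<close> in turn: once the values at the smaller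
  faces vanish, the value at \<open>F\<close> is a \<open>\<delta>\<close>-cocycle of positive degree, hence can be removed.\<close>

lemma clear_low:
  assumes w: "w \<in> Tot i" and D: "\<And>F. int (card F) \<le> i \<Longrightarrow> D w F = 0"
  shows "\<exists>u\<in>Tot (i - 1). \<forall>F. int (card F) < i \<longrightarrow> (w - D u) F = 0"
proof -
  have "\<exists>u\<in>Tot (i - 1). \<forall>F. card F < p \<and> int (card F) < i \<longrightarrow> (w - D u) F = 0" for p
  proof (induction p)
    case 0
    then show ?case using Tot_closed(3) by auto
  next
    case (Suc p)
    then obtain u where u: "u \<in> Tot (i - 1)"
      and u0: "\<And>F. card F < p \<Longrightarrow> int (card F) < i \<Longrightarrow> (w - D u) F = 0" by blast
    show ?case
    proof (cases "int p < i")
      case False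
      then have "card F < p" if "int (card F) < i" for F :: "'n set" using that by linarith
      then show ?thesis using u u0 by metis
    next
      case True
      define w' where "w' = w - D u"
      have w': "w' \<in> Tot i" using w D_Tot[OF u] by (simp add: w'_def Tot_closed)
      have "\<exists>y. y \<in> U (i - 1 - int p) F \<and> \<delta> y = sc ((- 1) ^ p) (w' F)" if F: "card F = p" for F
      proof -
        have "D w' F = 0" using D F True by (simp add: w'_def D_diff D_D)
        moreover have "w' (F - {j}) = 0" if "j \<in> F" for j
        proof -
          have "card (F - {j}) < card F" using that by (intro psubset_card_mono) auto
          then have "card (F - {j}) < p" using F by simp
          then show ?thesis using u0 True unfolding w'_def by auto
        qed
        ultimately have "\<delta> (w' F) = 0" by (simp add: D_def Y_simps)
        moreover have "w' F \<in> U (i - int p) F" using w' F unfolding Tot_def by blast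
        ultimately have "\<exists>y\<in>U (i - int p - 1) F. \<delta> y = sc ((- 1) ^ p) (w' F)"
          using True by (intro exact) (auto simp: U_closed \<delta>_simps)
        then show ?thesis by (auto simp: algebra_simps)
      qed
      then obtain h where h: "\<And>F. card F = p \<Longrightarrow> h F \<in> U (i - 1 - int p) F"
         "\<And>F. card F = p \<Longrightarrow> \<delta> (h F) = sc ((- 1) ^ p) (w' F)" by metis
      define v where "v F = (if card F = p then h F else 0)" for F
      have v: "v \<in> Tot (i - 1)" using h by (auto simp: v_def Tot_def)
      have "(w' - D v) F = 0" if F: "card F < Suc p" "int (card F) < i" for F
      proof -
        have "v (F - {j}) = 0" if "j \<in> F" for j
        proof -
          have "card (F - {j}) < card F" using that by (intro psubset_card_mono) auto
          then show ?thesis using F by (simp add: v_def)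
        qed
        then have "D v F = sc ((- 1) ^ card F) (\<delta> (v F))" by (simp add: D_def Y_simps)
        moreover have "w' F = 0" if "card F \<noteq> p" using u0[of F] F that by (simp add: w'_def)
        ultimately show ?thesis by (auto simp: v_def h \<delta>_simps simp flip: power_add)
      qed
      then have "\<forall>F. card F < Suc p \<and> int (card F) < i \<longrightarrow> (w - D (u + v)) F = 0"
        by (simp add: w'_def D_add algebra_simps)
      then show ?thesis using Tot_closed(1)[OF u v] by blast
    qed
  qed
  note this[of "Suc (nat i)"]
  moreover have "card F < Suc (nat i)" if "int (card F) < i" for F :: "'n set" using that by linarith
  ultimately show ?thesis by metis
qed

text \<open>After \<open>clear_low\<close> only faces with \<open>card F \<ge> i\<close> remain. For \<open>card F > i\<close> the value lies in a space of
  negative degree, and for \<open>card F = i\<close> it is a \<open>\<delta>\<close>-cocycle of degree \<open>0\<close>, that is, a multiple of \<open>\<eta> F\<close>.\<close>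

lemma into_edge:
  assumes w: "w \<in> Tot i" and D: "\<And>F. int (card F) \<le> i \<Longrightarrow> D w F = 0"
  shows "\<exists>u\<in>Tot (i - 1). \<exists>c\<in>Coch i. w - D u = aug c"
proof -
  obtain u where u: "u \<in> Tot (i - 1)" and u0: "\<And>F. int (card F) < i \<Longrightarrow> (w - D u) F = 0"
    using clear_low[OF assms] by blast
  define w' where "w' = w - D u"
  have w': "w' \<in> Tot i" using w D_Tot[OF u] by (simp add: w'_def Tot_closed)
  have "\<exists>c. w' F = sc c (\<eta> F)" if F: "int (card F) = i" for F
  proof (rule kernel_0)
    have "w' F \<in> U (i - int (card F)) F" using w' by (simp add: Tot_def)
    then show "w' F \<in> U 0 F" using F by simp
    have "w' (F - {j}) = 0" if "j \<in> F" for j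
    proof -
      have "card (F - {j}) < card F" using that by (intro psubset_card_mono) auto
      then show ?thesis using u0 F unfolding w'_def by auto
    qed
    moreover have "D w' F = 0" using D F by (simp add: w'_def D_diff D_D)
    ultimately show "\<delta> (w' F) = 0" by (simp add: D_def Y_simps)
  qed
  then obtain h where h: "\<And>F. int (card F) = i \<Longrightarrow> w' F = sc (h F) (\<eta> F)" by metis
  define c where "c F = (if int (card F) = i \<and> F \<in> \<F> then h F else 0)" for F
  have "w' F = aug c F" for F
  proof -
    consider "int (card F) < i" | "int (card F) = i" | "int (card F) > i" by linarith
    then show ?thesis
    proof cases
      case 1 then show ?thesis using u0 by (simp add: w'_def aug_def c_def)
    next
      case 2 then show ?thesis using h \<eta>_eq_0[of F] by (auto simp: aug_def c_def)
    next
      case 3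
      have "w' F \<in> U (i - int (card F)) F" using w' by (simp add: Tot_def)
      then show ?thesis using U_neg[of "i - int (card F)" F] 3 by (simp add: aug_def c_def)
    qed
  qed
  moreover have "c \<in> Coch i" by (auto simp: face_cochains_def c_def)
  ultimately show ?thesis using u unfolding w'_def by blast
qed

lemma aug_Tot: assumes "c \<in> Coch i" shows "aug c \<in> Tot i"
proof -
  have "aug c F \<in> U (i - int (card F)) F" for F
    using assms \<eta>_U[of F] by (cases "c F = 0") (auto simp: aug_def face_cochains_def U_closed)
  then show ?thesis by (simp add: Tot_def)
qed

lemma D_aug: assumes c: "c \<in> Coch i" shows "D (aug c) = aug (cobd c)"
proof (rule ext)
  fix F
  have "Y j (aug c (F - {j})) = sc (c (F - {j})) (\<eta> F)" if "j \<in> F" for j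
  proof (cases "c (F - {j}) = 0")
    case True then show ?thesis by (simp add: aug_def Y_simps)
  next
    case False
    then have "F - {j} \<in> \<F>" using c by (auto simp: face_cochains_def)
    then show ?thesis using Y_\<eta>[of "F - {j}" j] that by (simp add: aug_def Y_simps insert_absorb)
  qed
  then have "D (aug c) F = (\<Sum>j\<in>F. sc (incidence_sign j F * c (F - {j})) (\<eta> F))"
    unfolding D_def by (simp add: aug_def[of _ F] \<delta>_simps \<delta>_\<eta>)
  then show "D (aug c) F = aug (cobd c) F"
    using \<eta>_eq_0[of F] by (auto simp: aug_def face_coboundary_def scale_sum_left)
qed

lemma aug_inj: 
  assumes "aug c = aug c'" "\<And>F. F \<notin> \<F> \<Longrightarrow> c F = 0" "\<And>F. F \<notin> \<F> \<Longrightarrow> c' F = 0"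
  shows "c = c'"
proof (rule ext)
  fix F show "c F = c' F"
    using assms(2,3)[of F] \<eta>_eq_0[of F] fun_cong[OF assms(1), of F] by (cases "F \<in> \<F>") (auto simp: aug_def)
qed

lemma aug_eq_0: 
  assumes "aug c = 0" "\<And>F. F \<notin> \<F> \<Longrightarrow> c F = 0" shows "c = (\<lambda>_. 0)"
  by (rule aug_inj) (use assms in \<open>auto simp: aug_def fun_eq_iff\<close>)

lemma linked_cochain:
  assumes z: "z \<in> U i {}" "\<delta> z = 0" "\<And>j. Y j z = 0"
  shows "\<exists>c. linked i z c"
proof -
  have D0: "D (incl z) = 0" using D_incl[of z] z by (simp add: incl_def fun_eq_iff)
  then obtain u c where u: "u \<in> Tot (i - 1)" and c: "c \<in> Coch i" and eq: "incl z - D u = aug c"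
    using into_edge[OF incl_Tot[OF z(1)]] by auto
  have "aug (cobd c) = D (incl z - D u)" using D_aug[OF c] eq by simp
  then have "aug (cobd c) = 0" by (simp add: D_diff D_D D0)
  then have "cobd c = (\<lambda>_. 0)" by (rule aug_eq_0) (simp add: face_coboundary_def)
  moreover have "incl z - aug c = D u" by (simp add: eq[symmetric])
  ultimately show ?thesis using z u c by (auto simp: linked_def)
qed

lemma linked_cocycle:
  assumes c: "c \<in> Coch i" "cobd c = (\<lambda>_. 0)"
  shows "\<exists>z. linked i z c"
proof -
  have D0: "D (aug c) = 0" by (simp add: D_aug[OF c(1)] c(2) aug_def fun_eq_iff)
  have "aug c \<in> T UNIV i" "D (aug c) \<in> T {} (i + 1)"
    using aug_Tot[OF c(1)] by (simp_all add: T_UNIV D0) (simp add: T_def Tot_closed Y_simps)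
  then obtain u where u: "u \<in> Tot (i - 1)" "aug c - D u \<in> T {} i"
    using into_corner by (metis T_UNIV)
  define z where "z = (aug c - D u) {}"
  have z: "incl z = aug c - D u" "z \<in> U i {}" "\<And>j. Y j z = 0"
    using T_empty_incl[OF u(2)] unfolding z_def by (simp_all only:)
  have "incl (\<delta> z) = 0" using D_incl[OF z(3)] z(1) by (simp add: D_diff D_D D0)
  then have "\<delta> z = 0" by (auto simp: incl_def fun_eq_iff split: if_splits)
  moreover have "incl z - aug c = D (- u)" using z(1) by (simp add: D_uminus)
  ultimately show ?thesis using z c u(1) Tot_closed(4) unfolding linked_def by blast
qed

text \<open>From left to right, \<open>aug c\<close> is \<open>D\<close> of a total cochain, which \<open>into_edge\<close> moves into the edge; from right
  to left, \<open>incl z\<close> is \<open>D\<close> of a total cochain, which \<open>into_corner\<close> moves into the corner.\<close>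

lemma linked_coboundary:
  assumes l: "linked i z c"
  shows "(\<exists>y\<in>U (i - 1) {}. (\<forall>j. Y j y = 0) \<and> \<delta> y = z) \<longleftrightarrow> (\<exists>b\<in>Coch (i - 1). cobd b = c)"
proof -
  obtain v where v: "v \<in> Tot (i - 1)" "incl z - aug c = D v" and c: "c \<in> Coch i"
    using l by (auto simp: linked_def)
  show ?thesis
  proof
    assume "\<exists>y\<in>U (i - 1) {}. (\<forall>j. Y j y = 0) \<and> \<delta> y = z"
    then obtain y where y: "y \<in> U (i - 1) {}" "\<And>j. Y j y = 0" "\<delta> y = z" by blast
    define x where "x = incl y - v"
    have x: "x \<in> Tot (i - 1)" using incl_Tot[OF y(1)] v(1) by (simp add: x_def Tot_closed)
    have Dx: "D x = aug c" using D_incl[OF y(2)] y(3) by (simp add: x_def D_diff flip: v(2))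
    have "D x F = 0" if "int (card F) \<le> i - 1" for F
    proof -
      have "int (card F) \<noteq> i" using that by simp
      then have "c F = 0" using c by (auto simp: face_cochains_def)
      then show ?thesis by (simp add: Dx aug_def)
    qed
    then obtain u b where u: "u \<in> Tot (i - 1 - 1)" and b: "b \<in> Coch (i - 1)" "x - D u = aug b"
      using into_edge[OF x] by blast
    have "aug c = aug (cobd b)" unfolding D_aug[OF b(1), symmetric] b(2)[symmetric] by (simp add: D_diff D_D Dx)
    then have "c = cobd b" by (rule aug_inj) (use c in \<open>auto simp: face_cochains_def face_coboundary_def\<close>)
    then show "\<exists>b\<in>Coch (i - 1). cobd b = c" using b(1) by blast
  next
    assume "\<exists>b\<in>Coch (i - 1). cobd b = c"
    then obtain b where b: "b \<in> Coch (i - 1)" "cobd b = c" by blast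
    define x where "x = v + aug b"
    have Dx: "D x = incl z" by (simp add: x_def D_add D_aug[OF b(1)] b(2) v(2)[symmetric])
    have "x \<in> T UNIV (i - 1)" using v(1) aug_Tot[OF b(1)] by (simp add: x_def T_UNIV Tot_closed)
    moreover have "D x \<in> T {} (i - 1 + 1)"
      using l by (auto simp: Dx T_def incl_def Y_simps linked_def Tot_def)
    ultimately obtain u where u: "u \<in> Tot (i - 1 - 1)" "x - D u \<in> T {} (i - 1)"
      using into_corner T_UNIV by metis
    define y where "y = (x - D u) {}"
    have y: "x - D u = incl y" "y \<in> U (i - 1) {}" "\<And>j. Y j y = 0"
      using T_empty_incl[OF u(2)] unfolding y_def by (simp_all only:)
    have "incl (\<delta> y) = incl z" using D_incl[OF y(3)] by (simp add: D_diff D_D Dx flip: y(1))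
    then have "\<delta> y = z" by (auto simp: incl_def fun_eq_iff split: if_splits)
    then show "\<exists>y\<in>U (i - 1) {}. (\<forall>j. Y j y = 0) \<and> \<delta> y = z" using y by blast
  qed
qed

lemma linked_add:
  assumes "linked i z c" "linked i z' c'"
  shows "linked i (z + z') (\<lambda>F. c F + c' F)"
proof -
  obtain v v' where v: "v \<in> Tot (i - 1)" "incl z - aug c = D v" "v' \<in> Tot (i - 1)" "incl z' - aug c' = D v'"
    using assms by (auto simp: linked_def)
  have "incl (z + z') = incl z + incl z'" "aug (\<lambda>F. c F + c' F) = aug c + aug c'"
    by (auto simp: incl_def aug_def fun_eq_iff scale_left_distrib)
  then have "incl (z + z') - aug (\<lambda>F. c F + c' F) = D (v + v')"
    unfolding D_add v(2)[symmetric] v(4)[symmetric] by (simp add: algebra_simps)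
  moreover have "(\<lambda>F. c F + c' F) \<in> Coch i"
    using assms by (simp add: linked_def face_cochains_closed)
  moreover have "z + z' \<in> U i {}" "\<delta> (z + z') = 0" "\<forall>j. Y j (z + z') = 0"
      "cobd (\<lambda>F. c F + c' F) = (\<lambda>_. 0)"
    using assms by (simp_all add: linked_def U_closed \<delta>_simps Y_simps face_coboundary_add)
  ultimately show ?thesis using Tot_closed(1)[OF v(1,3)] unfolding linked_def by blast
qed

lemma linked_scale:
  assumes "linked i z c"
  shows "linked i (sc r z) (\<lambda>F. r * c F)"
proof -
  obtain v where v: "v \<in> Tot (i - 1)" "incl z - aug c = D v"
    using assms by (auto simp: linked_def)
  have "incl (sc r z) - aug (\<lambda>F. r * c F) = D (\<lambda>F. sc r (v F))"
    unfolding D_scale v(2)[symmetric]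
    by (auto simp: incl_def aug_def fun_eq_iff scale_right_diff_distrib)
  moreover have "(\<lambda>F. r * c F) \<in> Coch i" using assms by (auto simp: linked_def face_cochains_def)
  moreover have "sc r z \<in> U i {}" "\<delta> (sc r z) = 0" "\<forall>j. Y j (sc r z) = 0" "cobd (\<lambda>F. r * c F) = (\<lambda>_. 0)"
    using assms by (simp_all add: linked_def U_closed \<delta>_simps Y_simps face_coboundary_scale)
  ultimately show ?thesis using Tot_closed(5)[OF v(1)] unfolding linked_def by blast
qed

end

section \<open>Letting the exponent grow\<close>

text \<open>The degree $b + t e_F$.\<close>

definition shift :: "('n \<Rightarrow> int) \<Rightarrow> nat \<Rightarrow> 'n set \<Rightarrow> 'n \<Rightarrow> int" where
  "shift b t F = (\<lambda>i. if i \<in> F then b i + int t else b i)"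

lemma shift_0 [simp]: "shift b 0 F = b"
  by (auto simp: shift_def)

lemma shift_empty [simp]: "shift b t {} = b"
  by (simp add: shift_def)

lemma shift_shift: "shift (shift b s F) t F = shift b (s + t) F"
  by (auto simp: shift_def)

lemma shift_insert: "j \<notin> F \<Longrightarrow> shift (shift b t F) t {j} = shift b t (insert j F)"
  by (auto simp: shift_def)

text \<open>The data of \<open>koszul\<close> for all exponents at once, with \<open>\<xi> j\<close> for multiplication by $x_j$ and \<open>V q b\<close> for
  the component of $E^q$ in degree \<open>b\<close>. The set \<open>P\<close> consists of the degrees of the monomials in $I$: if
  \<open>b\<close> is outside \<open>P\<close>, then \<open>\<eta> b = 0\<close> while \<open>\<eta>\<close> may be nonzero in a larger degree, so the
  multiplication rule for \<open>\<eta>\<close> can only be asked for inside \<open>P\<close>. From \<open>t0\<close> on, the faces that carry a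
  nonzero monomial do not change any more.\<close>

locale multigraded_resolution = vector_space sc for sc :: "'k::field \<Rightarrow> 'w::ab_group_add \<Rightarrow> 'w" +
  fixes \<delta> :: "'w \<Rightarrow> 'w" and \<xi> :: "'n::{finite, linorder} \<Rightarrow> 'w \<Rightarrow> 'w"
    and V :: "int \<Rightarrow> ('n \<Rightarrow> int) \<Rightarrow> 'w set" and \<eta> :: "('n \<Rightarrow> int) \<Rightarrow> 'w" and P :: "('n \<Rightarrow> int) set"
    and a :: "'n \<Rightarrow> int" and t0 :: nat and \<F> :: "'n set set"
  assumes lin_\<delta>: "Vector_Spaces.linear sc sc \<delta>" and lin_\<xi>: "\<And>j. Vector_Spaces.linear sc sc (\<xi> j)"
    and subspace_V: "\<And>q b. subspace (V q b)"
    and \<delta>_V: "\<And>q b x. x \<in> V q b \<Longrightarrow> \<delta> x \<in> V (q + 1) b"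
    and \<xi>_V: "\<And>q b j x. x \<in> V q b \<Longrightarrow> \<xi> j x \<in> V q (shift b 1 {j})"
    and \<delta>_\<delta>: "\<And>x. \<delta> (\<delta> x) = 0" and \<delta>_\<xi>: "\<And>j x. \<delta> (\<xi> j x) = \<xi> j (\<delta> x)"
    and \<xi>_\<xi>: "\<And>j l x. \<xi> j (\<xi> l x) = \<xi> l (\<xi> j x)"
    and V_neg: "\<And>q b. q < 0 \<Longrightarrow> V q b = {0}"
    and exact: "\<And>q b x. q > 0 \<Longrightarrow> x \<in> V q b \<Longrightarrow> \<delta> x = 0 \<Longrightarrow> \<exists>y\<in>V (q - 1) b. \<delta> y = x"
    and kernel_0: "\<And>b x. x \<in> V 0 b \<Longrightarrow> \<delta> x = 0 \<Longrightarrow> \<exists>c. x = sc c (\<eta> b)"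
    and \<eta>_V: "\<And>b. \<eta> b \<in> V 0 b" and \<delta>_\<eta>: "\<And>b. \<delta> (\<eta> b) = 0"
    and \<eta>_P: "\<And>b. \<eta> b \<noteq> 0 \<Longrightarrow> b \<in> P"
    and P_shift: "\<And>b j. b \<in> P \<Longrightarrow> shift b 1 {j} \<in> P"
    and \<xi>_\<eta>: "\<And>b j. b \<in> P \<Longrightarrow> \<xi> j (\<eta> b) = \<eta> (shift b 1 {j})"
    and divide: "\<And>q b l A y t. l \<notin> A \<Longrightarrow> y \<in> V q (shift b t {l}) \<Longrightarrow> (\<forall>j\<in>A. (\<xi> j ^^ t) y = 0) \<Longrightarrow>
       \<exists>x\<in>V q b. (\<xi> l ^^ t) x = y \<and> (\<forall>j\<in>A. (\<xi> j ^^ t) x = 0)"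
    and stable: "\<And>t F. t \<ge> t0 \<Longrightarrow> \<eta> (shift a t F) \<noteq> 0 \<longleftrightarrow> F \<in> \<F>"
begin

lemmas \<xi>_simps = linear_simps[OF lin_\<xi>]

abbreviation Xp :: "nat \<Rightarrow> 'n \<Rightarrow> 'w \<Rightarrow> 'w" where "Xp t j \<equiv> \<xi> j ^^ t"

lemma Xp_simps: "Xp t j 0 = 0" "Xp t j (x + y) = Xp t j x + Xp t j y" 
  "Xp t j (sc c x) = sc c (Xp t j x)" "\<delta> (Xp t j x) = Xp t j (\<delta> x)" "Xp t j (\<xi> l x) = \<xi> l (Xp t j x)"
  by (induction t) (simp_all add: \<xi>_simps \<delta>_\<xi> \<xi>_\<xi>[of j l])

lemma Xp_Xp: "Xp t j (Xp s l x) = Xp s l (Xp t j x)"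
  by (induction t) (simp_all add: Xp_simps)

lemma Xp_V: "x \<in> V q b \<Longrightarrow> Xp t j x \<in> V q (shift b t {j})"
proof (induction t)
  case (Suc t)
  then show ?case using \<xi>_V[of "Xp t j x" q "shift b t {j}" j] by (simp add: shift_shift)
qed simp

lemma Xp_\<eta>: "b \<in> P \<Longrightarrow> shift b t {j} \<in> P \<and> Xp t j (\<eta> b) = \<eta> (shift b t {j})"
proof (induction t)
  case (Suc t)
  then show ?case using P_shift[of "shift b t {j}" j] \<xi>_\<eta>[of "shift b t {j}" j] by (simp add: shift_shift)
qed simp

lemma Xp_mono: "Xp s j x = 0 \<Longrightarrow> s \<le> t \<Longrightarrow> Xp t j x = 0"
  by (metis Xp_simps(1) funpow_add o_apply le_add_diff_inverse2)

lemma koszul: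
  assumes "t \<ge> t0"
  shows "koszul sc \<delta> (Xp t) (\<lambda>q F. V q (shift a t F)) (\<lambda>F. \<eta> (shift a t F)) \<F>"
proof
  show "\<exists>x\<in>V q (shift a t F). Xp t l x = y \<and> (\<forall>j\<in>A. Xp t j x = 0)"
    if "l \<notin> F" "l \<notin> A" "y \<in> V q (shift a t (insert l F))" "\<forall>j\<in>A. Xp t j y = 0" for q F l A y
    by (rule divide) (use that in \<open>simp_all add: shift_insert\<close>)
  show "Xp t j x \<in> V q (shift a t (insert j F))" if "x \<in> V q (shift a t F)" "j \<notin> F" for q F j x
    using Xp_V[OF that(1), of t j] that(2) by (simp add: shift_insert)
  show "Xp t j (\<eta> (shift a t F)) = \<eta> (shift a t (insert j F))" if "F \<in> \<F>" "j \<notin> F" for F j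
  proof -
    have "shift a t F \<in> P" using stable[OF assms] that \<eta>_P by blast
    then show ?thesis using Xp_\<eta> that shift_insert[of j F a t] by metis
  qed
  show "\<eta> (shift a t F) = 0 \<longleftrightarrow> F \<notin> \<F>" for F using stable[OF assms] by blast
  show "Xp t j (x + y) = Xp t j x + Xp t j y" "Xp t j (sc r x) = sc r (Xp t j x)" for j x y r
    by (simp_all add: Xp_simps)
  interpret l: Vector_Spaces.linear sc sc \<delta> by (rule lin_\<delta>)
  show "\<delta> (x + y) = \<delta> x + \<delta> y" "\<delta> (sc r x) = sc r (\<delta> x)" for x y r
    by (rule l.add l.scale)+
qed (simp_all add: subspace_V \<delta>_V \<delta>_\<delta> Xp_simps Xp_Xp V_neg exact kernel_0 \<eta>_V \<delta>_\<eta>)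

abbreviation link :: "nat \<Rightarrow> int \<Rightarrow> 'w \<Rightarrow> ('n set \<Rightarrow> 'k) \<Rightarrow> bool" where
  "link t \<equiv> koszul.linked sc \<delta> (Xp t) (\<lambda>q F. V q (shift a t F)) (\<lambda>F. \<eta> (shift a t F)) \<F>"

text \<open>Multiplication by $\prod_{j \in F} x_j$, which maps degree $a + t e_F$ to degree $a + (t+1) e_F$.\<close>

definition Xprod :: "'n set \<Rightarrow> 'w \<Rightarrow> 'w" where
  "Xprod F x = Finite_Set.fold \<xi> x F"

lemma Xprod_empty: "Xprod {} x = x"
  by (simp add: Xprod_def)

lemma Xprod_insert: 
  assumes "j \<notin> F" shows "Xprod (insert j F) x = \<xi> j (Xprod F x)"
proof -
  interpret comp_fun_commute \<xi> by standard (simp add: fun_eq_iff \<xi>_\<xi>)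
  show ?thesis unfolding Xprod_def using assms by (intro fold_insert) auto
qed

lemma Xprod_simps: "Xprod F 0 = 0" "Xprod F (x + y) = Xprod F x + Xprod F y"
  "Xprod F (x - y) = Xprod F x - Xprod F y"
  "Xprod F (sc c x) = sc c (Xprod F x)" "\<delta> (Xprod F x) = Xprod F (\<delta> x)"
  "Xprod F (\<xi> l x) = \<xi> l (Xprod F x)"
proof -
  have "finite F" by simp
  then show "Xprod F 0 = 0" "Xprod F (x + y) = Xprod F x + Xprod F y"
  "Xprod F (x - y) = Xprod F x - Xprod F y"
  "Xprod F (sc c x) = sc c (Xprod F x)" "\<delta> (Xprod F x) = Xprod F (\<delta> x)"
  "Xprod F (\<xi> l x) = \<xi> l (Xprod F x)"
    by (induction F rule: finite_induct) (simp_all add: Xprod_empty Xprod_insert \<xi>_simps \<delta>_\<xi> \<xi>_\<xi>[of _ l])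
qed

lemma Xprod_Xp: "Xprod F (Xp t l x) = Xp t l (Xprod F x)"
  by (induction t) (simp_all add: Xprod_simps)

lemma Xprod_sum: "Xprod F (sum f A) = (\<Sum>x\<in>A. Xprod F (f x))"
  by (induction A rule: infinite_finite_induct) (simp_all add: Xprod_simps)

lemma Xprod_V: "x \<in> V q b \<Longrightarrow> Xprod F x \<in> V q (shift b 1 F)"
proof -
  assume x: "x \<in> V q b"
  have "finite F" by simp
  then show ?thesis
  proof (induction F rule: finite_induct)
    case (insert j F)
    then show ?case using \<xi>_V[of "Xprod F x" q "shift b 1 F" j] by (simp add: Xprod_insert shift_insert)
  qed (simp add: x Xprod_empty)
qed

lemma Xprod_\<eta>: assumes "b \<in> P" shows "shift b 1 F \<in> P \<and> Xprod F (\<eta> b) = \<eta> (shift b 1 F)"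
proof -
  have "finite F" by simp
  then show ?thesis
  proof (induction F rule: finite_induct)
    case (insert j F)
    then show ?case using P_shift[of "shift b 1 F" j] \<xi>_\<eta>[of "shift b 1 F" j]
      by (simp add: Xprod_insert shift_insert)
  qed (simp add: assms Xprod_empty)
qed

text \<open>Multiplying the value at \<open>F\<close> by $\prod_{j \in F} x_j$ is a morphism from the double complex for \<open>t\<close> to
  the one for \<open>t + 1\<close>. It fixes the corner, and on the edge it maps monomials to monomials.\<close>

lemma link_Suc:
  assumes t: "t \<ge> t0" and l: "link t i z c" shows "link (Suc t) i z c"
proof -
  interpret K: koszul sc \<delta> "Xp t" "\<lambda>q F. V q (shift a t F)" "\<lambda>F. \<eta> (shift a t F)" \<F>
    by (rule koszul[OF t])
  interpret L: koszul sc \<delta> "Xp (Suc t)" "\<lambda>q F. V q (shift a (Suc t) F)" "\<lambda>F. \<eta> (shift a (Suc t) F)" \<F>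
    by (rule koszul) (use t in simp)
  obtain v where v: "v \<in> K.Tot (i - 1)" "K.incl z - K.aug c = K.D v" and c: "c \<in> K.Coch i"
    using l by (auto simp: K.linked_def)
  \<comment> \<open>The product of the variables in F raises the exponents from t to t + 1 exactly at F.\<close>
  define v' where "v' F = Xprod F (v F)" for F
  have "v' F \<in> V (i - 1 - int (card F)) (shift a (Suc t) F)" for F
    using v(1) Xprod_V[of "v F" "i - 1 - int (card F)" "shift a t F" F]
    by (simp add: K.Tot_def v'_def shift_shift)
  then have "v' \<in> L.Tot (i - 1)" by (simp add: L.Tot_def)
  moreover have "L.incl z - L.aug c = L.D v'"
  proof (rule ext)
    fix F
    have s: "Xprod F (Xp t j (v (F - {j}))) = Xp (Suc t) j (v' (F - {j}))" if "j \<in> F" for j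
      using Xprod_insert[of j "F - {j}"] that by (simp add: insert_absorb Xprod_Xp Xp_simps v'_def)
    have "Xprod F (K.incl z F) = L.incl z F" by (simp add: K.incl_def L.incl_def Xprod_empty Xprod_simps)
    moreover have "Xprod F (K.aug c F) = L.aug c F"
    proof (cases "c F = 0")
      case False
      then have "shift a t F \<in> P" using c stable[OF t] \<eta>_P unfolding face_cochains_def by blast
      then show ?thesis using Xprod_\<eta>[of "shift a t F" F]
        by (simp add: K.aug_def L.aug_def Xprod_simps shift_shift)
    qed (simp add: K.aug_def L.aug_def Xprod_simps)
    ultimately have "(L.incl z - L.aug c) F = Xprod F ((K.incl z - K.aug c) F)" by (simp add: Xprod_simps)
    also have "\<dots> = L.D v' F"
      unfolding v(2) K.D_def L.D_def
      by (simp add: Xprod_simps Xprod_sum s v'_def[of F] del: funpow.simps)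
    finally show "(L.incl z - L.aug c) F = L.D v' F" .
  qed
  ultimately show ?thesis
    using l unfolding K.linked_def L.linked_def by (auto simp: \<xi>_simps)
qed

lemma link_mono:
  assumes "t \<ge> t0" "t \<le> s" "link t i z c" shows "link s i z c"
  using assms(2)
proof (induction s rule: dec_induct)
  case (step s)
  then show ?case using assms(1) by (intro link_Suc) auto
qed (rule assms)

text \<open>The cocycles and coboundaries of $\Gamma_{\mathfrak m}(E)$ in degree \<open>a\<close>.\<close>

definition torsion_cocycles :: "int \<Rightarrow> 'w set" where
  "torsion_cocycles i = {z \<in> V i a. \<delta> z = 0 \<and> (\<exists>t. \<forall>j. Xp t j z = 0)}"

definition torsion_coboundaries :: "int \<Rightarrow> 'w set" where
  "torsion_coboundaries i = \<delta> ` {y \<in> V (i - 1) a. \<exists>t. \<forall>j. Xp t j y = 0}"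

definition rel :: "int \<Rightarrow> 'w \<Rightarrow> ('n set \<Rightarrow> 'k) \<Rightarrow> bool" where
  "rel i z c \<longleftrightarrow> (\<exists>t\<ge>t0. link t i z c)"

lemma rel_D: "rel i z c \<Longrightarrow> z \<in> torsion_cocycles i \<and> c \<in> face_cochains \<F> i \<and> face_coboundary \<F> c = (\<lambda>_. 0)"
  unfolding rel_def torsion_cocycles_def using koszul.linked_def[OF koszul] by fastforce

lemma rel_total: assumes "z \<in> torsion_cocycles i" shows "\<exists>c. rel i z c"
proof -
  obtain t where "\<forall>j. Xp t j z = 0" and z: "z \<in> V i a" "\<delta> z = 0" using assms by (auto simp: torsion_cocycles_def)
  then have "\<And>j. Xp (max t t0) j z = 0" using Xp_mono by (meson max.cobounded1)
  then have "\<exists>c. link (max t t0) i z c"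
    using koszul.linked_cochain[OF koszul, of "max t t0" z i] z by simp
  then show ?thesis unfolding rel_def using max.cobounded2 by blast
qed

lemma rel_surj:
  assumes "c \<in> face_cochains \<F> i" "face_coboundary \<F> c = (\<lambda>_. 0)" shows "\<exists>z. rel i z c"
  unfolding rel_def using koszul.linked_cocycle[OF koszul, of t0] assms by blast

lemma rel_add: assumes "rel i z c" "rel i z' c'" shows "rel i (z + z') (\<lambda>F. c F + c' F)"
proof -
  obtain t t' where t: "t \<ge> t0" "link t i z c" "t' \<ge> t0" "link t' i z' c'" using assms by (auto simp: rel_def)
  define s where "s = max t t'"
  have "link s i z c" "link s i z' c'" "s \<ge> t0" using t by (auto simp: s_def intro: link_mono)
  then show ?thesis unfolding rel_def using koszul.linked_add[OF koszul] by blast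
qed

lemma rel_scale: "rel i z c \<Longrightarrow> rel i (sc r z) (\<lambda>F. r * c F)"
  unfolding rel_def using koszul.linked_scale[OF koszul] by blast

lemma rel_coboundary:
  assumes "rel i z c"
  shows "z \<in> torsion_coboundaries i \<longleftrightarrow> c \<in> face_coboundary \<F> ` face_cochains \<F> (i - 1)"
proof -
  obtain t where t: "t \<ge> t0" "link t i z c" using assms by (auto simp: rel_def)
  have iff: "(\<exists>y\<in>V (i - 1) a. (\<forall>j. Xp s j y = 0) \<and> \<delta> y = z)
      \<longleftrightarrow> (\<exists>b\<in>face_cochains \<F> (i - 1). face_coboundary \<F> b = c)" if "t \<le> s" for s
    using koszul.linked_coboundary[OF koszul link_mono[OF t(1) that t(2)]] t(1) that by simp
  show ?thesis
  proof
    assume "z \<in> torsion_coboundaries i"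
    then obtain y s where y: "y \<in> V (i - 1) a" "\<forall>j. Xp s j y = 0" "\<delta> y = z"
      by (auto simp: torsion_coboundaries_def)
    have "\<forall>j. Xp (max t s) j y = 0" using y(2) Xp_mono by (meson max.cobounded2)
    then show "c \<in> face_coboundary \<F> ` face_cochains \<F> (i - 1)" using iff[of "max t s"] y by auto
  next
    assume "c \<in> face_coboundary \<F> ` face_cochains \<F> (i - 1)"
    then show "z \<in> torsion_coboundaries i" using iff[of t] unfolding torsion_coboundaries_def by blast
  qed
qed

end

section \<open>Monomials\<close>

lemma poly_sum_terms:
  fixes p :: "'m \<Rightarrow>\<^sub>0 'k::comm_monoid_add"
  shows "(\<Sum>m\<in>keys p. single m (lookup p m)) = p"
  by (rule poly_mapping_eqI)
    (simp add: lookup_sum lookup_single when_def in_keys_iff sum.delta flip: if_distrib)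

lemma poly_induct_terms [case_names zero add monomial]:
  fixes p :: "'m \<Rightarrow>\<^sub>0 'k::comm_monoid_add"
  assumes "Q 0" "\<And>p q. Q p \<Longrightarrow> Q q \<Longrightarrow> Q (p + q)"
    and "\<And>m. m \<in> keys p \<Longrightarrow> Q (single m (lookup p m))"
  shows "Q p"
proof -
  have "Q (\<Sum>m\<in>S. single m (lookup p m))" if "finite S" "S \<subseteq> keys p" for S
    using that by (induction S rule: finite_induct) (simp_all add: assms)
  from this[of "keys p"] show ?thesis by (simp add: poly_sum_terms)
qed

text \<open>Polynomials supported on the monomials in \<open>G\<close> represent the residue classes modulo the monomial
  ideal spanned by the other monomials, and \<open>restrict_terms\<close> is reduction to this normal form.\<close>

definition restrict_terms :: "'m set \<Rightarrow> ('m \<Rightarrow>\<^sub>0 'k::comm_monoid_add) \<Rightarrow> 'm \<Rightarrow>\<^sub>0 'k" where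
  "restrict_terms G p = Poly_Mapping.mapp (\<lambda>m c. c when m \<in> G) p"

lemma lookup_restrict_terms: "lookup (restrict_terms G p) m = (lookup p m when m \<in> G)"
  by (simp add: restrict_terms_def lookup_mapp when_def in_keys_iff)

lemma keys_restrict_terms: "keys (restrict_terms G p) = keys p \<inter> G"
  by (auto simp: in_keys_iff lookup_restrict_terms when_def split: if_splits)

lemma restrict_terms_add: "restrict_terms G (p + q) = restrict_terms G p + restrict_terms G q"
  by (rule poly_mapping_eqI) (simp add: lookup_restrict_terms lookup_add when_def)

lemma restrict_terms_diff:
  "restrict_terms G (p - q) = restrict_terms G p - restrict_terms G (q :: 'm \<Rightarrow>\<^sub>0 'k::ab_group_add)"
  by (rule poly_mapping_eqI) (simp add: lookup_restrict_terms lookup_minus when_def)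

lemma restrict_terms_id: "keys p \<subseteq> G \<Longrightarrow> restrict_terms G p = p"
  by (rule poly_mapping_eqI) (auto simp: lookup_restrict_terms when_def in_keys_iff)

lemma restrict_terms_eq_0: "keys p \<inter> G = {} \<Longrightarrow> restrict_terms G p = 0"
  by (rule poly_mapping_eqI) (auto simp: lookup_restrict_terms when_def in_keys_iff)

text \<open>Closure under divisors, so that the monomials outside \<open>G\<close> span an ideal.\<close>

definition order_ideal :: "'m::comm_monoid_add set \<Rightarrow> bool" where
  "order_ideal G \<longleftrightarrow> (\<forall>m n. m + n \<in> G \<longrightarrow> n \<in> G)"

lemma restrict_terms_mult:
  fixes p r :: "'m::comm_monoid_add \<Rightarrow>\<^sub>0 'k::comm_ring"
  assumes "order_ideal G"
  shows "restrict_terms G (r * restrict_terms G p) = restrict_terms G (r * p)"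
proof -
  have "keys (r * (p - restrict_terms G p)) \<inter> G = {}"
  proof -
    have "n \<notin> G" if "n \<in> keys (p - restrict_terms G p)" for n
      using that by (auto simp: in_keys_iff lookup_minus lookup_restrict_terms when_def)
    then show ?thesis using keys_mult[of r "p - restrict_terms G p"] assms
      unfolding order_ideal_def by blast
  qed
  then have "restrict_terms G (r * (p - restrict_terms G p)) = 0" by (rule restrict_terms_eq_0)
  then show ?thesis by (simp add: right_diff_distrib restrict_terms_diff)
qed

lemma term_mult_restrict:
  fixes p :: "'m::comm_monoid_add \<Rightarrow>\<^sub>0 'k::comm_ring"
  assumes "\<And>n. m + n \<in> G \<longleftrightarrow> n \<in> G"
  shows "restrict_terms G (single m c * p) = single m c * restrict_terms G p"
proof (induction p rule: poly_induct_terms)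
  case (monomial n)
  have "restrict_terms G (single n d) = (if n \<in> G then single n d else 0)" for n and d :: 'k
    by (rule poly_mapping_eqI) (auto simp: lookup_restrict_terms lookup_single when_def)
  then show ?case by (simp add: mult_single assms)
qed (simp_all add: restrict_terms_add distrib_left restrict_terms_eq_0)

lemma lookup_term_mult:
  fixes p :: "'m::cancel_comm_monoid_add \<Rightarrow>\<^sub>0 'k::comm_ring"
  shows "lookup (single m c * p) (m + n) = c * lookup p n"
  by (induction p rule: poly_induct_terms)
    (auto simp: mult_single lookup_single when_def distrib_left lookup_add)

lemma term_mult_inj:
  fixes p q :: "'m::cancel_comm_monoid_add \<Rightarrow>\<^sub>0 'k::comm_ring_1"
  assumes "single m 1 * p = single m 1 * q"
  shows "p = q"
  by (rule poly_mapping_eqI) (metis assms lookup_term_mult mult_1)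

lemma monomial_decompose:
  fixes m :: "'n \<Rightarrow>\<^sub>0 nat"
  assumes "\<And>i. lookup n i \<le> lookup m i"
  shows "m = (m - n) + n"
  by (rule poly_mapping_eqI) (simp add: lookup_add lookup_minus assms)

abbreviation x_pow :: "nat \<Rightarrow> 'n \<Rightarrow> ('n, 'k::field) mpoly" where
  "x_pow t j \<equiv> single (single j t) 1"

section \<open>Graded modules\<close>

lemma poly_ring_simps [simp]:
  "carrier (ring_of_type_algebra :: 'a::ring_1 ring) = UNIV"
  "monoid.mult (ring_of_type_algebra :: 'a ring) = (*)"
  "one (ring_of_type_algebra :: 'a ring) = 1"
  "ring.zero (ring_of_type_algebra :: 'a ring) = 0"
  "ring.add (ring_of_type_algebra :: 'a ring) = (+)"
  by (simp_all add: ring_of_type_algebra_def)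

locale graded_module =
  fixes M :: "('n::finite, 'k::field, 'm) multigraded" (structure)
  assumes mg: "multigraded_module M"
begin

sublocale M: module "poly_ring :: ('n, 'k) mpoly ring" M
  using mg by (simp add: multigraded_module_def)

lemma part_subgroup: "subgroup (degree_part M a) (add_monoid M)"
  using mg by (simp add: multigraded_module_def)

lemma part_carrier: "x \<in> degree_part M a \<Longrightarrow> x \<in> carrier M"
  using subgroup.subset[OF part_subgroup] by auto

lemma part_zero: "\<zero> \<in> degree_part M a"
  using subgroup.one_closed[OF part_subgroup] by simp

lemma part_add: "x \<in> degree_part M a \<Longrightarrow> y \<in> degree_part M a \<Longrightarrow> x \<oplus> y \<in> degree_part M a"
  using subgroup.m_closed[OF part_subgroup] by simp

lemma part_minus: "x \<in> degree_part M a \<Longrightarrow> \<ominus> x \<in> degree_part M a"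
  using subgroup.m_inv_closed[OF part_subgroup] unfolding a_inv_def by auto

lemma part_term: "x \<in> degree_part M a \<Longrightarrow>
   single m c \<odot> x \<in> degree_part M (\<lambda>i. a i + int (lookup m i))"
  using mg by (simp add: multigraded_module_def term_of_def)

lemma part_pow:
  assumes "x \<in> degree_part M a"
  shows "x_pow t j \<odot> x \<in> degree_part M (shift a t {j})"
proof -
  have "(\<lambda>i. a i + int (lookup (single j t) i)) = shift a t {j}"
    by (auto simp: shift_def lookup_single when_def)
  then show ?thesis using part_term[OF assms] by metis
qed

lemma part_scalar: "x \<in> degree_part M a \<Longrightarrow> single 0 c \<odot> x \<in> degree_part M a"
  using part_term[of x a 0] by simp

lemma smult_poly_add: "x \<in> carrier M \<Longrightarrow> (p + q) \<odot> x = p \<odot> x \<oplus> q \<odot> x"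
  using M.smult_l_distr[of p q x] by simp

lemma smult_poly_mult: "x \<in> carrier M \<Longrightarrow> (p * q) \<odot> x = p \<odot> (q \<odot> x)"
  using M.smult_assoc1[of p q x] by simp

lemma smult_poly_zero: "x \<in> carrier M \<Longrightarrow> 0 \<odot> x = \<zero>"
  using M.smult_l_null[of x] by simp

lemma smult_poly_one: "x \<in> carrier M \<Longrightarrow> 1 \<odot> x = x"
  using M.smult_one[of x] by simp

lemma smult_in_part:
  assumes y: "y \<in> degree_part M b"
    and p: "\<And>m. m \<in> keys p \<Longrightarrow> (\<lambda>i. b i + int (lookup m i)) = c"
  shows "p \<odot> y \<in> degree_part M c"
proof (induction p rule: poly_induct_terms)
  case (monomial m)
  then show ?case using part_term[OF y, of m] p by simp
qed (use part_carrier[OF y] part_zero part_add in \<open>simp_all add: smult_poly_zero smult_poly_add\<close>)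

text \<open>It is enough that every term of the polynomial is divisible by a monomial that kills \<open>y\<close>.\<close>

lemma smult_eq_zero:
  assumes y: "y \<in> carrier M"
    and p: "\<And>m. m \<in> keys p \<Longrightarrow> \<exists>n. (\<forall>i. lookup n i \<le> lookup m i) \<and>
        single n 1 \<odot> y = \<zero>"
  shows "p \<odot> y = \<zero>"
proof (induction p rule: poly_induct_terms)
  case (monomial m)
  then obtain n where n: "\<forall>i. lookup n i \<le> lookup m i" "single n 1 \<odot> y = \<zero>"
    using p by blast
  have "single m (lookup p m)
      = single (m - n) (lookup p m) * single n 1"
    using monomial_decompose[of n m] n(1) by (simp add: mult_single)
  then show ?case using n y by (simp add: smult_poly_mult)
qed (use y in \<open>simp_all add: smult_poly_zero smult_poly_add\<close>)

lemma decompose_unique: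
  assumes f: "\<And>a. f a \<in> degree_part M a" "finite {a. f a \<noteq> \<zero>}"
    and g: "\<And>a. g a \<in> degree_part M a" "finite {a. g a \<noteq> \<zero>}"
    and eq: "finsum M f {a. f a \<noteq> \<zero>} = finsum M g {a. g a \<noteq> \<zero>}"
  shows "f = g"
proof -
  have "finsum M f {a. f a \<noteq> \<zero>} \<in> carrier M"
    using f(1) part_carrier by (intro M.finsum_closed) auto
  then have "\<exists>!h. (\<forall>a. h a \<in> degree_part M a) \<and> finite {a. h a \<noteq> \<zero>} \<and>
        finsum M f {a. f a \<noteq> \<zero>} = finsum M h {a. h a \<noteq> \<zero>}"
    using mg by (simp add: multigraded_module_def)
  then show ?thesis using f g eq by blast
qed

end

section \<open>Quotients of the polynomial ring by monomial ideals\<close>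

text \<open>The quotient of the polynomial ring by the monomial ideal spanned by the monomials outside \<open>G\<close>, with
  its generator in degree \<open>b\<close>. Classes are represented by their normal forms, and these by constant
  sequences, because injectivity is tested on modules carried by sequences of polynomials.\<close>

definition standard_module :: "'n monomial set \<Rightarrow> ('n \<Rightarrow> int) \<Rightarrow> ('n, 'k::field, nat \<Rightarrow> ('n, 'k) mpoly) multigraded" where
  "standard_module G b = \<lparr>carrier = {\<lambda>_. p | p. keys p \<subseteq> G}, monoid.mult = undefined, one = undefined,
     ring.zero = (\<lambda>_. 0), ring.add = (\<lambda>f g j. f j + g j), module.smult = (\<lambda>r f j. restrict_terms G (r * f j)),
     degree_part = (\<lambda>c. {\<lambda>_. p | p. keys p \<subseteq> {m \<in> G. \<forall>i. b i + int (lookup m i) = c i}})\<rparr>"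

lemma standard_module_simps [simp]:
  "(\<lambda>_. p) \<in> carrier (standard_module G b) \<longleftrightarrow> keys p \<subseteq> G"
  "ring.zero (standard_module G b) = (\<lambda>_. 0)"
  "ring.add (standard_module G b) f g = (\<lambda>j. f j + g j)"
  "module.smult (standard_module G b) r f = (\<lambda>j. restrict_terms G (r * f j))"
  "(\<lambda>_. p) \<in> degree_part (standard_module G b) c \<longleftrightarrow>
     keys p \<subseteq> {m \<in> G. \<forall>i. b i + int (lookup m i) = c i}"
  by (auto simp: standard_module_def fun_eq_iff)

lemma standard_moduleE:
  assumes "f \<in> carrier (standard_module G b)"
  obtains p where "f = (\<lambda>_. p)" "keys p \<subseteq> G"
  using assms by (auto simp: standard_module_def)

lemma standard_module_partE:
  assumes "f \<in> degree_part (standard_module G b) c"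
  obtains p where "f = (\<lambda>_. p)" "keys p \<subseteq> {m \<in> G. \<forall>i. b i + int (lookup m i) = c i}"
  using assms by (auto simp: standard_module_def)

lemma keys_add_subset: "keys p \<subseteq> G \<Longrightarrow> keys q \<subseteq> G \<Longrightarrow> keys (p + q) \<subseteq> G"
  using keys_add[of p q] by blast

text \<open>Associativity of the truncated multiplication is \<open>restrict_terms_mult\<close>. The component of a polynomial
  in degree \<open>c\<close> consists of its terms of that degree.\<close>

lemma standard_module_multigraded:
  assumes G: "order_ideal (G :: 'n monomial set)"
  shows "multigraded_module (standard_module G b :: ('n, 'k::field, nat \<Rightarrow> ('n, 'k) mpoly) multigraded)"
proof -
  let ?M = "standard_module G b :: ('n, 'k, nat \<Rightarrow> ('n, 'k) mpoly) multigraded"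
  define deg where "deg m = (\<lambda>i. b i + int (lookup m i))" for m
  have ab: "abelian_group ?M"
  proof (rule abelian_groupI)
    show "\<exists>y\<in>carrier ?M. y \<oplus>\<^bsub>?M\<^esub> x = \<zero>\<^bsub>?M\<^esub>" if "x \<in> carrier ?M" for x
    proof -
      obtain p where p: "x = (\<lambda>_. p)" "keys p \<subseteq> G" using \<open>x \<in> carrier ?M\<close> by (rule standard_moduleE)
      then show ?thesis by (intro bexI[of _ "\<lambda>_. - p"]) auto
    qed
  qed (auto elim!: standard_moduleE simp: keys_add_subset algebra_simps)
  interpret M: abelian_group ?M by (rule ab)
  have inv: "\<ominus>\<^bsub>?M\<^esub> (\<lambda>_. p) = (\<lambda>_. - p)" if "keys p \<subseteq> G" for p
    using that by (intro M.minus_equality) auto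
  have mod: "module (poly_ring :: ('n, 'k) mpoly ring) ?M"
  proof (rule moduleI)
    show "cring (poly_ring :: ('n, 'k) mpoly ring)" by (rule comm_ring_1_class.cring_from_type_algebra)
  qed (auto elim!: standard_moduleE simp: ab keys_restrict_terms restrict_terms_add distrib_left distrib_right
      mult.assoc restrict_terms_mult[OF G] restrict_terms_id)
  have sub: "subgroup (degree_part ?M c) (add_monoid ?M)" for c
  proof (rule M.add.subgroupI)
    show "degree_part ?M c \<subseteq> carrier ?M" by (auto elim!: standard_module_partE)
    have "(\<lambda>_. 0) \<in> degree_part ?M c" by simp
    then show "degree_part ?M c \<noteq> {}" by blast
    show "\<ominus>\<^bsub>?M\<^esub> x \<in> degree_part ?M c" if "x \<in> degree_part ?M c" for x
    proof -
      obtain p where p: "x = (\<lambda>_. p)" "keys p \<subseteq> {m \<in> G. \<forall>i. b i + int (lookup m i) = c i}"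
        using \<open>x \<in> degree_part ?M c\<close> by (rule standard_module_partE)
      moreover have "keys p \<subseteq> G" using p by blast
      ultimately show ?thesis using inv[of p] by (simp add: a_inv_def)
    qed
    show "x \<oplus>\<^bsub>?M\<^esub> y \<in> degree_part ?M c" if "x \<in> degree_part ?M c" "y \<in> degree_part ?M c" for x y
      using that by (auto elim!: standard_module_partE simp: keys_add_subset)
  qed
  have fs: "finsum ?M f S = (\<lambda>_. \<Sum>c\<in>S. f c 0)" if "finite S" "\<And>c. c \<in> S \<Longrightarrow> f c \<in> carrier ?M" for S :: "('n \<Rightarrow> int) set" and f
    using that
  proof (induction S rule: finite_induct)
    case (insert c S)
    then have "finsum ?M f (insert c S) = f c \<oplus>\<^bsub>?M\<^esub> finsum ?M f S" by (intro M.finsum_insert) auto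
    moreover have "f c = (\<lambda>_. f c 0)" using insert.prems[of c] by (auto elim!: standard_moduleE)
    ultimately show ?case using insert by (simp add: fun_eq_iff)
  qed simp
  have dec: "\<exists>!f. (\<forall>c. f c \<in> degree_part ?M c) \<and> finite {c. f c \<noteq> \<zero>\<^bsub>?M\<^esub>} \<and> x = finsum ?M f {c. f c \<noteq> \<zero>\<^bsub>?M\<^esub>}"
    if "x \<in> carrier ?M" for x
  proof -
    obtain p where p: "x = (\<lambda>_. p)" "keys p \<subseteq> G" using \<open>x \<in> carrier ?M\<close> by (rule standard_moduleE)
    define f :: "('n \<Rightarrow> int) \<Rightarrow> nat \<Rightarrow> ('n, 'k) mpoly" where "f c = (\<lambda>_. restrict_terms {m. deg m = c} p)" for c
    have f_part: "f c \<in> degree_part ?M c" for c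
      using p(2) by (auto simp: f_def keys_restrict_terms deg_def fun_eq_iff)
    have f_supp: "{c. f c \<noteq> \<zero>\<^bsub>?M\<^esub>} \<subseteq> deg ` keys p"
    proof
      fix c assume "c \<in> {c. f c \<noteq> \<zero>\<^bsub>?M\<^esub>}"
      then have "restrict_terms {m. deg m = c} p \<noteq> 0" by (auto simp: f_def)
      then have "keys p \<inter> {m. deg m = c} \<noteq> {}" using restrict_terms_eq_0 by blast
      then show "c \<in> deg ` keys p" by blast
    qed
    have fin: "finite {c. f c \<noteq> \<zero>\<^bsub>?M\<^esub>}" by (rule finite_subset[OF f_supp]) simp
    have carr: "g c \<in> carrier ?M" if "\<forall>c. g c \<in> degree_part ?M c" for g c
    proof -
      have "g c \<in> degree_part ?M c" using that by blast
      then show ?thesis by (auto elim!: standard_module_partE)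
    qed
    have lk: "lookup (\<Sum>c\<in>{c. g c \<noteq> \<zero>\<^bsub>?M\<^esub>}. g c 0) m = lookup (g (deg m) 0) m"
      if g: "\<forall>c. g c \<in> degree_part ?M c" "finite {c. g c \<noteq> \<zero>\<^bsub>?M\<^esub>}" for g :: "('n \<Rightarrow> int) \<Rightarrow> nat \<Rightarrow> ('n, 'k) mpoly" and m
    proof -
      have z: "lookup (g c 0) m = 0" if "c \<noteq> deg m" for c
      proof -
        obtain q where q: "g c = (\<lambda>_. q)" "keys q \<subseteq> {m \<in> G. \<forall>i. b i + int (lookup m i) = c i}"
          using g(1)[rule_format, of c] by (rule standard_module_partE)
        then show ?thesis using that by (auto simp: deg_def in_keys_iff fun_eq_iff)
      qed
      have "lookup (\<Sum>c\<in>{c. g c \<noteq> \<zero>\<^bsub>?M\<^esub>}. g c 0) m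
          = (\<Sum>c\<in>{c. g c \<noteq> \<zero>\<^bsub>?M\<^esub>}. if c = deg m then lookup (g c 0) m else 0)"
        unfolding lookup_sum by (rule sum.cong) (use z in auto)
      also have "\<dots> = lookup (g (deg m) 0) m" using g(2) by (simp add: sum.delta)
      finally show ?thesis .
    qed
    show ?thesis
    proof (rule ex1I[of _ f], intro conjI allI)
      show "x = finsum ?M f {c. f c \<noteq> \<zero>\<^bsub>?M\<^esub>}"
        unfolding p(1) fs[OF fin carr[OF allI[OF f_part]]]
        by (rule ext, rule poly_mapping_eqI, subst lk)
          (use f_part fin in \<open>auto simp: f_def lookup_restrict_terms\<close>)
    next
      fix g assume g: "(\<forall>c. g c \<in> degree_part ?M c) \<and> finite {c. g c \<noteq> \<zero>\<^bsub>?M\<^esub>} \<and> x = finsum ?M g {c. g c \<noteq> \<zero>\<^bsub>?M\<^esub>}"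
      then have p_eq: "p = (\<Sum>c\<in>{c. g c \<noteq> \<zero>\<^bsub>?M\<^esub>}. g c 0)"
        unfolding p(1) using fs[of "{c. g c \<noteq> \<zero>\<^bsub>?M\<^esub>}" g] carr[of g] by (simp add: fun_eq_iff)
      show "g = f"
      proof (rule ext)
        fix c
        obtain q where q: "g c = (\<lambda>_. q)" "keys q \<subseteq> {m \<in> G. \<forall>i. b i + int (lookup m i) = c i}"
          using g[THEN conjunct1, rule_format, of c] by (rule standard_module_partE)
        have "restrict_terms {m. deg m = c} p = q"
        proof (rule poly_mapping_eqI)
          fix m
          show "lookup (restrict_terms {m. deg m = c} p) m = lookup q m"
          proof (cases "deg m = c")
            case True
            have "lookup p m = lookup (g (deg m) 0) m"
              unfolding p_eq by (rule lk) (use g in auto)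
            then show ?thesis using True q by (simp add: lookup_restrict_terms)
          next
            case False
            then show ?thesis using q(2) by (auto simp: lookup_restrict_terms deg_def in_keys_iff fun_eq_iff)
          qed
        qed
        then show "g c = f c" by (simp add: f_def q)
      qed
    qed (use f_part fin in auto)
  qed
  have trm: "term_of r m \<odot>\<^bsub>?M\<^esub> x \<in> degree_part ?M (\<lambda>i. c i + int (lookup m i))"
    if x: "x \<in> degree_part ?M c" for x c r m
  proof -
    obtain p where p: "x = (\<lambda>_. p)" "keys p \<subseteq> {m \<in> G. \<forall>i. b i + int (lookup m i) = c i}"
      using x by (rule standard_module_partE)
    have "b i + int (lookup n i) = c i + int (lookup m i)"
      if "n \<in> keys (single m r * p)" for n i
    proof -
      obtain n' where n': "n = m + n'" "n' \<in> keys p"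
        using \<open>n \<in> keys _\<close> keys_mult[of "single m r" p] by (auto split: if_splits)
      then have "b i + int (lookup n' i) = c i" using p(2) by blast
      then show ?thesis using n'(1) by (simp add: lookup_add)
    qed
    then show ?thesis by (auto simp: p(1) term_of_def keys_restrict_terms)
  qed
  show ?thesis unfolding multigraded_module_def using mod sub dec trm by blast
qed

text \<open>The map $1 \mapsto y$ from $S/(x_j^t : j \in A)$ to \<open>E\<close> is well defined because \<open>y\<close> is killed by
  these powers. Multiplication by $x_l^t$ is an injective endomorphism \<open>u\<close> of this quotient, of degree
  zero after a shift of the grading, since \<open>l\<close> is not in \<open>A\<close>. Extending the map along \<open>u\<close>, the value
  of the extension at \<open>1\<close> is the required quotient of \<open>y\<close>.\<close>

lemma graded_injective_divide:
  fixes E :: "('n::finite, 'k::field, 'e) multigraded"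
  assumes inj: "graded_injective E" and l: "l \<notin> A" and y: "y \<in> degree_part E (shift b t {l})"
    and ann: "\<And>j. j \<in> A \<Longrightarrow> x_pow t j \<odot>\<^bsub>E\<^esub> y = \<zero>\<^bsub>E\<^esub>"
  shows "\<exists>x\<in>degree_part E b. x_pow t l \<odot>\<^bsub>E\<^esub> x = y \<and>
     (\<forall>j\<in>A. x_pow t j \<odot>\<^bsub>E\<^esub> x = \<zero>\<^bsub>E\<^esub>)"
proof -
  interpret E: graded_module E
    by unfold_locales (use inj in \<open>simp add: graded_injective_def\<close>)
  have yc: "y \<in> carrier E" using y E.part_carrier by blast
  show ?thesis
  proof (cases "t = 0")
    case True
    then show ?thesis using y ann by (intro bexI[of _ y]) (simp_all add: E.smult_poly_one[OF yc])
  next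
    case False
    \<comment> \<open>The normal forms modulo the powers are those in which each variable of A has exponent below t; the exponent of the variable l is unrestricted, so G is stable under multiplication by its powers.\<close>
    define G where "G = {m :: 'n monomial. \<forall>j\<in>A. lookup m j < t}"
    have G: "order_ideal G" by (auto simp: order_ideal_def G_def lookup_add)
    have Gl: "single l t + n \<in> G \<longleftrightarrow> n \<in> G" for n
      using l by (auto simp: G_def lookup_add lookup_single when_def)
    let ?b' = "shift b t {l}"
    let ?A = "standard_module G ?b' :: ('n, 'k, nat \<Rightarrow> ('n, 'k) mpoly) multigraded"
    let ?B = "standard_module G b :: ('n, 'k, nat \<Rightarrow> ('n, 'k) mpoly) multigraded"
    define u :: "(nat \<Rightarrow> ('n, 'k) mpoly) \<Rightarrow> nat \<Rightarrow> ('n, 'k) mpoly"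
      where "u h = (\<lambda>i. x_pow t l * h i)" for h
    define f where "f h = h 0 \<odot>\<^bsub>E\<^esub> y" for h :: "nat \<Rightarrow> ('n, 'k) mpoly"
    have keys_u: "n \<in> keys (x_pow t l * p) \<Longrightarrow>
        \<exists>n'\<in>keys p. n = single l t + n'" for n and p :: "('n, 'k) mpoly"
      using keys_mult[of "x_pow t l" p] by auto
    have u_carr: "u h \<in> carrier ?B" if "h \<in> carrier ?A" for h
      using that keys_u Gl by (auto elim!: standard_moduleE simp: u_def) blast
    have u: "u \<in> graded_hom ?A ?B"
      unfolding graded_hom_def module_hom_def mem_Collect_eq
    proof (intro conjI ballI allI)
      show "u \<in> carrier ?A \<rightarrow> carrier ?B" using u_carr by blast
      show "u (r \<odot>\<^bsub>?A\<^esub> h) = r \<odot>\<^bsub>?B\<^esub> u h" for r h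
        using Gl by (simp add: u_def mult.left_commute[of r] term_mult_restrict)
      show "u (h \<oplus>\<^bsub>?A\<^esub> h') = u h \<oplus>\<^bsub>?B\<^esub> u h'" for h h'
        by (simp add: u_def distrib_left)
      show "u ` degree_part ?A c \<subseteq> degree_part ?B c" for c
      proof
        fix w assume "w \<in> u ` degree_part ?A c"
        then obtain p where p: "w = (\<lambda>_. x_pow t l * p)"
          "keys p \<subseteq> {m \<in> G. \<forall>i. ?b' i + int (lookup m i) = c i}"
          by (auto simp: u_def elim!: standard_module_partE)
        have "n \<in> G \<and> b i + int (lookup n i) = c i"
          if n: "n \<in> keys (x_pow t l * p)" for n i
        proof -
          obtain n' where n': "n' \<in> keys p" "n = single l t + n'" using keys_u[OF n] by blast
          then have "n' \<in> G" "?b' i + int (lookup n' i) = c i" using p(2) by blast+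
          then show ?thesis using n'(2) Gl by (auto simp: shift_def lookup_add lookup_single when_def split: if_splits)
        qed
        then show "w \<in> degree_part ?B c" unfolding p(1) by auto
      qed
    qed
    have u_inj: "inj_on u (carrier ?A)"
      by (rule inj_onI) (auto elim!: standard_moduleE simp: u_def fun_eq_iff dest: term_mult_inj)
    have bad: "q \<odot>\<^bsub>E\<^esub> y = \<zero>\<^bsub>E\<^esub>" if "keys q \<inter> G = {}" for q
    proof (rule E.smult_eq_zero[OF yc])
      fix m assume "m \<in> keys q"
      then have "m \<notin> G" using that by blast
      then obtain j where "j \<in> A" "t \<le> lookup m j" by (auto simp: G_def not_less)
      then show "\<exists>n. (\<forall>i. lookup n i \<le> lookup m i) \<and> single n 1 \<odot>\<^bsub>E\<^esub> y = \<zero>\<^bsub>E\<^esub>"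
        using ann by (intro exI[of _ "single j t"]) (auto simp: lookup_single when_def)
    qed
    have f_restrict: "restrict_terms G q \<odot>\<^bsub>E\<^esub> y = q \<odot>\<^bsub>E\<^esub> y" for q
    proof -
      have "keys (q - restrict_terms G q) \<inter> G = {}"
        by (auto simp: in_keys_iff lookup_minus lookup_restrict_terms when_def)
      then have "(q - restrict_terms G q) \<odot>\<^bsub>E\<^esub> y = \<zero>\<^bsub>E\<^esub>" by (rule bad)
      moreover have "q = (q - restrict_terms G q) + restrict_terms G q" by simp
      ultimately show ?thesis using E.smult_poly_add[OF yc, of "q - restrict_terms G q" "restrict_terms G q"] yc by simp
    qed
    have f: "f \<in> graded_hom ?A E"
      unfolding graded_hom_def module_hom_def mem_Collect_eq
    proof (intro conjI ballI allI)
      show "f \<in> carrier ?A \<rightarrow> carrier E" using yc by (simp add: f_def)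
      show "f (r \<odot>\<^bsub>?A\<^esub> h) = r \<odot>\<^bsub>E\<^esub> f h" for r h
        using yc by (simp add: f_def f_restrict E.smult_poly_mult)
      show "f (h \<oplus>\<^bsub>?A\<^esub> h') = f h \<oplus>\<^bsub>E\<^esub> f h'" for h h'
        using yc by (simp add: f_def E.smult_poly_add)
      show "f ` degree_part ?A c \<subseteq> degree_part E c" for c
        using E.smult_in_part[OF y] by (auto elim!: standard_module_partE simp: f_def) blast
    qed
    obtain g where g: "g \<in> graded_hom ?B E" "\<And>h. h \<in> carrier ?A \<Longrightarrow> g (u h) = f h"
      using inj u u_inj f standard_module_multigraded[OF G] unfolding graded_injective_def by meson
    define e :: "nat \<Rightarrow> ('n, 'k) mpoly" where "e = (\<lambda>_. 1)"
    have "0 \<in> G" using False by (simp add: G_def)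
    then have e: "e \<in> carrier ?A" "e \<in> carrier ?B" "e \<in> degree_part ?B b" by (auto simp: e_def)
    have smult: "g (r \<odot>\<^bsub>?B\<^esub> e) = r \<odot>\<^bsub>E\<^esub> g e" for r
      using g(1) e by (simp add: graded_hom_def module_hom_def)
    have "x_pow t l \<odot>\<^bsub>?B\<^esub> e = u e"
      using term_mult_restrict[of "single l t" G "1::'k" 1] Gl \<open>0 \<in> G\<close>
      by (simp add: e_def u_def restrict_terms_id)
    then have 1: "x_pow t l \<odot>\<^bsub>E\<^esub> g e = y"
      using smult[of "x_pow t l"] g(2)[OF e(1)]
      by (simp add: f_def e_def E.smult_poly_one[OF yc] del: standard_module_simps)
    have 2: "x_pow t j \<odot>\<^bsub>E\<^esub> g e = \<zero>\<^bsub>E\<^esub>" if "j \<in> A" for j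
    proof -
      have "keys ((x_pow t j :: ('n, 'k) mpoly)) \<inter> G = {}"
        using that by (auto simp: G_def lookup_single intro!: bexI[of _ j])
      then have "x_pow t j \<odot>\<^bsub>?B\<^esub> e = 0 \<odot>\<^bsub>?B\<^esub> e"
        by (simp add: e_def restrict_terms_eq_0)
      then show ?thesis using smult[of "x_pow t j"] smult[of 0] g(1) e
        by (simp add: graded_hom_def module_hom_def Pi_iff E.smult_poly_zero del: standard_module_simps)
    qed
    have "g e \<in> degree_part E b" using g(1) e(3) by (auto simp: graded_hom_def)
    then show ?thesis using 1 2 by blast
  qed
qed

context graded_module begin

definition hcomp :: "'m \<Rightarrow> ('n \<Rightarrow> int) \<Rightarrow> 'm" where
  "hcomp x = (THE f. (\<forall>a. f a \<in> degree_part M a) \<and> finite {a. f a \<noteq> \<zero>} \<and> x = finsum M f {a. f a \<noteq> \<zero>})"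

lemma hcomp:
  assumes "x \<in> carrier M"
  shows "hcomp x a \<in> degree_part M a" "finite {a. hcomp x a \<noteq> \<zero>}" "x = finsum M (hcomp x) {a. hcomp x a \<noteq> \<zero>}"
proof -
  have "\<exists>!f. (\<forall>a. f a \<in> degree_part M a) \<and> finite {a. f a \<noteq> \<zero>} \<and> x = finsum M f {a. f a \<noteq> \<zero>}"
    using mg assms by (simp add: multigraded_module_def)
  from theI'[OF this] show "hcomp x a \<in> degree_part M a" "finite {a. hcomp x a \<noteq> \<zero>}"
      "x = finsum M (hcomp x) {a. hcomp x a \<noteq> \<zero>}"
    unfolding hcomp_def by blast+
qed

lemma hcomp_unique:
  assumes f: "\<And>a. f a \<in> degree_part M a" and S: "finite S" "\<And>a. a \<notin> S \<Longrightarrow> f a = \<zero>"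
  shows "hcomp (finsum M f S) = f"
proof -
  have carr: "f a \<in> carrier M" for a using f part_carrier by blast
  have supp: "{a. f a \<noteq> \<zero>} \<subseteq> S" using S(2) by blast
  have "finsum M f {a. f a \<noteq> \<zero>} = finsum M f S"
    by (rule M.add.finprod_mono_neutral_cong_left) (use S supp carr in auto)
  moreover have "finsum M f S \<in> carrier M" using carr by (intro M.finsum_closed) auto
  ultimately show ?thesis
    using hcomp[of "finsum M f S"] finite_subset[OF supp S(1)] f by (intro decompose_unique) simp_all
qed

lemma hcomp_part:
  assumes "x \<in> degree_part M a" shows "hcomp x b = (if b = a then x else \<zero>)"
proof -
  have x: "x \<in> carrier M" using assms part_carrier by blast
  have "hcomp (finsum M (\<lambda>b. if b = a then x else \<zero>) {a}) = (\<lambda>b. if b = a then x else \<zero>)"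
    by (rule hcomp_unique) (auto simp: assms part_zero)
  moreover have "finsum M (\<lambda>b. if b = a then x else \<zero>) {a} = x" using x by simp
  ultimately show ?thesis by simp
qed

lemma hcomp_add:
  assumes "x \<in> carrier M" "y \<in> carrier M"
  shows "hcomp (x \<oplus> y) b = hcomp x b \<oplus> hcomp y b"
proof -
  let ?S = "{a. hcomp x a \<noteq> \<zero>} \<union> {a. hcomp y a \<noteq> \<zero>}"
  have fin: "finite ?S" using hcomp(2) assms by simp
  have carr: "hcomp x a \<in> carrier M" "hcomp y a \<in> carrier M" for a using hcomp(1) assms part_carrier by blast+
  have ext: "z = finsum M (hcomp z) ?S" if "z \<in> {x, y}" for z
  proof -
    have "z = finsum M (hcomp z) {a. hcomp z a \<noteq> \<zero>}" using that assms hcomp(3) by blast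
    also have "\<dots> = finsum M (hcomp z) ?S"
      by (rule M.add.finprod_mono_neutral_cong_left) (use that fin carr in auto)
    finally show ?thesis .
  qed
  have "finsum M (\<lambda>a. hcomp x a \<oplus> hcomp y a) ?S = finsum M (hcomp x) ?S \<oplus> finsum M (hcomp y) ?S"
    using carr by (intro M.finsum_addf) auto
  then have "finsum M (\<lambda>a. hcomp x a \<oplus> hcomp y a) ?S = x \<oplus> y" using ext by simp
  moreover have "hcomp (finsum M (\<lambda>a. hcomp x a \<oplus> hcomp y a) ?S) = (\<lambda>a. hcomp x a \<oplus> hcomp y a)"
    by (rule hcomp_unique) (use fin hcomp(1) assms part_add in auto)
  ultimately show ?thesis by simp
qed

lemma homogeneous_induct [consumes 1, case_names zero add homogeneous]:
  assumes x: "x \<in> carrier M" and zero: "Q \<zero>"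
    and add: "\<And>x y. x \<in> carrier M \<Longrightarrow> y \<in> carrier M \<Longrightarrow> Q x \<Longrightarrow> Q y \<Longrightarrow> Q (x \<oplus> y)"
    and hom: "\<And>a x. x \<in> degree_part M a \<Longrightarrow> Q x"
  shows "Q x"
proof -
  have "Q (finsum M (hcomp x) S)" if "finite S" for S
    using that
  proof (induction S rule: finite_induct)
    case (insert a S)
    have c: "hcomp x a \<in> carrier M" for a using hcomp(1)[OF x] part_carrier by blast
    then have "finsum M (hcomp x) (insert a S) = hcomp x a \<oplus> finsum M (hcomp x) S"
      using insert by (intro M.finsum_insert) auto
    then show ?case using add[OF c M.finsum_closed[of "hcomp x" S] hom[OF hcomp(1)[OF x]] insert.IH] c by auto
  qed (simp add: zero)
  then show ?thesis using hcomp(2,3)[OF x] by metis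
qed

lemma hcomp_zero: "hcomp \<zero> b = \<zero>"
  using hcomp_part[OF part_zero] by simp

end

text \<open>Both sides are additive in \<open>x\<close>, so homogeneous \<open>x\<close> suffice. The degree may be moved by an injection
  \<open>\<sigma>\<close>, to cover homomorphisms of degree zero as well as multiplication by a monomial.\<close>

lemma hcomp_commute:
  assumes "graded_module M" "graded_module N"
    and g: "\<And>x. x \<in> carrier M \<Longrightarrow> g x \<in> carrier N"
      "\<And>x y. x \<in> carrier M \<Longrightarrow> y \<in> carrier M \<Longrightarrow> g (x \<oplus>\<^bsub>M\<^esub> y) = g x \<oplus>\<^bsub>N\<^esub> g y"
      "\<And>a x. x \<in> degree_part M a \<Longrightarrow> g x \<in> degree_part N (\<sigma> a)"
    and \<sigma>: "inj \<sigma>" and x: "x \<in> carrier M"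
  shows "graded_module.hcomp N (g x) (\<sigma> b) = g (graded_module.hcomp M x b)"
proof -
  interpret M: graded_module M by fact
  interpret N: graded_module N by fact
  have g0: "g \<zero>\<^bsub>M\<^esub> = \<zero>\<^bsub>N\<^esub>"
  proof -
    have "g \<zero>\<^bsub>M\<^esub> \<oplus>\<^bsub>N\<^esub> g \<zero>\<^bsub>M\<^esub> = g \<zero>\<^bsub>M\<^esub>" using g(2)[of "\<zero>\<^bsub>M\<^esub>" "\<zero>\<^bsub>M\<^esub>"] by simp
    then show ?thesis using g(1)[of "\<zero>\<^bsub>M\<^esub>"] by (simp add: N.M.add.l_cancel_one)
  qed
  show ?thesis using x
  proof (induction rule: M.homogeneous_induct)
    case zero
    then show ?case by (simp add: g0 M.hcomp_zero N.hcomp_zero)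
  next
    case (add x y)
    have "M.hcomp x b \<in> carrier M" "M.hcomp y b \<in> carrier M" using M.hcomp(1) M.part_carrier add by blast+
    then show ?case using add by (simp add: g M.hcomp_add N.hcomp_add)
  next
    case (homogeneous a x)
    then show ?case using \<sigma> by (auto simp: M.hcomp_part N.hcomp_part[OF g(3)] g0 inj_def)
  qed
qed

lemma module_hom_zero:
  assumes "f \<in> module_hom R M N" "abelian_group M" "abelian_group N"
  shows "f \<zero>\<^bsub>M\<^esub> = \<zero>\<^bsub>N\<^esub>"
proof -
  interpret M: abelian_group M by fact
  interpret N: abelian_group N by fact
  have "f \<zero>\<^bsub>M\<^esub> \<in> carrier N" "f (\<zero>\<^bsub>M\<^esub> \<oplus>\<^bsub>M\<^esub> \<zero>\<^bsub>M\<^esub>) = f \<zero>\<^bsub>M\<^esub> \<oplus>\<^bsub>N\<^esub> f \<zero>\<^bsub>M\<^esub>"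
    using assms(1) unfolding module_hom_def by blast+
  then show ?thesis by (simp add: N.add.l_cancel_one)
qed

section \<open>Vector spaces on a carrier, embedded in a type of vectors\<close>

definition pscale :: "'k::field \<Rightarrow> ('e \<Rightarrow>\<^sub>0 'k) \<Rightarrow> 'e \<Rightarrow>\<^sub>0 'k" where
  "pscale c p = Poly_Mapping.mapp (\<lambda>_ x. c * x) p"

lemma lookup_pscale [simp]: "lookup (pscale c p) x = c * lookup p x"
  by (simp add: pscale_def lookup_mapp when_def in_keys_iff)

interpretation pscale: vector_space "pscale :: 'k::field \<Rightarrow> ('e \<Rightarrow>\<^sub>0 'k) \<Rightarrow> _"
  by unfold_locales (auto intro!: poly_mapping_eqI simp: lookup_add algebra_simps)

text \<open>The free vector space on the underlying set maps onto \<open>N\<close> by evaluation of formal linear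
  combinations. A linear projection \<open>g\<close> onto the kernel \<open>K\<close> exists by linear algebra over a field, and
  $p \mapsto p - g(p)$ factors through \<open>N\<close>; the factor \<open>j\<close> is a linear section of the evaluation.\<close>

lemma vector_space_embedding:
  fixes N :: "('k::field, 'e, 'q) module_scheme"
  assumes "module base_field N"
  obtains j :: "'e \<Rightarrow> 'e \<Rightarrow>\<^sub>0 'k" and \<pi> where
    "\<And>x y. x \<in> carrier N \<Longrightarrow> y \<in> carrier N \<Longrightarrow> j (x \<oplus>\<^bsub>N\<^esub> y) = j x + j y"
    "\<And>c x. x \<in> carrier N \<Longrightarrow> j (c \<odot>\<^bsub>N\<^esub> x) = pscale c (j x)"
    "\<And>p. \<pi> p \<in> carrier N" "\<And>p q. \<pi> (p + q) = \<pi> p \<oplus>\<^bsub>N\<^esub> \<pi> q" "\<And>c p. \<pi> (pscale c p) = c \<odot>\<^bsub>N\<^esub> \<pi> p"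
    "\<And>x. x \<in> carrier N \<Longrightarrow> \<pi> (j x) = x"
proof -
  interpret N: module "base_field :: 'k ring" N by fact
  define v where "v p x = (if x \<in> carrier N then lookup p x \<odot>\<^bsub>N\<^esub> x else \<zero>\<^bsub>N\<^esub>)" for p :: "'e \<Rightarrow>\<^sub>0 'k" and x
  have v: "v p x \<in> carrier N" for p x by (simp add: v_def)
  define \<pi> where "\<pi> p = finsum N (v p) (keys p)" for p
  have ext: "\<pi> p = finsum N (v p) S" if "finite S" "keys p \<subseteq> S" for p S
    unfolding \<pi>_def
    by (rule N.add.finprod_mono_neutral_cong_left) (use that v in \<open>auto simp: v_def in_keys_iff N.smult_l_null[simplified]\<close>)
  have closed: "\<pi> p \<in> carrier N" for p unfolding \<pi>_def by (rule N.finsum_closed) (use v in auto)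
  have add: "\<pi> (p + q) = \<pi> p \<oplus>\<^bsub>N\<^esub> \<pi> q" for p q
  proof -
    let ?S = "keys p \<union> keys q"
    have "\<pi> (p + q) = finsum N (v (p + q)) ?S" by (rule ext) (use keys_add[of p q] in auto)
    also have "v (p + q) = (\<lambda>x. v p x \<oplus>\<^bsub>N\<^esub> v q x)"
      using N.smult_l_distr by (auto simp: v_def lookup_add)
    also have "finsum N \<dots> ?S = finsum N (v p) ?S \<oplus>\<^bsub>N\<^esub> finsum N (v q) ?S"
      by (rule N.finsum_addf) (use v in auto)
    also have "\<dots> = \<pi> p \<oplus>\<^bsub>N\<^esub> \<pi> q" using ext[of ?S p] ext[of ?S q] by simp
    finally show ?thesis .
  qed
  have scale_sum: "c \<odot>\<^bsub>N\<^esub> finsum N (v p) S = finsum N (v (pscale c p)) S" if "finite S" for c p S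
    using that
  proof (induction S rule: finite_induct)
    case empty
    then show ?case using N.smult_r_null[of c] by simp
  next
    case (insert x S)
    have "c \<odot>\<^bsub>N\<^esub> v p x = v (pscale c p) x"
      using N.smult_assoc1[of c "lookup p x" x] N.smult_r_null[of c] by (simp add: v_def)
    moreover have "finsum N (v q) (insert x S) = v q x \<oplus>\<^bsub>N\<^esub> finsum N (v q) S" for q
      using insert v by (intro N.finsum_insert) auto
    moreover have "finsum N (v p) S \<in> carrier N" using v by (intro N.finsum_closed) auto
    ultimately show ?case using insert.IH N.smult_r_distr[of c "v p x" "finsum N (v p) S"] v by simp
  qed
  have scale: "\<pi> (pscale c p) = c \<odot>\<^bsub>N\<^esub> \<pi> p" for c p
  proof -
    have "\<pi> (pscale c p) = finsum N (v (pscale c p)) (keys p)"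
      by (rule ext) (auto simp: in_keys_iff)
    then show ?thesis using scale_sum[of "keys p" c p] by (simp add: \<pi>_def)
  qed
  have single: "\<pi> (single x 1) = x" if "x \<in> carrier N" for x
  proof -
    have "\<pi> (single x 1) = finsum N (v (single x 1)) {x}" by (rule ext) simp_all
    then show ?thesis using that N.smult_one[OF that] by (simp add: v_def)
  qed
  define K where "K = {p. \<pi> p = \<zero>\<^bsub>N\<^esub>}"
  have \<pi>0: "\<pi> 0 = \<zero>\<^bsub>N\<^esub>" by (simp add: \<pi>_def)
  have K: "pscale.subspace K"
    unfolding pscale.subspace_def K_def using \<pi>0 add scale N.smult_r_null by simp
  interpret pp: vector_space_pair "pscale :: 'k \<Rightarrow> ('e \<Rightarrow>\<^sub>0 'k) \<Rightarrow> _" "pscale :: 'k \<Rightarrow> ('e \<Rightarrow>\<^sub>0 'k) \<Rightarrow> _"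
    by unfold_locales
  \<comment> \<open>A linear projection onto the kernel of the evaluation.\<close>
  obtain g :: "('e \<Rightarrow>\<^sub>0 'k) \<Rightarrow> 'e \<Rightarrow>\<^sub>0 'k" where g: "range g \<subseteq> K" "Vector_Spaces.linear pscale pscale g" "\<And>p. p \<in> K \<Longrightarrow> g p = p"
    using pp.linear_exists_left_inverse_on[OF pscale.linear_ident K] by auto
  interpret g: Vector_Spaces.linear pscale pscale g by (rule g(2))
  have \<pi>_diff: "\<pi> (p - q) = \<zero>\<^bsub>N\<^esub>" if "\<pi> p = \<pi> q" for p q
  proof -
    have "\<pi> q \<oplus>\<^bsub>N\<^esub> \<pi> (p - q) = \<pi> q" using add[of q "p - q"] that by simp
    then show ?thesis using closed by (simp add: N.add.r_cancel_one)
  qed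
  define j where "j x = single x 1 - g (single x 1)" for x
  have eq: "p - g p = q - g q" if "\<pi> p = \<pi> q" for p q
    using g(3)[of "p - q"] \<pi>_diff[OF that] by (simp add: K_def g.diff algebra_simps)
  show ?thesis
  proof (rule that[of j \<pi>])
    show "j (x \<oplus>\<^bsub>N\<^esub> y) = j x + j y" if "x \<in> carrier N" "y \<in> carrier N" for x y
    proof -
      have "j (x \<oplus>\<^bsub>N\<^esub> y) = (single x 1 + single y 1) - g (single x 1 + single y 1)"
        unfolding j_def by (rule eq) (use that in \<open>simp add: add single\<close>)
      then show ?thesis by (simp add: j_def g.add)
    qed
    show "j (c \<odot>\<^bsub>N\<^esub> x) = pscale c (j x)" if "x \<in> carrier N" for c x
    proof -
      have "j (c \<odot>\<^bsub>N\<^esub> x) = pscale c (single x 1) - g (pscale c (single x 1))"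
        unfolding j_def by (rule eq) (use that in \<open>simp add: scale single\<close>)
      then show ?thesis by (simp add: j_def g.scale pscale.scale_right_diff_distrib)
    qed
    show "\<pi> (j x) = x" if "x \<in> carrier N" for x
    proof -
      have "x = \<pi> (j x + g (single x 1))" using single[OF that] by (simp add: j_def)
      also have "\<dots> = \<pi> (j x)" using g(1) closed by (simp add: add K_def subset_iff)
      finally show ?thesis by simp
    qed
  qed (use closed add scale in auto)
qed

context graded_module begin

lemma component_module: "module base_field (component M a)"
proof (rule moduleI)
  show "cring (base_field :: 'k ring)" by (rule comm_ring_1_class.cring_from_type_algebra)
  show "abelian_group (component M a)"
  proof (rule abelian_groupI)
    show "\<exists>y\<in>carrier (component M a). y \<oplus>\<^bsub>component M a\<^esub> x = \<zero>\<^bsub>component M a\<^esub>" if "x \<in> carrier (component M a)" for x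
      using that part_minus[of x a] part_carrier[of x a]
      by (intro bexI[of _ "\<ominus> x"]) (simp_all add: component_def M.l_neg)
    show "x \<oplus>\<^bsub>component M a\<^esub> y \<oplus>\<^bsub>component M a\<^esub> z = x \<oplus>\<^bsub>component M a\<^esub> (y \<oplus>\<^bsub>component M a\<^esub> z)"
      if "x \<in> carrier (component M a)" "y \<in> carrier (component M a)" "z \<in> carrier (component M a)" for x y z
      using that part_carrier[of _ a] M.a_assoc[of x y z] by (simp add: component_def)
    show "x \<oplus>\<^bsub>component M a\<^esub> y = y \<oplus>\<^bsub>component M a\<^esub> x"
      if "x \<in> carrier (component M a)" "y \<in> carrier (component M a)" for x y
      using that part_carrier[of _ a] M.a_comm[of x y] by (simp add: component_def)
  qed (use part_carrier in \<open>auto simp: component_def part_add part_zero\<close>)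
qed (use part_carrier in \<open>auto simp: component_def term_of_def part_scalar M.smult_r_distr smult_poly_one
      single_add smult_poly_add mult_single[of 0 _ 0, simplified, symmetric] smult_poly_mult\<close>)

end

section \<open>Monomial ideals and their degree complexes\<close>

lemma ring_poly_ring: "ring (poly_ring :: ('n, 'k::field) mpoly ring)"
  by (rule comm_ring_1_class.ring_from_type_algebra)

lemma ideal_closed:
  assumes "ideal K (poly_ring :: ('n, 'k::field) mpoly ring)"
  shows "0 \<in> K" "p \<in> K \<Longrightarrow> q \<in> K \<Longrightarrow> p + q \<in> K" "p \<in> K \<Longrightarrow> r * p \<in> K" "p \<in> K \<Longrightarrow> - p \<in> K"
    "p \<in> K \<Longrightarrow> q \<in> K \<Longrightarrow> p - q \<in> K"
proof -
  interpret ideal K "poly_ring :: ('n, 'k) mpoly ring" by fact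
  show 0: "0 \<in> K" using additive_subgroup.zero_closed[OF is_additive_subgroup] by simp
  show 1: "p \<in> K \<Longrightarrow> q \<in> K \<Longrightarrow> p + q \<in> K" for p q using additive_subgroup.a_closed[OF is_additive_subgroup, of p q] by simp
  show 2: "p \<in> K \<Longrightarrow> r * p \<in> K" for p r using I_l_closed[of p r] by simp
  show 3: "p \<in> K \<Longrightarrow> - p \<in> K" for p using 2[of p "- 1"] by simp
  show "p \<in> K \<Longrightarrow> q \<in> K \<Longrightarrow> p - q \<in> K" using 1[of p "- q"] 3[of q] by simp
qed

lemma poly_idealI:
  assumes "0 \<in> K" "\<And>p q. p \<in> K \<Longrightarrow> q \<in> K \<Longrightarrow> p + q \<in> K" "\<And>r p. p \<in> K \<Longrightarrow> r * p \<in> K"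
  shows "ideal K (poly_ring :: ('n, 'k::field) mpoly ring)"
proof (rule idealI[OF ring_poly_ring])
  interpret ring "poly_ring :: ('n, 'k::field) mpoly ring" by (rule ring_poly_ring)
  show "subgroup K (add_monoid (poly_ring :: ('n, 'k) mpoly ring))"
  proof (rule add.subgroupI)
    show "\<ominus>\<^bsub>poly_ring\<^esub> p \<in> K" if "p \<in> K" for p
    proof -
      have "\<ominus>\<^bsub>poly_ring\<^esub> p = - p" by (rule minus_equality) simp_all
      then show ?thesis using assms(3)[OF that, of "- 1"] by simp
    qed
  qed (use assms in auto)
qed (use assms(3) in \<open>auto simp: mult.commute\<close>)

lemma monomial_ideal_ideal:
  assumes "monomial_ideal (K :: ('n, 'k::field) mpoly set)" shows "ideal K poly_ring"
  using assms ring.genideal_ideal[OF ring_poly_ring] by (auto simp: monomial_ideal_def)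

text \<open>The polynomials all of whose terms are divisible by a generator form an ideal, which contains the
  generators and hence \<open>K\<close>.\<close>

lemma monomial_ideal_terms:
  fixes K :: "('n, 'k::field) mpoly set"
  assumes K: "monomial_ideal K" and p: "p \<in> K" and m: "m \<in> keys p"
  shows "single m c \<in> K"
proof -
  obtain B where B: "K = genideal poly_ring (term_of 1 ` B)" using K by (auto simp: monomial_ideal_def)
  let ?T = "{p :: ('n, 'k) mpoly. \<forall>m\<in>keys p. \<exists>b\<in>B. \<exists>n. m = n + b}"
  have "ideal ?T poly_ring"
  proof (rule poly_idealI)
    show "p + q \<in> ?T" if "p \<in> ?T" "q \<in> ?T" for p q using that keys_add[of p q] by blast
    show "r * p \<in> ?T" if "p \<in> ?T" for r p
    proof -
      have "\<exists>b\<in>B. \<exists>n. m = n + b" if m: "m \<in> keys (r * p)" for m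
      proof -
        obtain k l where "m = k + l" "l \<in> keys p" using keys_mult[of r p] m by blast
        moreover obtain b n where "b \<in> B" "l = n + b" using \<open>p \<in> ?T\<close> calculation(2) by blast
        ultimately have "m = (k + n) + b" by (simp add: add.assoc)
        then show ?thesis using \<open>b \<in> B\<close> by blast
      qed
      then show ?thesis by blast
    qed
  qed simp
  moreover have "term_of 1 ` B \<subseteq> ?T"
  proof -
    have "\<exists>b'\<in>B. \<exists>n. b = n + b'" if "b \<in> B" for b using that by (metis add_0)
    then show ?thesis by (auto simp: term_of_def)
  qed
  ultimately have "K \<subseteq> ?T" unfolding B by (rule ring.genideal_minimal[OF ring_poly_ring])
  then obtain b n where b: "b \<in> B" "m = n + b" using p m by blast
  have "term_of 1 b \<in> K"
    using ring.genideal_self[OF ring_poly_ring, of "term_of 1 ` B"] b(1) unfolding B by auto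
  then have "single n c * single b 1 \<in> K"
    using ideal_closed(3)[OF monomial_ideal_ideal[OF K]] by (simp add: term_of_def)
  then show ?thesis by (simp add: mult_single b(2))
qed

lemma monomial_ideal_le:
  assumes K: "monomial_ideal K" and "single n 1 \<in> K"
    and "\<And>i. lookup n i \<le> lookup m i"
  shows "single m c \<in> K"
proof -
  have "single (m - n) c * single n 1 \<in> K"
    using ideal_closed(3)[OF monomial_ideal_ideal[OF K]] assms by blast
  then show ?thesis using monomial_decompose[of n m] assms(3) by (simp add: mult_single)
qed

lemma minimal_generator_below:
  fixes K :: "('n::finite, 'k::field) mpoly set"
  assumes "single m 1 \<in> K"
  shows "\<exists>b\<in>minimal_generators K. \<forall>i. lookup b i \<le> lookup m i"
  using assms
proof (induction "\<Sum>i\<in>UNIV. lookup m i" arbitrary: m rule: less_induct)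
  case less
  show ?case
  proof (cases "m \<in> minimal_generators K")
    case True
    then show ?thesis by blast
  next
    case False
    then obtain c where c: "single c 1 \<in> K" "\<And>i. lookup c i \<le> lookup m i" "c \<noteq> m"
      using less.prems unfolding minimal_generators_def term_of_def by blast
    obtain i where "lookup c i \<noteq> lookup m i"
      using c(3) poly_mapping_eqI[of c m] by blast
    then have "\<exists>i. lookup c i < lookup m i"
      using c(2) by (intro exI[of _ i]) (simp add: le_neq_implies_less)
    then have "(\<Sum>i\<in>UNIV. lookup c i) < (\<Sum>i\<in>UNIV. lookup m i)"
      using c(2) by (intro sum_strict_mono_ex1) auto
    from less.hyps[OF this c(1)] show ?thesis using c(2) order_trans by blast
  qed
qed

definition monomial_of :: "('n::finite \<Rightarrow> int) \<Rightarrow> 'n monomial" where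
  "monomial_of b = Poly_Mapping.Abs_poly_mapping (\<lambda>i. nat (b i))"

lemma lookup_monomial_of [simp]: "lookup (monomial_of b) i = nat (b i)"
  unfolding monomial_of_def by (subst lookup_Abs_poly_mapping) auto

text \<open>The degrees of the monomials in \<open>K\<close>, as integer vectors so that they can be compared with degrees of
  graded modules.\<close>

definition exponents :: "('n::finite, 'k::field) mpoly set \<Rightarrow> ('n \<Rightarrow> int) set" where
  "exponents K = {b. (\<forall>i. 0 \<le> b i) \<and> single (monomial_of b) 1 \<in> K}"

lemma exponents_shift: "monomial_ideal K \<Longrightarrow> b \<in> exponents K \<Longrightarrow> shift b t F \<in> exponents K"
  using monomial_ideal_le[of K "monomial_of b" "monomial_of (shift b t F)" 1]
  by (auto simp: exponents_def shift_def nat_mono)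

text \<open>For large \<open>t\<close> the coordinates of $a + t e_F$ in \<open>F\<close> exceed those of any chosen generator. So the
  monomial of this degree exists if \<open>F\<close> contains all negative coordinates, and it is divisible by a
  minimal generator \<open>b\<close> if and only if $b_i \le a_i$ outside \<open>F\<close>; such \<open>b\<close> is what prevents
  $F - G_a$ from being a face of the degree complex.\<close>

lemma exponents_stable:
  fixes K :: "('n::finite, 'k::field) mpoly set"
  assumes K: "monomial_ideal K"
  shows "\<exists>t0. \<forall>t\<ge>t0. \<forall>F. shift a t F \<in> exponents K \<longleftrightarrow>
     negative_support a \<subseteq> F \<and> F - negative_support a \<notin> degree_complex a K"
proof -
  let ?G = "negative_support a"
  let ?ok = "\<lambda>F b. b \<in> minimal_generators K \<and> (\<forall>i. i \<notin> F \<longrightarrow> int (lookup b i) \<le> a i)"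
  \<comment> \<open>One generator per face is enough; as there are finitely many faces, one bound on t serves all of them.\<close>
  define g where "g F = (SOME b. ?ok F b)" for F
  define t0 where "t0 = (\<Sum>F\<in>UNIV. \<Sum>i\<in>UNIV. nat \<bar>a i\<bar> + lookup (g F) i)"
  have bound: "nat \<bar>a i\<bar> + lookup (g F) i \<le> t0" for i F
  proof -
    have "nat \<bar>a i\<bar> + lookup (g F) i \<le> (\<Sum>i\<in>UNIV. nat \<bar>a i\<bar> + lookup (g F) i)"
      by (rule member_le_sum) auto
    also have "\<dots> \<le> t0" unfolding t0_def by (rule member_le_sum) auto
    finally show ?thesis .
  qed
  have "shift a t F \<in> exponents K \<longleftrightarrow> ?G \<subseteq> F \<and> F - ?G \<notin> degree_complex a K" if t: "t0 \<le> t" for t F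
  proof
    assume L: "shift a t F \<in> exponents K"
    then have pos: "0 \<le> shift a t F i" for i by (simp add: exponents_def)
    have G: "?G \<subseteq> F"
    proof
      fix i assume "i \<in> ?G" then show "i \<in> F" using pos[of i] by (auto simp: shift_def negative_support_def split: if_splits)
    qed
    obtain b where b: "b \<in> minimal_generators K" "\<And>i. lookup b i \<le> nat (shift a t F i)"
      using minimal_generator_below[of "monomial_of (shift a t F)" K] L by (auto simp: exponents_def)
    have "\<not> a i < int (lookup b i)" if "i \<notin> F" for i
      using b(2)[of i] pos[of i] that by (auto simp: shift_def)
    moreover have "(F - ?G) \<union> ?G = F" using G by blast
    moreover have "\<exists>i. i \<notin> (F - ?G) \<union> ?G \<and> a i < int (lookup b i)" if "F - ?G \<in> degree_complex a K"
      using that b(1) unfolding degree_complex_def by blast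
    ultimately have "F - ?G \<notin> degree_complex a K" by metis
    then show "?G \<subseteq> F \<and> F - ?G \<notin> degree_complex a K" using G by blast
  next
    assume R: "?G \<subseteq> F \<and> F - ?G \<notin> degree_complex a K"
    then have "(F - ?G) \<union> ?G = F" "(F - ?G) \<inter> ?G = {}" by blast+
    moreover have "\<not> (\<forall>b\<in>minimal_generators K. \<exists>i. i \<notin> (F - ?G) \<union> ?G \<and> a i < int (lookup b i))"
      using R calculation(2) unfolding degree_complex_def by blast
    ultimately obtain b where "b \<in> minimal_generators K" "\<not> (\<exists>i. i \<notin> F \<and> a i < int (lookup b i))"
      by metis
    then have "?ok F b" by (meson not_less)
    then have g: "?ok F (g F)" unfolding g_def by (rule someI[where P = "?ok F"])
    have le: "int (lookup (g F) i) \<le> shift a t F i" for i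
    proof (cases "i \<in> F")
      case True
      then show ?thesis using bound[of i F] t by (simp add: shift_def)
    next
      case False
      then show ?thesis using g by (simp add: shift_def)
    qed
    have pos: "0 \<le> shift a t F i" for i using le[of i] by linarith
    have "lookup (g F) i \<le> nat (shift a t F i)" for i using le[of i] by linarith
    moreover have "single (g F) 1 \<in> K"
      using g unfolding minimal_generators_def term_of_def by blast
    ultimately have "single (monomial_of (shift a t F)) 1 \<in> K"
      using monomial_ideal_le[OF K, of "g F" "monomial_of (shift a t F)" 1] by simp
    then show "shift a t F \<in> exponents K" using pos by (simp add: exponents_def)
  qed
  then show ?thesis by blast
qed

lemma exponents_diff_stable:
  fixes I J :: "('n::finite, 'k::field) mpoly set"
  assumes I: "monomial_ideal I" and J: "monomial_ideal J"
  obtains t0 where "\<And>t F. t0 \<le> t \<Longrightarrow> shift a t F \<in> exponents I - exponents J \<longleftrightarrow>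
     negative_support a \<subseteq> F \<and> F - negative_support a \<in> degree_complex a J - degree_complex a I"
proof -
  obtain t1 t2 where t: "\<forall>t\<ge>t1. \<forall>F. shift a t F \<in> exponents I \<longleftrightarrow>
     negative_support a \<subseteq> F \<and> F - negative_support a \<notin> degree_complex a I"
    "\<forall>t\<ge>t2. \<forall>F. shift a t F \<in> exponents J \<longleftrightarrow>
     negative_support a \<subseteq> F \<and> F - negative_support a \<notin> degree_complex a J"
    using exponents_stable[OF I, of a] exponents_stable[OF J, of a] by blast
  show ?thesis by (rule that[of "max t1 t2"]) (use t in auto)
qed

lemma degree_complex_antimono:
  fixes I J :: "('n::finite, 'k::field) mpoly set"
  assumes "J \<subseteq> I" shows "degree_complex a I \<subseteq> degree_complex a J"
proof
  fix F assume F: "F \<in> degree_complex a I"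
  show "F \<in> degree_complex a J"
    unfolding degree_complex_def mem_Collect_eq
  proof (intro conjI ballI)
    show "F \<inter> negative_support a = {}" using F by (simp add: degree_complex_def)
    fix b assume "b \<in> minimal_generators J"
    then have "single b 1 \<in> I" using assms unfolding minimal_generators_def term_of_def by blast
    then obtain c where c: "c \<in> minimal_generators I" "\<And>i. lookup c i \<le> lookup b i"
      using minimal_generator_below by blast
    then obtain i where "i \<notin> F \<union> negative_support a" "a i < int (lookup c i)"
      using F by (auto simp: degree_complex_def)
    then show "\<exists>i. i \<notin> F \<union> negative_support a \<and> a i < int (lookup b i)"
      using c(2)[of i] by (intro exI[of _ i]) linarith
  qed
qed

text \<open>A minimal generator of \<open>J\<close> that divides a power of $\prod_{i \in G_a} x_i$ has its support inside
  $G_a$, so it violates the second condition in the definition of the degree complex for every face.\<close>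

lemma degree_complex_empty:
  fixes J :: "('n::{finite,linorder}, 'k::field) mpoly set"
  assumes J: "monomial_ideal J" and G: "negative_support a \<notin> stanley_reisner_complex (ideal_radical J)"
  shows "degree_complex a J = {}"
proof -
  let ?G = "negative_support a"
  obtain t where t: "(\<Prod>i\<in>?G. var i :: ('n, 'k) mpoly) ^ t \<in> J"
    using G by (auto simp: stanley_reisner_complex_def ideal_radical_def)
  define m where "m = (\<Sum>i\<in>?G. single i t)"
  have "(\<Prod>i\<in>S. var i :: ('n, 'k) mpoly) ^ t = single (\<Sum>i\<in>S. single i t) 1" for S :: "'n set"
  proof -
    have pw: "(var i :: ('n, 'k) mpoly) ^ t = single (single i t) 1" for i
      by (induction t) (simp_all add: var_def term_of_def mult_single flip: single_add)
    have "finite S" by simp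
    then show ?thesis by (induction S rule: finite_induct) (simp_all add: power_mult_distrib pw mult_single)
  qed
  then have "single m 1 \<in> J" using t by (simp add: m_def)
  then obtain b where b: "b \<in> minimal_generators J" "\<And>i. lookup b i \<le> lookup m i"
    using minimal_generator_below by blast
  have "lookup m i = 0" if "i \<notin> ?G" for i
    unfolding m_def lookup_sum using that by (auto intro!: sum.neutral simp: lookup_single when_def)
  then have "lookup b i = 0" if "i \<notin> ?G" for i using b(2)[of i] that by simp
  then have "\<not> a i < int (lookup b i)" if "i \<notin> ?G" for i using that by (simp add: negative_support_def)
  then show ?thesis using b(1) by (auto simp: degree_complex_def)
qed

section \<open>Torsion\<close>

definition total_degree :: "'n::finite monomial \<Rightarrow> nat" where
  "total_degree m = (\<Sum>i\<in>UNIV. lookup m i)"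

lemma total_degree_add: "total_degree (m + n) = total_degree m + total_degree n"
  by (simp add: total_degree_def lookup_add sum.distrib)

lemma irrelevant_ideal_degree:
  fixes p :: "('n::finite, 'k::field) mpoly"
  assumes "p \<in> irrelevant_ideal" "m \<in> keys p"
  shows "1 \<le> total_degree m"
proof -
  let ?T = "{p :: ('n, 'k) mpoly. \<forall>m\<in>keys p. 1 \<le> total_degree m}"
  have "ideal ?T poly_ring"
  proof (rule poly_idealI)
    show "p + q \<in> ?T" if "p \<in> ?T" "q \<in> ?T" for p q using that keys_add[of p q] by blast
    show "r * p \<in> ?T" if "p \<in> ?T" for r p
    proof -
      have "1 \<le> total_degree m" if m: "m \<in> keys (r * p)" for m
      proof -
        obtain k l where "m = k + l" "l \<in> keys p" using keys_mult[of r p] m by blast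
        then show ?thesis using \<open>p \<in> ?T\<close> by (auto simp: total_degree_add trans_le_add2)
      qed
      then show ?thesis by blast
    qed
  qed simp
  moreover have "total_degree (single i 1 :: 'n monomial) = 1" for i
    by (simp add: total_degree_def lookup_single when_def)
  then have "range var \<subseteq> ?T" by (auto simp: var_def term_of_def)
  ultimately have "irrelevant_ideal \<subseteq> ?T"
    unfolding irrelevant_ideal_def by (rule ring.genideal_minimal[OF ring_poly_ring])
  then show ?thesis using assms by blast
qed

lemma ideal_power_degree:
  fixes p :: "('n::finite, 'k::field) mpoly"
  assumes "p \<in> ideal_power poly_ring irrelevant_ideal t" "m \<in> keys p"
  shows "t \<le> total_degree m"
  using assms
proof (induction t arbitrary: p m)
  case (Suc t)
  from Suc.prems(1) have "p \<in> ideal_prod poly_ring (ideal_power poly_ring irrelevant_ideal t) irrelevant_ideal" by simp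
  then have "\<forall>m\<in>keys p. Suc t \<le> total_degree m"
  proof (induction p rule: ideal_prod.induct)
    case (prod f g)
    show ?case
    proof
      fix m assume "m \<in> keys (f \<otimes>\<^bsub>poly_ring\<^esub> g)"
      then obtain k l where kl: "m = k + l" "k \<in> keys f" "l \<in> keys g"
        using keys_mult[of f g] by auto
      then show "Suc t \<le> total_degree m"
        using Suc.IH[OF prod(1) kl(2)] irrelevant_ideal_degree[OF prod(2) kl(3)] by (simp add: total_degree_add)
    qed
  next
    case (sum f g)
    then show ?case using keys_add[of f g] by auto
  qed
  then show ?case using Suc.prems(2) by blast
qed simp

lemma pow_var_in_ideal_power:
  "x_pow t j \<in> ideal_power poly_ring (irrelevant_ideal :: ('n::finite, 'k::field) mpoly set) t"
proof (induction t)
  case (Suc t)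
  have "(var j :: ('n, 'k) mpoly) \<in> irrelevant_ideal"
    unfolding irrelevant_ideal_def using ring.genideal_self[OF ring_poly_ring, of "range var"] by auto
  from ideal_prod.prod[OF Suc this, of "poly_ring"]
  show ?case by (simp add: var_def term_of_def mult_single flip: single_add)
qed simp

text \<open>The ideals $\mathfrak m^t$ and $(x_1^t, \dots, x_n^t)$ define the same torsion: the power $x_j^t$ lies
  in $\mathfrak m^t$, and a monomial of degree at least $nt$ is divisible by some $x_j^t$.\<close>

lemma (in graded_module) torsion_carrier:
  "x \<in> carrier (torsion M) \<longleftrightarrow> x \<in> carrier M \<and> (\<exists>t. \<forall>j. x_pow t j \<odot> x = \<zero>)"
proof
  assume x: "x \<in> carrier (torsion M)"
  then obtain t where t: "\<And>f. f \<in> ideal_power poly_ring irrelevant_ideal t \<Longrightarrow> f \<odot> x = \<zero>"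
    by (auto simp: torsion_def graded_sub_def)
  then have "\<forall>j. x_pow t j \<odot> x = \<zero>"
    using pow_var_in_ideal_power by blast
  moreover have "x \<in> carrier M" using x by (simp add: torsion_def graded_sub_def)
  ultimately show "x \<in> carrier M \<and> (\<exists>t. \<forall>j. x_pow t j \<odot> x = \<zero>)" by blast
next
  assume "x \<in> carrier M \<and> (\<exists>t. \<forall>j. x_pow t j \<odot> x = \<zero>)"
  then obtain t where x: "x \<in> carrier M" and t: "\<And>j. x_pow t j \<odot> x = \<zero>" by blast
  have "f \<odot> x = \<zero>" if f: "f \<in> ideal_power poly_ring irrelevant_ideal (card (UNIV :: 'n set) * t)" for f
  proof (rule smult_eq_zero[OF x])
    fix m assume "m \<in> keys f"
    then have "card (UNIV :: 'n set) * t \<le> total_degree m" using ideal_power_degree f by blast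
    have "\<exists>j. t \<le> lookup m j"
    proof (rule ccontr)
      assume "\<not> (\<exists>j. t \<le> lookup m j)"
      then have "total_degree m < (\<Sum>i\<in>(UNIV :: 'n set). t)"
        unfolding total_degree_def by (intro sum_strict_mono) (auto simp: not_le)
      then show False using \<open>card UNIV * t \<le> total_degree m\<close> by simp
    qed
    then obtain j where "t \<le> lookup m j" by blast
    then show "\<exists>n. (\<forall>i. lookup n i \<le> lookup m i) \<and> single n 1 \<odot> x = \<zero>"
      using t by (intro exI[of _ "single j t"]) (auto simp: lookup_single when_def)
  qed
  then show "x \<in> carrier (torsion M)" using x by (auto simp: torsion_def graded_sub_def)
qed

section \<open>Complexes of graded modules as operators on vectors\<close>

text \<open>All components $E^q_b$ are placed side by side in a product indexed by \<open>q\<close> and \<open>b\<close>, so that one operator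
  on one type stands for all the maps $d^q$, and one for all multiplications by a variable.\<close>

type_synonym ('n, 'e, 'k) vectors = "int \<Rightarrow> ('n \<Rightarrow> int) \<Rightarrow> ('e \<Rightarrow>\<^sub>0 'k)"

locale graded_complex =
  fixes E :: "int \<Rightarrow> ('n::{finite, linorder}, 'k::field, 'e) multigraded" and d :: "int \<Rightarrow> 'e \<Rightarrow> 'e"
  assumes graded: "graded_module (E q)" and d_hom: "d q \<in> graded_hom (E q) (E (q + 1))"
    and d_d': "x \<in> carrier (E q) \<Longrightarrow> d (q + 1) (d q x) = \<zero>\<^bsub>E (q + 1 + 1)\<^esub>"
begin

sublocale E: graded_module "E q" for q by (rule graded)

lemma d_simps:
  "x \<in> carrier (E q) \<Longrightarrow> d q x \<in> carrier (E (q + 1))"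
  "x \<in> carrier (E q) \<Longrightarrow> y \<in> carrier (E q) \<Longrightarrow> d q (x \<oplus>\<^bsub>E q\<^esub> y) = d q x \<oplus>\<^bsub>E (q + 1)\<^esub> d q y"
  "x \<in> carrier (E q) \<Longrightarrow> d q (r \<odot>\<^bsub>E q\<^esub> x) = r \<odot>\<^bsub>E (q + 1)\<^esub> d q x"
  "x \<in> degree_part (E q) b \<Longrightarrow> d q x \<in> degree_part (E (q + 1)) b"
  using d_hom[of q] by (auto simp: graded_hom_def module_hom_def image_subset_iff)

lemma d_zero: "d q \<zero>\<^bsub>E q\<^esub> = \<zero>\<^bsub>E (q + 1)\<^esub>"
  using d_hom[of q] by (intro module_hom_zero[where R = poly_ring])
    (auto simp: graded_hom_def E.M.abelian_group_axioms)

definition is_embedding :: "int \<Rightarrow> ('n \<Rightarrow> int) \<Rightarrow> ('e \<Rightarrow> 'e \<Rightarrow>\<^sub>0 'k) \<times> (('e \<Rightarrow>\<^sub>0 'k) \<Rightarrow> 'e) \<Rightarrow> bool" where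
  "is_embedding q b jp \<longleftrightarrow>
     (\<forall>x\<in>degree_part (E q) b. \<forall>y\<in>degree_part (E q) b. fst jp (x \<oplus>\<^bsub>E q\<^esub> y) = fst jp x + fst jp y) \<and>
     (\<forall>c. \<forall>x\<in>degree_part (E q) b. fst jp (single 0 c \<odot>\<^bsub>E q\<^esub> x) = pscale c (fst jp x)) \<and>
     (\<forall>p. snd jp p \<in> degree_part (E q) b) \<and> (\<forall>p p'. snd jp (p + p') = snd jp p \<oplus>\<^bsub>E q\<^esub> snd jp p') \<and>
     (\<forall>c p. snd jp (pscale c p) = single 0 c \<odot>\<^bsub>E q\<^esub> snd jp p) \<and>
     (\<forall>x\<in>degree_part (E q) b. snd jp (fst jp x) = x)"

text \<open>A linear embedding of the component $E^q_b$ into vectors, and (\<open>retr\<close>) a linear left inverse of it that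
  is defined for all vectors.\<close>

definition emb :: "int \<Rightarrow> ('n \<Rightarrow> int) \<Rightarrow> 'e \<Rightarrow> 'e \<Rightarrow>\<^sub>0 'k" where
  "emb q b = fst (SOME jp. is_embedding q b jp)"

definition retr :: "int \<Rightarrow> ('n \<Rightarrow> int) \<Rightarrow> ('e \<Rightarrow>\<^sub>0 'k) \<Rightarrow> 'e" where
  "retr q b = snd (SOME jp. is_embedding q b jp)"

lemma emb_retr:
  "x \<in> degree_part (E q) b \<Longrightarrow> y \<in> degree_part (E q) b \<Longrightarrow> emb q b (x \<oplus>\<^bsub>E q\<^esub> y) = emb q b x + emb q b y"
  "x \<in> degree_part (E q) b \<Longrightarrow> emb q b (single 0 c \<odot>\<^bsub>E q\<^esub> x) = pscale c (emb q b x)"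
  "retr q b p \<in> degree_part (E q) b"
  "retr q b (p + p') = retr q b p \<oplus>\<^bsub>E q\<^esub> retr q b p'"
  "retr q b (pscale c p) = single 0 c \<odot>\<^bsub>E q\<^esub> retr q b p"
  "x \<in> degree_part (E q) b \<Longrightarrow> retr q b (emb q b x) = x"
proof -
  obtain j :: "'e \<Rightarrow> 'e \<Rightarrow>\<^sub>0 'k" and \<pi> where jp:
    "\<And>x y. x \<in> carrier (component (E q) b) \<Longrightarrow> y \<in> carrier (component (E q) b) \<Longrightarrow> j (x \<oplus>\<^bsub>component (E q) b\<^esub> y) = j x + j y"
    "\<And>c x. x \<in> carrier (component (E q) b) \<Longrightarrow> j (c \<odot>\<^bsub>component (E q) b\<^esub> x) = pscale c (j x)"
    "\<And>p. \<pi> p \<in> carrier (component (E q) b)" "\<And>p p'. \<pi> (p + p') = \<pi> p \<oplus>\<^bsub>component (E q) b\<^esub> \<pi> p'"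
    "\<And>c p. \<pi> (pscale c p) = c \<odot>\<^bsub>component (E q) b\<^esub> \<pi> p"
    "\<And>x. x \<in> carrier (component (E q) b) \<Longrightarrow> \<pi> (j x) = x"
    using vector_space_embedding[OF E.component_module] by blast
  have "is_embedding q b (j, \<pi>)"
    using jp by (simp add: is_embedding_def component_def term_of_def)
  then have *: "is_embedding q b (SOME jp. is_embedding q b jp)" by (rule someI)
  show "x \<in> degree_part (E q) b \<Longrightarrow> y \<in> degree_part (E q) b \<Longrightarrow> emb q b (x \<oplus>\<^bsub>E q\<^esub> y) = emb q b x + emb q b y"
  "x \<in> degree_part (E q) b \<Longrightarrow> emb q b (single 0 c \<odot>\<^bsub>E q\<^esub> x) = pscale c (emb q b x)"
  "retr q b p \<in> degree_part (E q) b"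
  "retr q b (p + p') = retr q b p \<oplus>\<^bsub>E q\<^esub> retr q b p'"
  "retr q b (pscale c p) = single 0 c \<odot>\<^bsub>E q\<^esub> retr q b p"
  "x \<in> degree_part (E q) b \<Longrightarrow> retr q b (emb q b x) = x"
    using * unfolding is_embedding_def emb_def retr_def by blast+
qed

lemma emb_zero: "emb q b \<zero>\<^bsub>E q\<^esub> = 0"
  using emb_retr(1)[of "\<zero>\<^bsub>E q\<^esub>" q b "\<zero>\<^bsub>E q\<^esub>"] by (simp add: E.part_zero)

lemma retr_zero: "retr q b 0 = \<zero>\<^bsub>E q\<^esub>"
  using emb_retr(6)[OF E.part_zero] by (simp add: emb_zero)

definition wscale :: "'k \<Rightarrow> ('n, 'e, 'k) vectors \<Rightarrow> ('n, 'e, 'k) vectors" where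
  "wscale c f = (\<lambda>q b. pscale c (f q b))"

definition put :: "int \<Rightarrow> ('n \<Rightarrow> int) \<Rightarrow> 'e \<Rightarrow> ('n, 'e, 'k) vectors" where
  "put q b x = (\<lambda>q' b'. if q' = q \<and> b' = b then emb q b x else 0)"

text \<open>Applying the left inverse first makes the operator total and linear; on the vectors that represent
  elements of $E$ it is the differential (\<open>dW_put\<close>).\<close>

definition dW :: "('n, 'e, 'k) vectors \<Rightarrow> ('n, 'e, 'k) vectors" where
  "dW f = (\<lambda>q b. emb q b (d (q - 1) (retr (q - 1) b (f (q - 1) b))))"

definition unshift :: "('n \<Rightarrow> int) \<Rightarrow> 'n \<Rightarrow> 'n \<Rightarrow> int" where
  "unshift b i = (\<lambda>l. if l = i then b l - 1 else b l)"

definition mW :: "'n \<Rightarrow> ('n, 'e, 'k) vectors \<Rightarrow> ('n, 'e, 'k) vectors" where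
  "mW i f = (\<lambda>q b. emb q b (x_pow 1 i \<odot>\<^bsub>E q\<^esub> retr q (unshift b i) (f q (unshift b i))))"

definition VW :: "int \<Rightarrow> ('n \<Rightarrow> int) \<Rightarrow> ('n, 'e, 'k) vectors set" where
  "VW q b = put q b ` degree_part (E q) b"

sublocale W: vector_space wscale
  by unfold_locales (auto simp: wscale_def fun_eq_iff pscale.scale_right_distrib pscale.scale_left_distrib)

lemma unshift_shift [simp]: "unshift (shift b (Suc 0) {i}) i = b" "shift (unshift b i) (Suc 0) {i} = b"
  by (auto simp: unshift_def shift_def)

lemma unshift_eq: "unshift b' i = b \<longleftrightarrow> b' = shift b (Suc 0) {i}"
  by (metis unshift_shift)

lemma unshift_commute: "unshift (unshift b i) l = unshift (unshift b l) i"
  by (auto simp: unshift_def)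

lemma put_simps:
  "x \<in> degree_part (E q) b \<Longrightarrow> y \<in> degree_part (E q) b \<Longrightarrow> put q b (x \<oplus>\<^bsub>E q\<^esub> y) = put q b x + put q b y"
  "x \<in> degree_part (E q) b \<Longrightarrow> put q b (single 0 c \<odot>\<^bsub>E q\<^esub> x) = wscale c (put q b x)"
  "put q b \<zero>\<^bsub>E q\<^esub> = 0"
  by (auto simp: put_def wscale_def fun_eq_iff emb_retr emb_zero)

lemma put_inj:
  assumes "put q b x = put q b y" "x \<in> degree_part (E q) b" "y \<in> degree_part (E q) b" shows "x = y"
proof -
  have "put q b x q b = put q b y q b" using assms(1) by simp
  then have "emb q b x = emb q b y" by (simp add: put_def)
  then show ?thesis using emb_retr(6) assms(2,3) by metis
qed

lemma put_eq_0: "x \<in> degree_part (E q) b \<Longrightarrow> put q b x = 0 \<longleftrightarrow> x = \<zero>\<^bsub>E q\<^esub>"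
  using put_inj[of q b x "\<zero>\<^bsub>E q\<^esub>"] E.part_zero by (auto simp: put_simps)

lemma dW_put: assumes x: "x \<in> degree_part (E q) b" shows "dW (put q b x) = put (q + 1) b (d q x)"
proof (intro ext)
  fix q' b'
  show "dW (put q b x) q' b' = put (q + 1) b (d q x) q' b'"
    using d_zero[of "q' - 1"] by (cases "q' = q + 1 \<and> b' = b")
      (auto simp: dW_def put_def emb_retr(6)[OF x] retr_zero emb_zero)
qed

lemma mW_put: assumes x: "x \<in> degree_part (E q) b" shows "mW i (put q b x) = put q (shift b 1 {i}) (x_pow 1 i \<odot>\<^bsub>E q\<^esub> x)"
proof (intro ext)
  fix q' b'
  show "mW i (put q b x) q' b' = put q (shift b 1 {i}) (x_pow 1 i \<odot>\<^bsub>E q\<^esub> x) q' b'"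
    using E.M.smult_r_null
    by (cases "q' = q \<and> b' = shift b 1 {i}") (auto simp: mW_def put_def unshift_eq emb_retr(6)[OF x] retr_zero emb_zero)
qed

lemma mW_pow_put:
  assumes x: "x \<in> degree_part (E q) b"
  shows "(mW i ^^ t) (put q b x) = put q (shift b t {i}) (x_pow t i \<odot>\<^bsub>E q\<^esub> x)"
proof (induction t)
  case 0
  then show ?case using E.smult_poly_one[OF E.part_carrier[OF x]] by simp
next
  case (Suc t)
  have "x_pow 1 i \<odot>\<^bsub>E q\<^esub> (x_pow t i \<odot>\<^bsub>E q\<^esub> x) = x_pow (Suc t) i \<odot>\<^bsub>E q\<^esub> x"
    using E.part_carrier[OF x] by (simp add: mult_single flip: E.smult_poly_mult single_add)
  then show ?case using mW_put[OF E.part_pow[OF x, of i t], of i] Suc by (simp add: shift_shift)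
qed

lemma retr_part: "retr (q - 1) b p \<in> carrier (E (q - 1))" "retr q b p \<in> carrier (E q)"
  using emb_retr(3) E.part_carrier by blast+

lemma d_prev: "x \<in> degree_part (E (q - 1)) b \<Longrightarrow> d (q - 1) x \<in> degree_part (E q) b"
  using d_simps(4)[of x "q - 1" b] by simp

lemma x_prev: "x \<in> degree_part (E q) (unshift b i) \<Longrightarrow> x_pow 1 i \<odot>\<^bsub>E q\<^esub> x \<in> degree_part (E q) b"
  using E.part_pow[of x q "unshift b i" i 1] by simp

lemma smult_commute: "x \<in> carrier (E q) \<Longrightarrow> p \<odot>\<^bsub>E q\<^esub> (r \<odot>\<^bsub>E q\<^esub> x) = r \<odot>\<^bsub>E q\<^esub> (p \<odot>\<^bsub>E q\<^esub> x)"
  by (simp add: mult.commute flip: E.smult_poly_mult)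

lemma linear_dW: "Vector_Spaces.linear wscale wscale dW"
proof unfold_locales
  show "dW (f + g) = dW f + dW g" for f g
  proof (intro ext)
    fix q b
    show "dW (f + g) q b = (dW f + dW g) q b"
      using d_simps(2)[of "retr (q - 1) b (f (q - 1) b)" "q - 1" "retr (q - 1) b (g (q - 1) b)"]
      by (simp add: dW_def emb_retr retr_part d_prev)
  qed
  show "dW (wscale r f) = wscale r (dW f)" for r f
  proof (intro ext)
    fix q b
    show "dW (wscale r f) q b = wscale r (dW f) q b"
      using d_simps(3)[of "retr (q - 1) b (f (q - 1) b)" "q - 1" "single 0 r"]
      by (simp add: dW_def wscale_def emb_retr retr_part d_prev)
  qed
qed

lemma linear_mW: "Vector_Spaces.linear wscale wscale (mW i)"
proof unfold_locales
  show "mW i (f + g) = mW i f + mW i g" for f g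
  proof (intro ext)
    fix q b
    show "mW i (f + g) q b = (mW i f + mW i g) q b"
      using x_prev[OF emb_retr(3), of q i b] by (simp add: mW_def emb_retr retr_part E.M.smult_r_distr)
  qed
  show "mW i (wscale r f) = wscale r (mW i f)" for r f
  proof (intro ext)
    fix q b
    show "mW i (wscale r f) q b = wscale r (mW i f) q b"
      using x_prev[OF emb_retr(3), of q i b] retr_part(2)
      by (simp add: mW_def wscale_def emb_retr smult_commute[of _ _ "x_pow (Suc 0) i"])
  qed
qed

lemma dW_dW: "dW (dW f) = 0"
proof (intro ext)
  fix q b
  have "d (q - 1) (d (q - 1 - 1) (retr (q - 1 - 1) b (f (q - 1 - 1) b))) = \<zero>\<^bsub>E q\<^esub>"
    using d_d'[OF retr_part(2), of "q - 1 - 1"] by simp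
  moreover have "retr (q - 1) b (dW f (q - 1) b) = d (q - 1 - 1) (retr (q - 1 - 1) b (f (q - 1 - 1) b))"
    unfolding dW_def by (intro emb_retr(6) d_prev emb_retr(3))
  ultimately show "dW (dW f) q b = 0 q b" unfolding dW_def[of "dW f"] by (simp add: emb_zero)
qed

lemma dW_mW: "dW (mW i f) = mW i (dW f)"
proof (intro ext)
  fix q b
  let ?x = "retr (q - 1) (unshift b i) (f (q - 1) (unshift b i))"
  have "retr (q - 1) b (mW i f (q - 1) b) = x_pow 1 i \<odot>\<^bsub>E (q - 1)\<^esub> ?x"
    unfolding mW_def by (intro emb_retr(6) x_prev emb_retr(3))
  moreover have "retr q (unshift b i) (dW f q (unshift b i)) = d (q - 1) ?x"
    unfolding dW_def by (intro emb_retr(6) d_prev emb_retr(3))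
  moreover have "d (q - 1) (x_pow 1 i \<odot>\<^bsub>E (q - 1)\<^esub> ?x) = x_pow 1 i \<odot>\<^bsub>E q\<^esub> d (q - 1) ?x"
    using d_simps(3)[OF retr_part(2), of "q - 1" "x_pow 1 i"] by simp
  ultimately show "dW (mW i f) q b = mW i (dW f) q b"
    unfolding dW_def[of "mW i f"] mW_def[of i "dW f"] by simp
qed

lemma mW_mW: "mW i (mW l f) = mW l (mW i f)"
proof (intro ext)
  fix q b
  have 1: "retr q (unshift b i) (mW l f q (unshift b i)) =
      x_pow 1 l \<odot>\<^bsub>E q\<^esub> retr q (unshift (unshift b i) l) (f q (unshift (unshift b i) l))" for i l
    unfolding mW_def by (intro emb_retr(6) x_prev emb_retr(3))
  show "mW i (mW l f) q b = mW l (mW i f) q b"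
    unfolding mW_def[of i "mW l f"] mW_def[of l "mW i f"] 1
    by (simp add: unshift_commute[of b i l] smult_commute[OF retr_part(2), of q "x_pow (Suc 0) l"])
qed

lemma VW_put: "x \<in> degree_part (E q) b \<Longrightarrow> put q b x \<in> VW q b"
  by (simp add: VW_def)

lemma subspace_VW: "W.subspace (VW q b)"
  unfolding W.subspace_def VW_def
proof (intro conjI ballI allI)
  show "0 \<in> put q b ` degree_part (E q) b" using put_simps(3) E.part_zero by (metis imageI)
  show "v + w \<in> put q b ` degree_part (E q) b" if "v \<in> put q b ` degree_part (E q) b" "w \<in> put q b ` degree_part (E q) b" for v w
    using that by (auto simp flip: put_simps(1) intro: E.part_add)
  show "wscale c v \<in> put q b ` degree_part (E q) b" if "v \<in> put q b ` degree_part (E q) b" for c v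
    using that by (auto simp flip: put_simps(2) intro: E.part_scalar)
qed

end

section \<open>The resolution of a quotient of monomial ideals\<close>

locale quotient_resolution =
  fixes I J :: "('n::{finite, linorder}, 'k::field) mpoly set"
    and E :: "int \<Rightarrow> ('n, 'k, 'e) multigraded" and d :: "int \<Rightarrow> 'e \<Rightarrow> 'e"
    and \<epsilon> :: "('n, 'k) mpoly set \<Rightarrow> 'e"
  assumes I: "monomial_ideal I" and J: "monomial_ideal J"
    and resolution: "injective_resolution (ideal_quotient I J) \<epsilon> E d"
begin

lemma injective: "graded_injective (E q)"
  using resolution by (simp add: injective_resolution_def)

lemma E_neg: "q < 0 \<Longrightarrow> carrier (E q) = {\<zero>\<^bsub>E q\<^esub>}"
  using resolution by (simp add: injective_resolution_def)

lemma boundaries_eq_cycles: "q > 0 \<Longrightarrow> coboundaries E d q = cocycles E d q"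
  using resolution by (simp add: injective_resolution_def)

sublocale graded_complex E d
proof
  show gr: "multigraded_module (E q)" for q using injective by (simp add: graded_injective_def)
  show dh: "d q \<in> graded_hom (E q) (E (q + 1))" for q using resolution by (simp add: injective_resolution_def)
  fix q x assume x: "x \<in> carrier (E q)"
  show "d (q + 1) (d q x) = \<zero>\<^bsub>E (q + 1 + 1)\<^esub>"
  proof (cases "q < 0")
    case True
    have z: "d q \<zero>\<^bsub>E q\<^esub> = \<zero>\<^bsub>E (q + 1)\<^esub>" for q
    proof (rule module_hom_zero[where R = poly_ring])
      show "d q \<in> module_hom poly_ring (E q) (E (q + 1))" using dh by (simp add: graded_hom_def)
      show "abelian_group (E q)" for q using gr[of q] by (simp add: multigraded_module_def module_def)
      then show "abelian_group (E (q + 1))" .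
    qed
    have "x = \<zero>\<^bsub>E q\<^esub>" using x E_neg[OF True] by simp
    then show ?thesis by (simp add: z)
  next
    case False
    have "d q x \<in> coboundaries E d (q + 1)" using x by (simp add: coboundaries_def)
    then have "d q x \<in> cocycles E d (q + 1)" using boundaries_eq_cycles[of "q + 1"] False by simp
    then show ?thesis by (simp add: cocycles_def)
  qed
qed

text \<open>Exactness gives some preimage; its component in degree \<open>b\<close> is a preimage of \<open>x\<close> as well.\<close>

lemma exact_part:
  assumes q: "q > 0" and x: "x \<in> degree_part (E q) b" and dx: "d q x = \<zero>\<^bsub>E (q + 1)\<^esub>"
  shows "\<exists>y\<in>degree_part (E (q - 1)) b. d (q - 1) y = x"
proof -
  have "x \<in> cocycles E d q" using E.part_carrier[OF x] dx by (simp add: cocycles_def)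
  then have "x \<in> coboundaries E d q" using boundaries_eq_cycles[OF q] by simp
  then obtain y where y: "y \<in> carrier (E (q - 1))" "d (q - 1) y = x"
    unfolding coboundaries_def by blast
  have "E.hcomp q (d (q - 1) y) b = d (q - 1) (E.hcomp (q - 1) y b)"
    using hcomp_commute[where \<sigma> = "\<lambda>b. b" and g = "d (q - 1)" and b = b, OF E.graded_module_axioms[of "q - 1"] E.graded_module_axioms[of q]]
      d_simps[of _ "q - 1"] y(1) by simp
  then have "d (q - 1) (E.hcomp (q - 1) y b) = x" using E.hcomp_part[OF x] y(2) by simp
  then show ?thesis using E.hcomp(1)[OF y(1)] by blast
qed

lemmas ideal_I = ideal_closed[OF monomial_ideal_ideal[OF I]]
lemmas ideal_J = ideal_closed[OF monomial_ideal_ideal[OF J]]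

definition qclass :: "('n, 'k) mpoly \<Rightarrow> ('n, 'k) mpoly set" where
  "qclass f = (\<lambda>h. h + f) ` J"

lemma qclass_eq: "qclass f = qclass g \<longleftrightarrow> f - g \<in> J"
proof
  assume "qclass f = qclass g"
  moreover have "f \<in> qclass f" unfolding qclass_def using ideal_J(1) by force
  ultimately obtain h where "h \<in> J" "f = h + g" by (auto simp: qclass_def)
  then show "f - g \<in> J" by simp
next
  assume fg: "f - g \<in> J"
  show "qclass f = qclass g"
  proof (intro subset_antisym subsetI)
    fix p assume "p \<in> qclass f"
    then obtain h where "h \<in> J" "p = (h + (f - g)) + g" by (auto simp: qclass_def)
    then show "p \<in> qclass g" using ideal_J(2)[OF _ fg] unfolding qclass_def by blast
  next
    fix p assume "p \<in> qclass g"
    then obtain h where "h \<in> J" "p = (h - (f - g)) + f" by (auto simp: qclass_def)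
    then show "p \<in> qclass f" using ideal_J(5)[OF _ fg] unfolding qclass_def by blast
  qed
qed

lemma a_r_coset_qclass: "J +>\<^bsub>graded_sub poly_module I\<^esub> f = qclass f"
  by (auto simp: a_r_coset_def' qclass_def graded_sub_def poly_module_def)

lemma quotient_simps:
  "carrier (ideal_quotient I J) = qclass ` I"
  "degree_part (ideal_quotient I J) b = qclass ` (I \<inter> degree_part poly_module b)"
  by (auto simp: ideal_quotient_def graded_quot_def quot_module_def module.extend_def gmodule.fields_def
      A_RCOSETS_def' a_r_coset_qclass) (auto simp: graded_sub_def)

lemma quotient_add: "qclass f \<oplus>\<^bsub>ideal_quotient I J\<^esub> qclass g = qclass (f + g)"
proof -
  have "qclass f \<oplus>\<^bsub>ideal_quotient I J\<^esub> qclass g = (\<Union>h\<in>J. \<Union>h'\<in>J. {(h + f) + (h' + g)})"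
    by (auto simp: ideal_quotient_def graded_quot_def quot_module_def module.extend_def gmodule.fields_def
      set_add_def' qclass_def graded_sub_def poly_module_def)
  also have "\<dots> = qclass (f + g)"
  proof -
    have "(h + f) + (h' + g) \<in> qclass (f + g)" if "h \<in> J" "h' \<in> J" for h h'
    proof -
      have "(h + f) + (h' + g) = (h + h') + (f + g)" by simp
      then show ?thesis using ideal_J(2)[OF that] unfolding qclass_def by blast
    qed
    moreover have "h + (f + g) \<in> (\<Union>h\<in>J. \<Union>h'\<in>J. {(h + f) + (h' + g)})" if "h \<in> J" for h
    proof -
      have "h + (f + g) = (h + f) + (0 + g)" by simp
      then show ?thesis using that ideal_J(1) by blast
    qed
    ultimately show ?thesis by (auto simp: qclass_def)
  qed
  finally show ?thesis .
qed

lemma quotient_smult: "r \<odot>\<^bsub>ideal_quotient I J\<^esub> qclass f = qclass (r * f)"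
proof -
  have "r \<odot>\<^bsub>ideal_quotient I J\<^esub> qclass f = (\<Union>x\<in>qclass f. J +>\<^bsub>graded_sub poly_module I\<^esub> (r * x))"
    by (simp add: ideal_quotient_def graded_quot_def quot_module_def module.extend_def gmodule.fields_def)
      (simp add: graded_sub_def poly_module_def)
  also have "\<dots> = (\<Union>h\<in>J. qclass (r * (h + f)))" unfolding a_r_coset_qclass by (simp add: qclass_def)
  also have "\<dots> = qclass (r * f)"
  proof -
    have "qclass (r * (h + f)) = qclass (r * f)" if "h \<in> J" for h
      using ideal_J(3)[OF that, of r] by (simp add: qclass_eq algebra_simps)
    then show ?thesis using ideal_J(1) by auto
  qed
  finally show ?thesis .
qed

definition eta :: "('n, 'k) mpoly \<Rightarrow> 'e" where "eta f = \<epsilon> (qclass f)"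

lemma \<epsilon>: "\<epsilon> \<in> graded_hom (ideal_quotient I J) (E 0)" "inj_on \<epsilon> (qclass ` I)" "\<epsilon> ` qclass ` I = cocycles E d 0"
  using resolution by (simp_all add: injective_resolution_def flip: quotient_simps(1))

lemma eta_carrier: "f \<in> I \<Longrightarrow> eta f \<in> carrier (E 0)"
  using \<epsilon>(1) by (auto simp: graded_hom_def module_hom_def eta_def quotient_simps)

lemma eta_add: "f \<in> I \<Longrightarrow> g \<in> I \<Longrightarrow> eta (f + g) = eta f \<oplus>\<^bsub>E 0\<^esub> eta g"
  using \<epsilon>(1) by (auto simp: graded_hom_def module_hom_def eta_def quotient_simps quotient_add)

lemma eta_smult: "f \<in> I \<Longrightarrow> eta (r * f) = r \<odot>\<^bsub>E 0\<^esub> eta f"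
  using \<epsilon>(1) by (auto simp: graded_hom_def module_hom_def eta_def quotient_simps quotient_smult)

lemma eta_part: "f \<in> I \<Longrightarrow> f \<in> degree_part poly_module b \<Longrightarrow> eta f \<in> degree_part (E 0) b"
  using \<epsilon>(1) by (auto simp: graded_hom_def module_hom_def eta_def quotient_simps image_subset_iff)

lemma eta_zero: "eta 0 = \<zero>\<^bsub>E 0\<^esub>"
  using eta_smult[OF ideal_I(1), of 0] E.smult_poly_zero[OF eta_carrier[OF ideal_I(1)]] by simp

lemma eta_eq_0: "f \<in> I \<Longrightarrow> eta f = \<zero>\<^bsub>E 0\<^esub> \<longleftrightarrow> f \<in> J"
  using inj_on_eq_iff[OF \<epsilon>(2) imageI imageI, of f 0] ideal_I(1) by (simp add: qclass_eq eta_def flip: eta_zero)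

lemma eta_cocycle: "f \<in> I \<Longrightarrow> d 0 (eta f) = \<zero>\<^bsub>E 1\<^esub>"
  using \<epsilon>(3) by (auto simp: eta_def cocycles_def)

text \<open>The image in $E^0$ of the monomial of degree \<open>b\<close>. Because $I/J$ is at most one-dimensional in each
  degree, it spans the image of the component of degree \<open>b\<close>.\<close>

definition unit :: "('n \<Rightarrow> int) \<Rightarrow> 'e" where
  "unit b = (if b \<in> exponents I then eta (single (monomial_of b) 1) else \<zero>\<^bsub>E 0\<^esub>)"

lemma unit_part: "unit b \<in> degree_part (E 0) b"
  using eta_part[of "single (monomial_of b) 1" b] E.part_zero
  by (auto simp: unit_def exponents_def poly_module_def)

lemma unit_eq_0: "unit b \<noteq> \<zero>\<^bsub>E 0\<^esub> \<longleftrightarrow> b \<in> exponents I - exponents J"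
  using eta_eq_0[of "single (monomial_of b) 1"] by (auto simp: unit_def exponents_def)

lemma unit_cocycle: "d 0 (unit b) = \<zero>\<^bsub>E 1\<^esub>"
  using eta_cocycle d_zero[of 0] by (auto simp: unit_def exponents_def)

lemma x_unit: assumes b: "b \<in> exponents I" shows "x_pow 1 i \<odot>\<^bsub>E 0\<^esub> unit b = unit (shift b 1 {i})"
proof -
  have "single i 1 + monomial_of b = monomial_of (shift b 1 {i})"
    using b by (intro poly_mapping_eqI) (auto simp: lookup_add lookup_single when_def shift_def exponents_def nat_add_distrib)
  then show ?thesis
    using b exponents_shift[OF I b, of 1 "{i}"] eta_smult[of "single (monomial_of b) 1" "x_pow 1 i"]
    by (simp add: unit_def exponents_def mult_single)
qed

text \<open>By additivity it suffices to look at a single term, which lies in \<open>I\<close> because \<open>I\<close> is a monomial ideal.\<close>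

lemma hcomp_eta:
  assumes "f \<in> I" shows "\<exists>c. E.hcomp 0 (eta f) b = single 0 c \<odot>\<^bsub>E 0\<^esub> unit b"
proof -
  have u: "unit b \<in> carrier (E 0)" using unit_part E.part_carrier by blast
  have "f \<in> I \<and> (\<exists>c. E.hcomp 0 (eta f) b = single 0 c \<odot>\<^bsub>E 0\<^esub> unit b)"
  proof (induction f rule: poly_induct_terms)
    case zero
    then show ?case using ideal_I(1) by (auto simp: eta_zero E.hcomp_zero E.smult_poly_zero[OF u] intro!: exI[of _ 0])
  next
    case (add f g)
    then obtain c c' where c: "E.hcomp 0 (eta f) b = single 0 c \<odot>\<^bsub>E 0\<^esub> unit b"
      "E.hcomp 0 (eta g) b = single 0 c' \<odot>\<^bsub>E 0\<^esub> unit b" by blast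
    have "E.hcomp 0 (eta (f + g)) b = single 0 (c + c') \<odot>\<^bsub>E 0\<^esub> unit b"
      using add c by (simp add: eta_add E.hcomp_add eta_carrier single_add E.smult_poly_add[OF u])
    then show ?case using add ideal_I(2) by blast
  next
    case (monomial m)
    let ?c = "lookup f m"
    have mI: "single m c \<in> I" for c using monomial_ideal_terms[OF I assms monomial] .
    define b' where "b' = (\<lambda>i. int (lookup m i))"
    have m: "monomial_of b' = m" by (rule poly_mapping_eqI) (simp add: b'_def)
    have b': "b' \<in> exponents I" using mI[of 1] by (simp add: exponents_def m) (simp add: b'_def)
    have "single m ?c = single 0 ?c * single m 1" by (simp add: mult_single)
    then have eq: "eta (single m ?c) = single 0 ?c \<odot>\<^bsub>E 0\<^esub> unit b'"
      using eta_smult[OF mI, of "single 0 ?c" 1] b' by (simp add: unit_def m)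
    have "E.hcomp 0 (eta (single m ?c)) b = (if b = b' then single 0 ?c \<odot>\<^bsub>E 0\<^esub> unit b' else \<zero>\<^bsub>E 0\<^esub>)"
      unfolding eq by (rule E.hcomp_part) (intro E.part_scalar unit_part)
    then show ?case using mI E.smult_poly_zero[OF u] by (metis single_zero)
  qed
  then show ?thesis by blast
qed

lemma kernel_unit:
  assumes x: "x \<in> degree_part (E 0) b" and dx: "d 0 x = \<zero>\<^bsub>E 1\<^esub>"
  shows "\<exists>c. x = single 0 c \<odot>\<^bsub>E 0\<^esub> unit b"
proof -
  have "x \<in> cocycles E d 0" using E.part_carrier[OF x] dx by (simp add: cocycles_def)
  then obtain f where "f \<in> I" "x = eta f" using \<epsilon>(3) by (auto simp: eta_def)
  then show ?thesis using hcomp_eta[of f b] E.hcomp_part[OF x] by simp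
qed

lemma resolution_of_exponents:
  assumes stable: "\<And>t F. t0 \<le> t \<Longrightarrow> shift a t F \<in> exponents I - exponents J \<longleftrightarrow> F \<in> \<F>"
  shows "multigraded_resolution wscale dW mW VW (\<lambda>b. put 0 b (unit b)) (exponents I) a t0 \<F>"
proof -
  show ?thesis
  proof (intro multigraded_resolution.intro multigraded_resolution_axioms.intro)
    show "vector_space wscale" by (rule W.vector_space_axioms)
    show "Vector_Spaces.linear wscale wscale dW" by (rule linear_dW)
    show "Vector_Spaces.linear wscale wscale (mW j)" for j by (rule linear_mW)
    show "W.subspace (VW q b)" for q b by (rule subspace_VW)
    show "dW x \<in> VW (q + 1) b" if "x \<in> VW q b" for q b x
      using that by (auto simp: VW_def dW_put intro!: imageI d_simps)
    show "mW j x \<in> VW q (shift b 1 {j})" if "x \<in> VW q b" for q b j x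
      using that E.part_pow[of _ q b j 1] by (auto simp: VW_def mW_put)
    show "dW (dW x) = 0" for x by (rule dW_dW)
    show "dW (mW j x) = mW j (dW x)" for j x by (rule dW_mW)
    show "mW j (mW l x) = mW l (mW j x)" for j l x by (rule mW_mW)
    show "VW q b = {0}" if "q < 0" for q b
    proof -
      have "degree_part (E q) b = {\<zero>\<^bsub>E q\<^esub>}"
        using E_neg[OF that] E.part_carrier[of _ q b] E.part_zero[of q b] by blast
      then show ?thesis by (simp add: VW_def put_simps)
    qed
    show "\<exists>y\<in>VW (q - 1) b. dW y = x" if q: "0 < q" and x: "x \<in> VW q b" and dx: "dW x = 0" for q b x
    proof -
      obtain x' where x': "x' \<in> degree_part (E q) b" "x = put q b x'" using x by (auto simp: VW_def)
      have "d q x' = \<zero>\<^bsub>E (q + 1)\<^esub>" using dx x' by (simp add: dW_put put_eq_0 d_simps)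
      then obtain y where "y \<in> degree_part (E (q - 1)) b" "d (q - 1) y = x'" using exact_part[OF q x'(1)] by blast
      then show ?thesis using x'(2) dW_put[of y "q - 1" b] by (auto simp: VW_def)
    qed
    show "\<exists>c. x = wscale c (put 0 b (unit b))" if x: "x \<in> VW 0 b" and dx: "dW x = 0" for b x
    proof -
      obtain x' where x': "x' \<in> degree_part (E 0) b" "x = put 0 b x'" using x by (auto simp: VW_def)
      have "put 1 b (d 0 x') = 0" using dx x' dW_put[OF x'(1)] by simp
      then have "d 0 x' = \<zero>\<^bsub>E 1\<^esub>" using put_eq_0[of "d 0 x'" 1 b] d_simps(4)[OF x'(1)] by simp
      then obtain c where "x' = single 0 c \<odot>\<^bsub>E 0\<^esub> unit b" using kernel_unit[OF x'(1)] by blast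
      then show ?thesis using x'(2) unit_part by (auto simp: put_simps)
    qed
    show "put 0 b (unit b) \<in> VW 0 b" for b by (rule VW_put[OF unit_part])
    show "dW (put 0 b (unit b)) = 0" for b
      using dW_put[OF unit_part[of b]] unit_cocycle[of b] by (simp add: put_simps)
    show "b \<in> exponents I" if "put 0 b (unit b) \<noteq> 0" for b
      using that put_eq_0[OF unit_part[of b]] unit_eq_0[of b] by blast
    show "shift b 1 {j} \<in> exponents I" if "b \<in> exponents I" for b j by (rule exponents_shift[OF I that])
    show "mW j (put 0 b (unit b)) = put 0 (shift b 1 {j}) (unit (shift b 1 {j}))" if "b \<in> exponents I" for b j
      by (simp only: mW_put[OF unit_part] x_unit[OF that])
    show "\<exists>x\<in>VW q b. (mW l ^^ t) x = y \<and> (\<forall>j\<in>A. (mW j ^^ t) x = 0)"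
      if l: "l \<notin> A" and y: "y \<in> VW q (shift b t {l})" and ann: "\<forall>j\<in>A. (mW j ^^ t) y = 0" for q b l A y t
    proof -
      obtain y' where y': "y' \<in> degree_part (E q) (shift b t {l})" "y = put q (shift b t {l}) y'" using y by (auto simp: VW_def)
      have "x_pow t j \<odot>\<^bsub>E q\<^esub> y' = \<zero>\<^bsub>E q\<^esub>" if "j \<in> A" for j
      proof -
        have "put q (shift (shift b t {l}) t {j}) (x_pow t j \<odot>\<^bsub>E q\<^esub> y') = 0"
          using ann that y'(2) mW_pow_put[OF y'(1)] by metis
        then show ?thesis using put_eq_0[OF E.part_pow[OF y'(1)]] by blast
      qed
      then obtain x where x: "x \<in> degree_part (E q) b" "x_pow t l \<odot>\<^bsub>E q\<^esub> x = y'"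
          "\<And>j. j \<in> A \<Longrightarrow> x_pow t j \<odot>\<^bsub>E q\<^esub> x = \<zero>\<^bsub>E q\<^esub>"
        using graded_injective_divide[OF injective l y'(1)] by blast
      then show ?thesis
        by (intro bexI[of _ "put q b x"]) (auto simp: mW_pow_put y'(2) put_simps VW_put)
    qed
    show "put 0 (shift a t F) (unit (shift a t F)) \<noteq> 0 \<longleftrightarrow> F \<in> \<F>" if "t0 \<le> t" for t F
      using stable[OF that] put_eq_0[OF unit_part] unit_eq_0 by blast
  qed
qed

text \<open>The relation between torsion cocycles of degree \<open>a\<close> and cochains. Coboundaries may come from
  inhomogeneous torsion elements; their components of degree \<open>a\<close> are again torsion and have the same
  image.\<close>

lemma torsion_cochains_comparison:
  fixes a :: "'n \<Rightarrow> int"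
  assumes F: "\<F> = {F. negative_support a \<subseteq> F \<and> F - negative_support a \<in> degree_complex a J - degree_complex a I}"
  obtains Rel :: "'e \<Rightarrow> ('n set \<Rightarrow> 'k) \<Rightarrow> bool" where
    "\<And>z c. Rel z c \<Longrightarrow> z \<in> degree_part (E i) a \<and> z \<in> cocycles (\<lambda>q. torsion (E q)) d i \<and>
       c \<in> face_cochains \<F> i \<and> face_coboundary \<F> c = (\<lambda>_. 0)"
    "\<And>z. z \<in> degree_part (E i) a \<Longrightarrow> z \<in> cocycles (\<lambda>q. torsion (E q)) d i \<Longrightarrow> \<exists>c. Rel z c"
    "\<And>c. c \<in> face_cochains \<F> i \<Longrightarrow> face_coboundary \<F> c = (\<lambda>_. 0) \<Longrightarrow> \<exists>z. Rel z c"
    "\<And>z c z' c'. Rel z c \<Longrightarrow> Rel z' c' \<Longrightarrow> Rel (z \<oplus>\<^bsub>E i\<^esub> z') (\<lambda>F. c F + c' F)"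
    "\<And>z c r. Rel z c \<Longrightarrow> Rel (single 0 r \<odot>\<^bsub>E i\<^esub> z) (\<lambda>F. r * c F)"
    "\<And>z c. Rel z c \<Longrightarrow> z \<in> coboundaries (\<lambda>q. torsion (E q)) d i \<longleftrightarrow>
       c \<in> face_coboundary \<F> ` face_cochains \<F> (i - 1)"
proof -
  obtain t0 where t0: "\<And>t F. t0 \<le> t \<Longrightarrow> shift a t F \<in> exponents I - exponents J \<longleftrightarrow>
     negative_support a \<subseteq> F \<and> F - negative_support a \<in> degree_complex a J - degree_complex a I"
    using exponents_diff_stable[OF I J, of a] by blast
  interpret R: multigraded_resolution wscale dW mW VW "\<lambda>b. put 0 b (unit b)" "exponents I" a t0 \<F>
    by (rule resolution_of_exponents) (unfold F, use t0 in blast)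
  have pw: "(mW j ^^ t) (put q a z) = 0 \<longleftrightarrow> x_pow t j \<odot>\<^bsub>E q\<^esub> z = \<zero>\<^bsub>E q\<^esub>" if "z \<in> degree_part (E q) a" for j t q z
    using put_eq_0[OF E.part_pow[OF that]] mW_pow_put[OF that] by simp
  have tors: "z \<in> carrier (torsion (E q)) \<longleftrightarrow> (\<exists>t. \<forall>j. (mW j ^^ t) (put q a z) = 0)" if "z \<in> degree_part (E q) a" for q z
    using E.torsion_carrier[of z q] E.part_carrier[OF that] pw[OF that] by simp
  have cyc: "put i a z \<in> R.torsion_cocycles i \<longleftrightarrow> z \<in> cocycles (\<lambda>q. torsion (E q)) d i" if z: "z \<in> degree_part (E i) a" for z
  proof -
    have "dW (put i a z) = 0 \<longleftrightarrow> d i z = \<zero>\<^bsub>E (i + 1)\<^esub>"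
      using dW_put[OF z] put_eq_0 d_simps(4)[OF z] by simp
    moreover have "\<zero>\<^bsub>torsion (E (i + 1))\<^esub> = \<zero>\<^bsub>E (i + 1)\<^esub>" by (simp add: torsion_def graded_sub_def)
    ultimately show ?thesis using tors[OF z] VW_put[OF z] by (auto simp: R.torsion_cocycles_def cocycles_def)
  qed
  have bd: "put i a z \<in> R.torsion_coboundaries i \<longleftrightarrow> z \<in> coboundaries (\<lambda>q. torsion (E q)) d i" if z: "z \<in> degree_part (E i) a" for z
  proof
    assume "put i a z \<in> R.torsion_coboundaries i"
    then obtain v where v: "v \<in> VW (i - 1) a" "\<exists>t. \<forall>j. (mW j ^^ t) v = 0" "put i a z = dW v"
      unfolding R.torsion_coboundaries_def by blast
    then obtain y where "y \<in> degree_part (E (i - 1)) a" "v = put (i - 1) a y" unfolding VW_def by blast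
    with v have y: "y \<in> degree_part (E (i - 1)) a" "\<exists>t. \<forall>j. (mW j ^^ t) (put (i - 1) a y) = 0"
        "dW (put (i - 1) a y) = put i a z" by simp_all
    have "put i a (d (i - 1) y) = put i a z" using dW_put[OF y(1)] y(3) by simp
    then have "d (i - 1) y = z" using put_inj[OF _ d_prev[OF y(1)] z] by blast
    then show "z \<in> coboundaries (\<lambda>q. torsion (E q)) d i" using tors[OF y(1)] y(2) by (auto simp: coboundaries_def)
  next
    assume "z \<in> coboundaries (\<lambda>q. torsion (E q)) d i"
    then obtain y where y: "y \<in> carrier (torsion (E (i - 1)))" "d (i - 1) y = z" by (auto simp: coboundaries_def)
    then obtain t where yc: "y \<in> carrier (E (i - 1))" and t: "\<And>j. x_pow t j \<odot>\<^bsub>E (i - 1)\<^esub> y = \<zero>\<^bsub>E (i - 1)\<^esub>"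
      using E.torsion_carrier[of y "i - 1"] by auto
    define y' where "y' = E.hcomp (i - 1) y a"
    have y': "y' \<in> degree_part (E (i - 1)) a" unfolding y'_def by (rule E.hcomp(1)[OF yc])
    have "E.hcomp i (d (i - 1) y) a = d (i - 1) y'"
      unfolding y'_def
      using hcomp_commute[where \<sigma> = "\<lambda>b. b" and g = "d (i - 1)" and b = a, OF E.graded_module_axioms[of "i - 1"] E.graded_module_axioms[of i]]
        d_simps[of _ "i - 1"] yc by simp
    then have dy': "d (i - 1) y' = z" using y(2) E.hcomp_part[OF z] by simp
    have "x_pow t j \<odot>\<^bsub>E (i - 1)\<^esub> y' = \<zero>\<^bsub>E (i - 1)\<^esub>" for j
    proof -
      have inj: "inj (\<lambda>b. shift b t {j})"
        by (rule injI) (auto simp: shift_def fun_eq_iff split: if_splits)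
      have "E.hcomp (i - 1) (x_pow t j \<odot>\<^bsub>E (i - 1)\<^esub> y) (shift a t {j}) = x_pow t j \<odot>\<^bsub>E (i - 1)\<^esub> y'"
        unfolding y'_def
        by (rule hcomp_commute[where \<sigma> = "\<lambda>b. shift b t {j}", OF E.graded_module_axioms E.graded_module_axioms _ _ _ inj yc])
          (simp_all add: E.M.smult_r_distr E.part_pow)
      then show ?thesis by (simp add: t E.hcomp_zero)
    qed
    then have "\<exists>t. \<forall>j. (mW j ^^ t) (put (i - 1) a y') = 0" using pw[OF y'] by blast
    moreover have "dW (put (i - 1) a y') = put i a z" using dW_put[OF y'] dy' by simp
    ultimately show "put i a z \<in> R.torsion_coboundaries i"
      unfolding R.torsion_coboundaries_def using VW_put[OF y'] by force
  qed
  show thesis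
  proof (rule that[of "\<lambda>z c. z \<in> degree_part (E i) a \<and> R.rel i (put i a z) c"])
    show "z \<in> degree_part (E i) a \<and> z \<in> cocycles (\<lambda>q. torsion (E q)) d i \<and>
       c \<in> face_cochains \<F> i \<and> face_coboundary \<F> c = (\<lambda>_. 0)"
      if "z \<in> degree_part (E i) a \<and> R.rel i (put i a z) c" for z c
      using that R.rel_D[of i "put i a z" c] cyc[of z] by blast
    show "\<exists>c. z \<in> degree_part (E i) a \<and> R.rel i (put i a z) c"
      if "z \<in> degree_part (E i) a" "z \<in> cocycles (\<lambda>q. torsion (E q)) d i" for z
      using that cyc[of z] R.rel_total[of "put i a z" i] by blast
    show "\<exists>z. z \<in> degree_part (E i) a \<and> R.rel i (put i a z) c"
      if "c \<in> face_cochains \<F> i" "face_coboundary \<F> c = (\<lambda>_. 0)" for c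
    proof -
      have "\<exists>w. R.rel i w c" by (rule R.rel_surj[OF that])
      then obtain w where w: "R.rel i w c" by blast
      then have "w \<in> VW i a" using R.rel_D by (auto simp: R.torsion_cocycles_def)
      then show ?thesis using w by (auto simp: VW_def)
    qed
    show "z \<oplus>\<^bsub>E i\<^esub> z' \<in> degree_part (E i) a \<and> R.rel i (put i a (z \<oplus>\<^bsub>E i\<^esub> z')) (\<lambda>F. c F + c' F)"
      if "z \<in> degree_part (E i) a \<and> R.rel i (put i a z) c" "z' \<in> degree_part (E i) a \<and> R.rel i (put i a z') c'" for z c z' c'
      using that R.rel_add by (auto simp: put_simps E.part_add)
    show "single 0 r \<odot>\<^bsub>E i\<^esub> z \<in> degree_part (E i) a \<and>
        R.rel i (put i a (single 0 r \<odot>\<^bsub>E i\<^esub> z)) (\<lambda>F. r * c F)"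
      if "z \<in> degree_part (E i) a \<and> R.rel i (put i a z) c" for z c r
      using that R.rel_scale by (auto simp: put_simps E.part_scalar)
    show "z \<in> coboundaries (\<lambda>q. torsion (E q)) d i \<longleftrightarrow> c \<in> face_coboundary \<F> ` face_cochains \<F> (i - 1)"
      if "z \<in> degree_part (E i) a \<and> R.rel i (put i a z) c" for z c
      using that bd[of z] R.rel_coboundary[of i "put i a z" c] by blast
  qed
qed

end

section \<open>Cosets and isomorphisms from relations\<close>

lemma coset_facts:
  assumes M: "abelian_group M" and N: "subgroup N (add_monoid M)"
    and xy: "x \<in> carrier M" "y \<in> carrier M"
  shows "N +>\<^bsub>M\<^esub> x = N +>\<^bsub>M\<^esub> y \<longleftrightarrow> x \<ominus>\<^bsub>M\<^esub> y \<in> N"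
    and "set_add M (N +>\<^bsub>M\<^esub> x) (N +>\<^bsub>M\<^esub> y) = N +>\<^bsub>M\<^esub> (x \<oplus>\<^bsub>M\<^esub> y)"
    and "x \<in> N +>\<^bsub>M\<^esub> x"
proof -
  interpret M: abelian_group M by fact
  interpret abelian_subgroup N M
    by (rule abelian_subgroupI3) (use M N in \<open>auto intro: additive_subgroup.intro\<close>)
  show "set_add M (N +>\<^bsub>M\<^esub> x) (N +>\<^bsub>M\<^esub> y) = N +>\<^bsub>M\<^esub> (x \<oplus>\<^bsub>M\<^esub> y)"
    by (rule a_rcos_sum[OF xy])
  show x: "x \<in> N +>\<^bsub>M\<^esub> x" by (rule a_rcos_self[OF xy(1)])
  show "N +>\<^bsub>M\<^esub> x = N +>\<^bsub>M\<^esub> y \<longleftrightarrow> x \<ominus>\<^bsub>M\<^esub> y \<in> N"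
    using x a_rcos_module[OF xy(2,1)] M.a_repr_independence[OF _ xy(2) N] by (metis M.minus_eq)
qed

lemma coset_smult:
  assumes M: "abelian_group M" and N: "subgroup N (add_monoid M)" and x: "x \<in> carrier M"
    and s: "\<And>y. y \<in> carrier M \<Longrightarrow> s y \<in> carrier M"
      "\<And>y z. y \<in> carrier M \<Longrightarrow> z \<in> carrier M \<Longrightarrow> s (y \<oplus>\<^bsub>M\<^esub> z) = s y \<oplus>\<^bsub>M\<^esub> s z"
      "\<And>y. y \<in> N \<Longrightarrow> s y \<in> N"
  shows "(\<Union>y\<in>N +>\<^bsub>M\<^esub> x. N +>\<^bsub>M\<^esub> s y) = N +>\<^bsub>M\<^esub> s x"
proof -
  interpret M: abelian_group M by fact
  have NM: "N \<subseteq> carrier M" using subgroup.subset[OF N] by simp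
  have "N +>\<^bsub>M\<^esub> s y = N +>\<^bsub>M\<^esub> s x" if y: "y \<in> N +>\<^bsub>M\<^esub> x" for y
  proof -
    obtain h where h: "h \<in> N" "y = h \<oplus>\<^bsub>M\<^esub> x" using y by (auto simp: a_r_coset_def')
    have hc: "h \<in> carrier M" "s h \<in> carrier M" using h(1) NM s(1) by blast+
    have "s y \<ominus>\<^bsub>M\<^esub> s x = s h"
      using hc x s(1)[OF x] by (simp add: h(2) s(2) M.minus_eq M.a_assoc M.r_neg)
    then show ?thesis using coset_facts(1)[OF M N, of "s y" "s x"] s h hc x by auto
  qed
  moreover have "x \<in> N +>\<^bsub>M\<^esub> x" by (rule coset_facts(3)[OF M N x x])
  ultimately show ?thesis by blast
qed

text \<open>A linear relation that is total and surjective, and that respects equality of classes in both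
  directions, is the graph of an isomorphism between the classes.\<close>

lemma module_iso_from_relation:
  assumes P: "carrier P = p ` Z" and Q: "carrier Q = q ` Z'"
    and dom: "\<And>x c. Rel x c \<Longrightarrow> x \<in> Z \<and> c \<in> Z'"
    and total: "\<And>x. x \<in> Z \<Longrightarrow> \<exists>c. Rel x c" and surj: "\<And>c. c \<in> Z' \<Longrightarrow> \<exists>x. Rel x c"
    and eq: "\<And>x c y c'. Rel x c \<Longrightarrow> Rel y c' \<Longrightarrow> p x = p y \<longleftrightarrow> q c = q c'"
    and add: "\<And>x c y c'. Rel x c \<Longrightarrow> Rel y c' \<Longrightarrow>
        \<exists>w e. Rel w e \<and> p x \<oplus>\<^bsub>P\<^esub> p y = p w \<and> q c \<oplus>\<^bsub>Q\<^esub> q c' = q e"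
    and smult: "\<And>x c r. Rel x c \<Longrightarrow> \<exists>w e. Rel w e \<and> r \<odot>\<^bsub>P\<^esub> p x = p w \<and> r \<odot>\<^bsub>Q\<^esub> q c = q e"
  shows "module_iso R P Q"
proof -
  define f where "f u = (SOME v. \<exists>x c. Rel x c \<and> u = p x \<and> v = q c)" for u
  have f: "f (p x) = q c" if "Rel x c" for x c
  proof -
    have "\<exists>v. \<exists>x' c. Rel x' c \<and> p x = p x' \<and> v = q c" using that by blast
    from someI_ex[OF this] obtain x' c' where "Rel x' c'" "p x = p x'" "f (p x) = q c'"
      unfolding f_def by blast
    then show ?thesis using eq[OF that] by metis
  qed
  have inP: "\<exists>x c. Rel x c \<and> u = p x" if "u \<in> carrier P" for u
    using that total unfolding P by blast
  have "f \<in> module_hom R P Q"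
    unfolding module_hom_def mem_Collect_eq
  proof (intro conjI ballI funcsetI)
    fix u assume "u \<in> carrier P"
    then obtain x c where x: "Rel x c" "u = p x" using inP by blast
    then show "f u \<in> carrier Q" using f dom by (auto simp: Q)
    show "f (r \<odot>\<^bsub>P\<^esub> u) = r \<odot>\<^bsub>Q\<^esub> f u" for r using smult[OF x(1), of r] f x by metis
    fix v assume "v \<in> carrier P"
    then obtain y c' where y: "Rel y c'" "v = p y" using inP by blast
    show "f (u \<oplus>\<^bsub>P\<^esub> v) = f u \<oplus>\<^bsub>Q\<^esub> f v" using add[OF x(1) y(1)] f x y by metis
  qed
  moreover have "inj_on f (carrier P)"
  proof (rule inj_onI)
    fix u v assume "u \<in> carrier P" "v \<in> carrier P" "f u = f v"
    then show "u = v" using inP f eq by metis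
  qed
  moreover have "f ` carrier P = carrier Q"
  proof
    show "f ` carrier P \<subseteq> carrier Q" using inP f dom by (fastforce simp: Q)
    show "carrier Q \<subseteq> f ` carrier P"
    proof
      fix v assume "v \<in> carrier Q"
      then obtain x c where "Rel x c" "v = q c" using surj unfolding Q by blast
      then show "v \<in> f ` carrier P" using f dom by (force simp: P)
    qed
  qed
  ultimately show ?thesis unfolding module_iso_def bij_betw_def by blast
qed

section \<open>Relative simplicial cochains\<close>

lemma chains_simps [simp]:
  "ring.zero (chains \<Delta> j) = (\<lambda>F. 0)" "ring.add (chains \<Delta> j) c c' = (\<lambda>F. c F + c' F)"
  "module.smult (chains \<Delta> j) r c = (\<lambda>F. r * c F)"
  "c \<in> carrier (chains \<Delta> j) \<longleftrightarrow> (\<forall>F. c F \<noteq> 0 \<longrightarrow> F \<in> \<Delta> \<and> int (card F) - 1 = j)"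
  by (auto simp: chains_def)

lemma chains_add_closed:
  "c \<in> carrier (chains \<Delta> j) \<Longrightarrow> c' \<in> carrier (chains \<Delta> j) \<Longrightarrow> (\<lambda>F. c F + c' F) \<in> carrier (chains \<Delta> j)"
  unfolding chains_simps by (metis add_0)

lemma chains_abelian:
  fixes \<Delta> :: "'n::{finite, linorder} set set"
  shows "abelian_group (chains \<Delta> j :: ('k::field, 'n set \<Rightarrow> 'k) module)"
proof (rule abelian_groupI)
  show "\<exists>y\<in>carrier (chains \<Delta> j). y \<oplus>\<^bsub>chains \<Delta> j\<^esub> x = \<zero>\<^bsub>chains \<Delta> j\<^esub>"
    if "x \<in> carrier (chains \<Delta> j)" for x :: "'n set \<Rightarrow> 'k"
    using that by (intro bexI[of _ "\<lambda>F. - x F"]) auto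
  show "x \<oplus>\<^bsub>chains \<Delta> j\<^esub> y \<in> carrier (chains \<Delta> j)"
    if "x \<in> carrier (chains \<Delta> j)" "y \<in> carrier (chains \<Delta> j)" for x y :: "'n set \<Rightarrow> 'k"
    using chains_add_closed[OF that] by simp
qed (auto simp: algebra_simps)

lemma chains_minus:
  assumes "c \<in> carrier (chains \<Delta> j)" "c' \<in> carrier (chains \<Delta> j :: ('k::field, 'n::{finite,linorder} set \<Rightarrow> 'k) module)"
  shows "c \<ominus>\<^bsub>chains \<Delta> j\<^esub> c' = (\<lambda>F. c F - c' F)"
proof -
  interpret abelian_group "chains \<Delta> j :: ('k, 'n set \<Rightarrow> 'k) module" by (rule chains_abelian)
  have "\<ominus>\<^bsub>chains \<Delta> j\<^esub> c' = (\<lambda>F. - c' F)"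
    by (rule minus_equality) (use assms in auto)
  then show ?thesis by (simp add: minus_eq)
qed

definition face_chain :: "'n set \<Rightarrow> 'n set \<Rightarrow> 'k::field" where
  "face_chain F = (\<lambda>F'. if F' = F then 1 else 0)"

locale simplicial_pair =
  fixes \<Delta> \<Gamma> :: "'n::{finite, linorder} set set" and scalars :: "'k::field itself"
  assumes \<Gamma>_\<Delta>: "\<Gamma> \<subseteq> \<Delta>" and down_\<Gamma>: "\<And>F F'. F \<in> \<Gamma> \<Longrightarrow> F' \<subseteq> F \<Longrightarrow> F' \<in> \<Gamma>"
    and down_\<Delta>: "\<And>F F'. F \<in> \<Delta> \<Longrightarrow> F' \<subseteq> F \<Longrightarrow> F' \<in> \<Delta>"
begin

abbreviation C :: "int \<Rightarrow> ('n set \<Rightarrow> 'k) set" where "C j \<equiv> carrier (chains \<Delta> j)"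

abbreviation rel_chains :: "int \<Rightarrow> ('k, ('n set \<Rightarrow> 'k) set) module" where
  "rel_chains j \<equiv> relative_chains \<Delta> \<Gamma> j"

definition rclass :: "int \<Rightarrow> ('n set \<Rightarrow> 'k) \<Rightarrow> ('n set \<Rightarrow> 'k) set" where
  "rclass j c = carrier (chains \<Gamma> j) +>\<^bsub>chains \<Delta> j\<^esub> c"

lemma \<Gamma>_C: "c \<in> carrier (chains \<Gamma> j) \<Longrightarrow> c \<in> C j"
  using \<Gamma>_\<Delta> unfolding chains_simps by blast

lemma subgroup_\<Gamma>: "subgroup (carrier (chains \<Gamma> j :: ('k, 'n set \<Rightarrow> 'k) module)) (add_monoid (chains \<Delta> j))"
proof -
  interpret abelian_group "chains \<Delta> j :: ('k, 'n set \<Rightarrow> 'k) module" by (rule chains_abelian)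
  show ?thesis
  proof (rule add.subgroupI)
    show "carrier (chains \<Gamma> j) \<subseteq> C j" using \<Gamma>_C by blast
    have "(\<lambda>F. 0 :: 'k) \<in> carrier (chains \<Gamma> j)" by simp
    then show "carrier (chains \<Gamma> j) \<noteq> ({} :: ('n set \<Rightarrow> 'k) set)" by blast
    show "\<ominus>\<^bsub>chains \<Delta> j\<^esub> c \<in> carrier (chains \<Gamma> j)" if "c \<in> carrier (chains \<Gamma> j)" for c :: "'n set \<Rightarrow> 'k"
    proof -
      have "\<ominus>\<^bsub>chains \<Delta> j\<^esub> c = (\<lambda>F. - c F)"
        by (rule minus_equality) (use that \<Gamma>_C[OF that] in \<open>simp_all\<close>)
      then show ?thesis using that by simp
    qed
    show "c \<oplus>\<^bsub>chains \<Delta> j\<^esub> c' \<in> carrier (chains \<Gamma> j)"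
      if "c \<in> carrier (chains \<Gamma> j)" "c' \<in> carrier (chains \<Gamma> j)" for c c' :: "'n set \<Rightarrow> 'k"
      using chains_add_closed[OF that] by simp
  qed
qed

lemma rel_chains_carrier: "carrier (rel_chains j) = rclass j ` C j"
  by (auto simp: relative_chains_def quot_module_def A_RCOSETS_def' rclass_def)

lemma rel_chains_add: "c \<in> C j \<Longrightarrow> c' \<in> C j \<Longrightarrow> rclass j c \<oplus>\<^bsub>rel_chains j\<^esub> rclass j c' = rclass j (\<lambda>F. c F + c' F)"
  using coset_facts(2)[OF chains_abelian subgroup_\<Gamma>, of c j c']
  by (simp add: relative_chains_def quot_module_def rclass_def)

lemma rel_chains_smult: "c \<in> C j \<Longrightarrow> r \<odot>\<^bsub>rel_chains j\<^esub> rclass j c = rclass j (\<lambda>F. r * c F)"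
  using coset_smult[OF chains_abelian subgroup_\<Gamma>, of c j "\<lambda>c F. r * c F"]
  by (simp add: relative_chains_def quot_module_def rclass_def algebra_simps)

lemma rclass_eq: "c \<in> C j \<Longrightarrow> c' \<in> C j \<Longrightarrow> rclass j c = rclass j c' \<longleftrightarrow> (\<lambda>F. c F - c' F) \<in> carrier (chains \<Gamma> j)"
  using coset_facts(1)[OF chains_abelian subgroup_\<Gamma>, of c j c'] chains_minus[of c \<Delta> j c'] by (simp add: rclass_def)

lemma rclass_mem: "c' \<in> rclass j c \<Longrightarrow> F \<notin> \<Gamma> \<Longrightarrow> c' F = c F"
  by (auto simp: rclass_def a_r_coset_def')

lemma rclass_self: "c \<in> C j \<Longrightarrow> c \<in> rclass j c"
  using coset_facts(3)[OF chains_abelian subgroup_\<Gamma>, of c j] by (simp add: rclass_def)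

lemma boundary_closed:
  assumes down: "\<And>F F'. F \<in> A \<Longrightarrow> F' \<subseteq> F \<Longrightarrow> F' \<in> A"
    and c: "(c :: 'n set \<Rightarrow> 'k) \<in> carrier (chains A j)"
  shows "boundary c \<in> carrier (chains A (j - 1))"
  unfolding chains_simps
proof (intro allI impI)
  fix F assume "boundary c F \<noteq> 0"
  then obtain v where v: "v \<notin> F" "c (insert v F) \<noteq> 0"
    unfolding boundary_def by (metis (no_types, lifting) ComplD mult_zero_right sum.neutral)
  then have "insert v F \<in> A" "int (card (insert v F)) - 1 = j" using c by auto
  then show "F \<in> A \<and> int (card F) - 1 = j - 1" using down v(1) by auto
qed

lemma boundary_add: "boundary (\<lambda>F. c F + c' F) = (\<lambda>F. boundary c F + boundary c' F :: 'k)"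
  by (rule ext) (simp add: boundary_def distrib_left sum.distrib)

lemma boundary_scale: "boundary (\<lambda>F. r * c F) = (\<lambda>F. r * boundary c F :: 'k)"
  by (rule ext) (simp add: boundary_def sum_distrib_left mult.left_commute)

lemma relative_boundary_rclass:
  assumes c: "c \<in> C j" shows "relative_boundary \<Delta> \<Gamma> j (rclass j c) = rclass (j - 1) (boundary c)"
proof -
  have "rclass (j - 1) (boundary c') = rclass (j - 1) (boundary c)" if c': "c' \<in> rclass j c" for c'
  proof -
    obtain h where h: "h \<in> carrier (chains \<Gamma> j)" "c' = (\<lambda>F. h F + c F)"
      using c' by (auto simp: rclass_def a_r_coset_def')
    have bh: "boundary h \<in> carrier (chains \<Gamma> (j - 1))" by (rule boundary_closed[OF down_\<Gamma> h(1)])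
    have bc: "boundary c \<in> C (j - 1)" by (rule boundary_closed[OF down_\<Delta> c])
    have "boundary h \<in> C (j - 1)" by (rule \<Gamma>_C[OF bh])
    have eq: "boundary c' = (\<lambda>F. boundary h F + boundary c F)" by (simp add: h(2) boundary_add)
    have "boundary c' \<in> C (j - 1)" unfolding eq by (rule chains_add_closed) fact+
    then show ?thesis using rclass_eq[OF _ bc, of "boundary c'"] bh by (simp add: eq del: chains_simps)
  qed
  then show ?thesis using rclass_self[OF c] unfolding relative_boundary_def rclass_def[of "j - 1", symmetric] by blast
qed

abbreviation cochains :: "int \<Rightarrow> ('k, ('n set \<Rightarrow> 'k) set \<Rightarrow> 'k) module" where
  "cochains j \<equiv> dual (rel_chains j)"

lemma cochain_iff:
  "\<phi> \<in> carrier (cochains j) \<longleftrightarrow>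
     (\<forall>c\<in>C j. \<forall>c'\<in>C j. \<phi> (rclass j (\<lambda>F. c F + c' F)) = \<phi> (rclass j c) + \<phi> (rclass j c')) \<and>
     (\<forall>r. \<forall>c\<in>C j. \<phi> (rclass j (\<lambda>F. r * c F)) = r * \<phi> (rclass j c)) \<and>
     \<phi> \<in> extensional (rclass j ` C j)"
proof -
  have "\<phi> \<in> module_hom base_field (rel_chains j) field_module \<longleftrightarrow>
     (\<forall>c\<in>C j. \<forall>c'\<in>C j. \<phi> (rclass j (\<lambda>F. c F + c' F)) = \<phi> (rclass j c) + \<phi> (rclass j c')) \<and>
     (\<forall>r. \<forall>c\<in>C j. \<phi> (rclass j (\<lambda>F. r * c F)) = r * \<phi> (rclass j c))"
    unfolding module_hom_def rel_chains_carrier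
    by (simp add: field_module_def ring_of_type_algebra_def rel_chains_add rel_chains_smult del: chains_simps)
  then show ?thesis by (simp add: dual_def rel_chains_carrier del: chains_simps)
qed

definition pairing :: "('n set \<Rightarrow> 'k) \<Rightarrow> ('n set \<Rightarrow> 'k) \<Rightarrow> 'k" where
  "pairing c x = (\<Sum>F\<in>UNIV. c F * x F)"

text \<open>A relative cochain is determined by its values on the oriented faces of \<open>\<Delta>\<close> outside \<open>\<Gamma>\<close>. With
  \<open>ev_inj\<close> and \<open>ev_surj\<close> this identifies the dual of the relative chains with functions on these
  faces; a face of dimension \<open>j\<close> has \<open>j + 1\<close> elements.\<close>

definition ev :: "int \<Rightarrow> (('n set \<Rightarrow> 'k) set \<Rightarrow> 'k) \<Rightarrow> 'n set \<Rightarrow> 'k" where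
  "ev j \<phi> F = (if F \<in> \<Delta> - \<Gamma> \<and> int (card F) = j + 1 then \<phi> (rclass j (face_chain F)) else 0)"

lemma cochain_pairing:
  assumes \<phi>: "\<phi> \<in> carrier (cochains j)" and x: "x \<in> C j"
  shows "\<phi> (rclass j x) = pairing (ev j \<phi>) x"
proof -
  have add: "\<phi> (rclass j (\<lambda>F. c F + c' F)) = \<phi> (rclass j c) + \<phi> (rclass j c')" if "c \<in> C j" "c' \<in> C j" for c c'
    using \<phi> that unfolding cochain_iff by blast
  have scale: "\<phi> (rclass j (\<lambda>F. r * c F)) = r * \<phi> (rclass j c)" if "c \<in> C j" for r c
    using \<phi> that unfolding cochain_iff by blast
  have 0: "\<phi> (rclass j (\<lambda>F. 0)) = 0" using scale[of "\<lambda>F. 0" 0] by simp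
  have fc: "\<phi> (rclass j (\<lambda>F'. x F * face_chain F F')) = ev j \<phi> F * x F" for F
  proof (cases "F \<in> \<Delta> \<and> int (card F) - 1 = j")
    case True
    then have c: "face_chain F \<in> C j" by (simp add: face_chain_def)
    show ?thesis
    proof (cases "F \<in> \<Gamma>")
      case F: True
      have "rclass j (face_chain F) = rclass j (\<lambda>F. 0)"
        by (subst rclass_eq) (use c F True in \<open>auto simp: face_chain_def\<close>)
      then show ?thesis using scale[OF c, of "x F"] F 0 by (simp add: ev_def)
    next
      case False
      then show ?thesis using scale[OF c, of "x F"] True by (simp add: ev_def)
    qed
  next
    case False
    then have "x F = 0" using x by auto
    then show ?thesis using 0 by simp
  qed
  have "\<phi> (rclass j (\<lambda>F'. \<Sum>F\<in>S. x F * face_chain F F')) = (\<Sum>F\<in>S. ev j \<phi> F * x F)" if "finite S" for S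
    using that
  proof (induction S rule: finite_induct)
    case empty
    then show ?case using 0 by simp
  next
    case (insert F S)
    have in_C: "(\<lambda>F'. x F * face_chain F F') \<in> C j" for F
      using x by (auto simp: face_chain_def)
    have "(\<lambda>F'. \<Sum>F\<in>S. x F * face_chain F F') = (\<lambda>F'. if F' \<in> S then x F' else 0)"
    proof
      fix F' show "(\<Sum>F\<in>S. x F * face_chain F F') = (if F' \<in> S then x F' else 0)"
        using insert(1) by (simp add: face_chain_def if_distrib[of "(*) _"] cong: if_cong)
    qed
    then have "(\<lambda>F'. \<Sum>F\<in>S. x F * face_chain F F') \<in> C j" using x by auto
    from add[OF in_C[of F] this] show ?case using insert fc by simp
  qed
  from this[of UNIV] have "\<phi> (rclass j (\<lambda>F'. \<Sum>F\<in>UNIV. x F * face_chain F F')) = pairing (ev j \<phi>) x"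
    by (simp add: pairing_def)
  moreover have "(\<lambda>F'. \<Sum>F\<in>UNIV. x F * face_chain F F') = x"
    by (rule ext) (simp add: face_chain_def if_distrib[of "(*) _"] cong: if_cong)
  ultimately show ?thesis by simp
qed

lemma ev_face_cochain: "ev j \<phi> \<in> face_cochains (\<Delta> - \<Gamma>) (j + 1)"
  by (auto simp: face_cochains_def ev_def)

lemma ev_inj:
  assumes "\<phi> \<in> carrier (cochains j)" "\<psi> \<in> carrier (cochains j)" "ev j \<phi> = ev j \<psi>"
  shows "\<phi> = \<psi>"
proof (rule extensionalityI)
  show "\<phi> \<in> extensional (rclass j ` C j)" "\<psi> \<in> extensional (rclass j ` C j)" using assms(1,2) cochain_iff by blast+
  fix Q assume "Q \<in> rclass j ` C j"
  then obtain x where "x \<in> C j" "Q = rclass j x" by blast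
  then show "\<phi> Q = \<psi> Q"
    using cochain_pairing[OF assms(1)] cochain_pairing[OF assms(2)] assms(3) by (simp del: chains_simps)
qed

lemma ev_surj:
  assumes c: "c \<in> face_cochains (\<Delta> - \<Gamma>) (j + 1)"
  shows "\<exists>\<phi>\<in>carrier (cochains j). ev j \<phi> = c"
proof -
  define \<phi> where "\<phi> = (\<lambda>Q\<in>rclass j ` C j. pairing c (SOME x. x \<in> Q))"
  have \<phi>: "\<phi> (rclass j x) = pairing c x" if x: "x \<in> C j" for x
  proof -
    have "(SOME y. y \<in> rclass j x) \<in> rclass j x" by (rule someI[of "\<lambda>y. y \<in> rclass j x"]) (rule rclass_self[OF x])
    then have "(SOME y. y \<in> rclass j x) F = x F" if "F \<notin> \<Gamma>" for F using rclass_mem that by blast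
    moreover have "c F = 0" if "F \<in> \<Gamma>" for F using c that by (auto simp: face_cochains_def)
    ultimately have "pairing c (SOME y. y \<in> rclass j x) = pairing c x"
      unfolding pairing_def by (intro sum.cong refl) (metis mult_zero_left)
    then show ?thesis using x by (simp add: \<phi>_def)
  qed
  have "\<phi> \<in> carrier (cochains j)"
    unfolding cochain_iff
  proof (intro conjI ballI allI)
    show "\<phi> (rclass j (\<lambda>F. x F + y F)) = \<phi> (rclass j x) + \<phi> (rclass j y)" if "x \<in> C j" "y \<in> C j" for x y
      using \<phi>[OF chains_add_closed[OF that]] \<phi>[OF that(1)] \<phi>[OF that(2)]
      by (simp add: pairing_def distrib_left sum.distrib)
    show "\<phi> (rclass j (\<lambda>F. r * x F)) = r * \<phi> (rclass j x)" if "x \<in> C j" for r x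
    proof -
      have "(\<lambda>F. r * x F) \<in> C j" using that by auto
      then show ?thesis using \<phi>[OF that] \<phi> by (simp add: pairing_def sum_distrib_left mult.left_commute)
    qed
  qed (simp add: \<phi>_def)
  moreover have "ev j \<phi> = c"
  proof
    fix F
    show "ev j \<phi> F = c F"
    proof (cases "F \<in> \<Delta> - \<Gamma> \<and> int (card F) = j + 1")
      case True
      then have "face_chain F \<in> C j" by (auto simp: face_chain_def)
      then show ?thesis using True \<phi> by (simp add: ev_def pairing_def face_chain_def if_distrib[of "(*) _"] cong: if_cong)
    next
      case False
      then show ?thesis using c by (auto simp: ev_def face_cochains_def)
    qed
  qed
  ultimately show ?thesis by blast
qed

text \<open>The transpose of the boundary, by summing over pairs of a face and a vertex in the other order.\<close>

lemma pairing_boundary_face: "pairing c (boundary (face_chain F)) = (\<Sum>v\<in>F. incidence_sign v F * c (F - {v}))"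
proof -
  have "pairing c (boundary (face_chain F))
     = (\<Sum>F'\<in>UNIV. \<Sum>v\<in>UNIV. if v \<notin> F' \<and> insert v F' = F then incidence_sign v F' * c F' else 0)"
    unfolding pairing_def boundary_def sum_distrib_left
  proof (rule sum.cong[OF refl])
    fix F'
    have "(\<Sum>v\<in>- F'. c F' * ((- 1) ^ card {w \<in> F'. w < v} * face_chain F (insert v F')))
        = (\<Sum>v\<in>- F'. if insert v F' = F then incidence_sign v F' * c F' else 0)"
      by (rule sum.cong) (auto simp: face_chain_def incidence_sign_def)
    also have "\<dots> = (\<Sum>v\<in>UNIV. if v \<notin> F' \<and> insert v F' = F then incidence_sign v F' * c F' else 0)"
      by (rule sum.mono_neutral_cong_left) auto
    finally show "(\<Sum>v\<in>- F'. c F' * ((- 1) ^ card {w \<in> F'. w < v} * face_chain F (insert v F'))) = \<dots>" .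
  qed
  also have "\<dots> = (\<Sum>v\<in>UNIV. \<Sum>F'\<in>UNIV. if v \<notin> F' \<and> insert v F' = F then incidence_sign v F' * c F' else 0)"
    by (rule sum.swap)
  also have "\<dots> = (\<Sum>v\<in>UNIV. if v \<in> F then incidence_sign v F * c (F - {v}) else 0)"
  proof (rule sum.cong[OF refl])
    fix v
    have iff: "(v \<notin> F' \<and> insert v F' = F) \<longleftrightarrow> (F' = F - {v} \<and> v \<in> F)" for F' by auto
    show "(\<Sum>F'\<in>UNIV. if v \<notin> F' \<and> insert v F' = F then incidence_sign v F' * c F' else 0)
        = (if v \<in> F then incidence_sign v F * c (F - {v}) else 0)"
      unfolding iff by (cases "v \<in> F") (simp_all add: incidence_sign_remove_self cong: if_cong)
  qed
  also have "\<dots> = (\<Sum>v\<in>F. incidence_sign v F * c (F - {v}))"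
    by (rule sum.mono_neutral_cong_right) auto
  finally show ?thesis .
qed

lemma coboundary_rclass:
  assumes "x \<in> C (j + 1)"
  shows "relative_coboundary \<Delta> \<Gamma> j \<phi> (rclass (j + 1) x) = \<phi> (rclass j (boundary x))"
  using relative_boundary_rclass[OF assms] assms by (simp add: relative_coboundary_def rel_chains_carrier del: chains_simps)

lemma coboundary_cochain:
  assumes \<phi>: "\<phi> \<in> carrier (cochains j)"
  shows "relative_coboundary \<Delta> \<Gamma> j \<phi> \<in> carrier (cochains (j + 1))"
  unfolding cochain_iff
proof (intro conjI ballI allI)
  have b: "boundary x \<in> C j" if "x \<in> C (j + 1)" for x
    using boundary_closed[OF down_\<Delta> that] by simp
  show "relative_coboundary \<Delta> \<Gamma> j \<phi> (rclass (j + 1) (\<lambda>F. x F + y F))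
      = relative_coboundary \<Delta> \<Gamma> j \<phi> (rclass (j + 1) x) + relative_coboundary \<Delta> \<Gamma> j \<phi> (rclass (j + 1) y)"
    if xy: "x \<in> C (j + 1)" "y \<in> C (j + 1)" for x y
    unfolding coboundary_rclass[OF xy(1)] coboundary_rclass[OF xy(2)] coboundary_rclass[OF chains_add_closed[OF xy]] boundary_add
    using \<phi> b[OF xy(1)] b[OF xy(2)] unfolding cochain_iff by blast
  show "relative_coboundary \<Delta> \<Gamma> j \<phi> (rclass (j + 1) (\<lambda>F. r * x F)) = r * relative_coboundary \<Delta> \<Gamma> j \<phi> (rclass (j + 1) x)"
    if x: "x \<in> C (j + 1)" for r x
  proof -
    have rx: "(\<lambda>F. r * x F) \<in> C (j + 1)" using x by auto
    show ?thesis unfolding coboundary_rclass[OF x] coboundary_rclass[OF rx] boundary_scale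
      using \<phi> b[OF x] unfolding cochain_iff by blast
  qed
qed (simp add: relative_coboundary_def rel_chains_carrier)

lemma ev_coboundary:
  assumes \<phi>: "\<phi> \<in> carrier (cochains j)"
  shows "ev (j + 1) (relative_coboundary \<Delta> \<Gamma> j \<phi>) = face_coboundary (\<Delta> - \<Gamma>) (ev j \<phi>)"
proof
  fix F
  show "ev (j + 1) (relative_coboundary \<Delta> \<Gamma> j \<phi>) F = face_coboundary (\<Delta> - \<Gamma>) (ev j \<phi>) F"
  proof (cases "F \<in> \<Delta> - \<Gamma> \<and> int (card F) = j + 1 + 1")
    case True
    then have F: "face_chain F \<in> C (j + 1)" by (auto simp: face_chain_def)
    have "boundary (face_chain F) \<in> C j" using boundary_closed[OF down_\<Delta> F] by simp
    then show ?thesis using True cochain_pairing[OF \<phi>] pairing_boundary_face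
      by (simp add: ev_def[of "j + 1"] coboundary_rclass[OF F] face_coboundary_def del: chains_simps)
  next
    case False
    have "ev j \<phi> (F - {v}) = 0" if "F \<in> \<Delta> - \<Gamma>" "v \<in> F" for v
    proof -
      have "card F = Suc (card (F - {v}))" by (metis card_Suc_Diff1 finite that(2))
      then show ?thesis using False that(1) by (auto simp: ev_def)
    qed
    then show ?thesis using False by (auto simp: ev_def[of "j + 1"] face_coboundary_def)
  qed
qed

lemma ev_add: "ev j (\<phi> \<oplus>\<^bsub>cochains j\<^esub> \<psi>) = (\<lambda>F. ev j \<phi> F + ev j \<psi> F)"
proof
  fix F
  have "face_chain F \<in> C j" if "F \<in> \<Delta> - \<Gamma> \<and> int (card F) = j + 1" using that by (auto simp: face_chain_def)
  then show "ev j (\<phi> \<oplus>\<^bsub>cochains j\<^esub> \<psi>) F = ev j \<phi> F + ev j \<psi> F"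
    by (simp add: ev_def dual_def rel_chains_carrier del: chains_simps)
qed

lemma ev_smult: "ev j (r \<odot>\<^bsub>cochains j\<^esub> \<phi>) = (\<lambda>F. r * ev j \<phi> F)"
proof
  fix F
  have "face_chain F \<in> C j" if "F \<in> \<Delta> - \<Gamma> \<and> int (card F) = j + 1" using that by (auto simp: face_chain_def)
  then show "ev j (r \<odot>\<^bsub>cochains j\<^esub> \<phi>) F = r * ev j \<phi> F"
    by (simp add: ev_def dual_def rel_chains_carrier del: chains_simps)
qed

lemma ev_zero: "ev j \<zero>\<^bsub>cochains j\<^esub> = (\<lambda>F. 0)"
proof
  fix F
  have "face_chain F \<in> C j" if "F \<in> \<Delta> - \<Gamma> \<and> int (card F) = j + 1" using that by (auto simp: face_chain_def)
  then show "ev j \<zero>\<^bsub>cochains j\<^esub> F = 0"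
    by (simp add: ev_def dual_def rel_chains_carrier del: chains_simps)
qed

lemma cochains_closed:
  "\<phi> \<in> carrier (cochains j) \<Longrightarrow> \<psi> \<in> carrier (cochains j) \<Longrightarrow> \<phi> \<oplus>\<^bsub>cochains j\<^esub> \<psi> \<in> carrier (cochains j)"
  "\<phi> \<in> carrier (cochains j) \<Longrightarrow> r \<odot>\<^bsub>cochains j\<^esub> \<phi> \<in> carrier (cochains j)"
  "\<zero>\<^bsub>cochains j\<^esub> \<in> carrier (cochains j)"
proof -
  have in_C: "(\<lambda>F. c F + c' F) \<in> C j" if "c \<in> C j" "c' \<in> C j" for c c' by (rule chains_add_closed[OF that])
  have in_C': "(\<lambda>F. r * c F) \<in> C j" if "c \<in> C j" for c r using that by auto
  show "\<phi> \<oplus>\<^bsub>cochains j\<^esub> \<psi> \<in> carrier (cochains j)" if "\<phi> \<in> carrier (cochains j)" "\<psi> \<in> carrier (cochains j)"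
    using that unfolding cochain_iff
    by (simp add: dual_def rel_chains_carrier in_C in_C' distrib_left del: chains_simps)
  show "r \<odot>\<^bsub>cochains j\<^esub> \<phi> \<in> carrier (cochains j)" if "\<phi> \<in> carrier (cochains j)"
    using that unfolding cochain_iff
    by (simp add: dual_def rel_chains_carrier in_C in_C' distrib_left mult.left_commute del: chains_simps)
  show "\<zero>\<^bsub>cochains j\<^esub> \<in> carrier (cochains j)"
    unfolding cochain_iff by (simp add: dual_def rel_chains_carrier in_C in_C' del: chains_simps)
qed

lemma cochains_abelian: "abelian_group (cochains j)"
proof (rule abelian_groupI)
  show "\<exists>\<psi>\<in>carrier (cochains j). \<psi> \<oplus>\<^bsub>cochains j\<^esub> \<phi> = \<zero>\<^bsub>cochains j\<^esub>" if "\<phi> \<in> carrier (cochains j)" for \<phi>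
  proof (rule bexI)
    show n: "(- 1) \<odot>\<^bsub>cochains j\<^esub> \<phi> \<in> carrier (cochains j)" by (rule cochains_closed(2)[OF that])
    show "(- 1) \<odot>\<^bsub>cochains j\<^esub> \<phi> \<oplus>\<^bsub>cochains j\<^esub> \<phi> = \<zero>\<^bsub>cochains j\<^esub>"
    proof (rule ev_inj[of _ j])
      show "(- 1) \<odot>\<^bsub>cochains j\<^esub> \<phi> \<oplus>\<^bsub>cochains j\<^esub> \<phi> \<in> carrier (cochains j)"
        by (rule cochains_closed(1)[OF n that])
      show "ev j ((- 1) \<odot>\<^bsub>cochains j\<^esub> \<phi> \<oplus>\<^bsub>cochains j\<^esub> \<phi>) = ev j \<zero>\<^bsub>cochains j\<^esub>"
        unfolding ev_add ev_smult ev_zero by simp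
    qed (rule cochains_closed(3))
  qed
  show "\<phi> \<oplus>\<^bsub>cochains j\<^esub> \<psi> \<oplus>\<^bsub>cochains j\<^esub> \<chi> = \<phi> \<oplus>\<^bsub>cochains j\<^esub> (\<psi> \<oplus>\<^bsub>cochains j\<^esub> \<chi>)"
    if "\<phi> \<in> carrier (cochains j)" "\<psi> \<in> carrier (cochains j)" "\<chi> \<in> carrier (cochains j)" for \<phi> \<psi> \<chi>
    by (rule ev_inj[of _ j]) (use cochains_closed that in \<open>auto simp: ev_add add.assoc\<close>)
  show "\<phi> \<oplus>\<^bsub>cochains j\<^esub> \<psi> = \<psi> \<oplus>\<^bsub>cochains j\<^esub> \<phi>" if "\<phi> \<in> carrier (cochains j)" "\<psi> \<in> carrier (cochains j)" for \<phi> \<psi>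
    by (rule ev_inj[of _ j]) (use cochains_closed that in \<open>auto simp: ev_add add.commute\<close>)
  show "\<zero>\<^bsub>cochains j\<^esub> \<oplus>\<^bsub>cochains j\<^esub> \<phi> = \<phi>" if "\<phi> \<in> carrier (cochains j)" for \<phi>
    by (rule ev_inj[of _ j]) (use cochains_closed that in \<open>auto simp: ev_add ev_zero\<close>)
qed (use cochains_closed in auto)

lemma cocycle_iff:
  "\<phi> \<in> cocycles cochains (relative_coboundary \<Delta> \<Gamma>) j \<longleftrightarrow>
     \<phi> \<in> carrier (cochains j) \<and> face_coboundary (\<Delta> - \<Gamma>) (ev j \<phi>) = (\<lambda>F. 0)"
  unfolding cocycles_def mem_Collect_eq
  using ev_inj[OF coboundary_cochain cochains_closed(3)] ev_coboundary ev_zero by metis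

lemma coboundary_iff:
  assumes \<phi>: "\<phi> \<in> carrier (cochains j)"
  shows "\<phi> \<in> coboundaries cochains (relative_coboundary \<Delta> \<Gamma>) j \<longleftrightarrow>
     ev j \<phi> \<in> face_coboundary (\<Delta> - \<Gamma>) ` face_cochains (\<Delta> - \<Gamma>) j"
proof
  assume "\<phi> \<in> coboundaries cochains (relative_coboundary \<Delta> \<Gamma>) j"
  then obtain \<psi> where "\<psi> \<in> carrier (cochains (j - 1))" "\<phi> = relative_coboundary \<Delta> \<Gamma> (j - 1) \<psi>"
    by (auto simp: coboundaries_def)
  then show "ev j \<phi> \<in> face_coboundary (\<Delta> - \<Gamma>) ` face_cochains (\<Delta> - \<Gamma>) j"
    using ev_coboundary[of \<psi> "j - 1"] ev_face_cochain[of "j - 1" \<psi>] by simp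
next
  assume "ev j \<phi> \<in> face_coboundary (\<Delta> - \<Gamma>) ` face_cochains (\<Delta> - \<Gamma>) j"
  then obtain b where b: "b \<in> face_cochains (\<Delta> - \<Gamma>) (j - 1 + 1)" "ev j \<phi> = face_coboundary (\<Delta> - \<Gamma>) b" by auto
  obtain \<psi> where \<psi>: "\<psi> \<in> carrier (cochains (j - 1))" "ev (j - 1) \<psi> = b" using ev_surj[OF b(1)] by blast
  have "relative_coboundary \<Delta> \<Gamma> (j - 1) \<psi> = \<phi>"
    by (rule ev_inj[of _ j]) (use coboundary_cochain[OF \<psi>(1)] ev_coboundary[OF \<psi>(1)] \<phi> b(2) \<psi>(2) in simp_all)
  then show "\<phi> \<in> coboundaries cochains (relative_coboundary \<Delta> \<Gamma>) j" using \<psi>(1) by (auto simp: coboundaries_def)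
qed

end

section \<open>Twisting by the negative support\<close>

text \<open>The faces \<open>F\<close> of the Koszul complex are the sets \<open>G \<union> H\<close> with \<open>H\<close> a relative face, where \<open>G\<close> is the
  negative support. The sign of \<open>v\<close> in \<open>G \<union> H\<close> is its sign in \<open>H\<close> times $-1$ to the power of the number of
  elements of \<open>G\<close> below \<open>v\<close>; \<open>twist_sign\<close> is the product of these corrections over \<open>H\<close>, which turns one
  differential into the other.\<close>

definition twist_sign :: "'n::linorder set \<Rightarrow> 'n set \<Rightarrow> 'k::comm_ring_1" where
  "twist_sign G H = (\<Prod>v\<in>H. incidence_sign v G)"

definition twist :: "'n::linorder set \<Rightarrow> ('n set \<Rightarrow> 'k::comm_ring_1) \<Rightarrow> 'n set \<Rightarrow> 'k" where
  "twist G c F = (if G \<subseteq> F then twist_sign G (F - G) * c (F - G) else 0)"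

lemma twist_sign_square: "twist_sign G H * twist_sign G H = 1"
  by (simp add: twist_sign_def flip: prod.distrib)

lemma incidence_sign_union:
  fixes G H :: "'n::{finite,linorder} set"
  assumes "G \<inter> H = {}"
  shows "(incidence_sign v (G \<union> H) :: 'k::comm_ring_1) = incidence_sign v G * incidence_sign v H"
proof -
  have "{l \<in> G \<union> H. l < v} = {l \<in> G. l < v} \<union> {l \<in> H. l < v}" by auto
  then have "card {l \<in> G \<union> H. l < v} = card {l \<in> G. l < v} + card {l \<in> H. l < v}"
    using assms by (subst card_Un_disjoint[symmetric]) auto
  then show ?thesis by (simp add: incidence_sign_def power_add)
qed

definition cone_faces :: "'n set \<Rightarrow> 'n set set \<Rightarrow> 'n set set" where
  "cone_faces G L = {F. G \<subseteq> F \<and> F - G \<in> L}"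

context
  fixes G :: "'n::{finite, linorder} set" and L :: "'n set set"
  assumes disjoint: "\<forall>F\<in>L. F \<inter> G = {}"
begin

lemma twist_cochain:
  assumes c: "(c :: 'n set \<Rightarrow> 'k::field) \<in> face_cochains L m"
  shows "twist G c \<in> face_cochains (cone_faces G L) (m + int (card G))"
proof -
  have "F \<in> cone_faces G L \<and> int (card F) = m + int (card G)" if "twist G c F \<noteq> 0" for F
  proof -
    have F: "G \<subseteq> F" "c (F - G) \<noteq> 0" using that by (auto simp: twist_def split: if_splits)
    then have "F - G \<in> L" "int (card (F - G)) = m" using c by (auto simp: face_cochains_def)
    moreover have "card F = card (F - G) + card G" using F(1) by (simp add: card_Diff_subset card_mono)
    ultimately show ?thesis using F by (simp add: cone_faces_def)
  qed
  then show ?thesis by (simp add: face_cochains_def)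
qed

lemma twist_inj:
  assumes c: "(c :: 'n set \<Rightarrow> 'k::field) \<in> face_cochains L m" "c' \<in> face_cochains L m"
    and eq: "twist G c = twist G c'"
  shows "c = c'"
proof
  fix H
  show "c H = c' H"
  proof (cases "H \<in> L")
    case True
    then have "H \<union> G - G = H" using disjoint by blast
    moreover have "twist G c (H \<union> G) = twist G c' (H \<union> G)" by (simp add: eq)
    ultimately have "twist_sign G H * c H = twist_sign G H * c' H" by (simp add: twist_def)
    moreover have "twist_sign G H \<noteq> (0 :: 'k)" using twist_sign_square[of G H] by (metis mult_zero_left zero_neq_one)
    ultimately show ?thesis by simp
  next
    case False
    then have "c H = 0" "c' H = 0" using c unfolding face_cochains_def by blast+
    then show ?thesis by simp
  qed
qed

lemma twist_surj:
  assumes c: "(c :: 'n set \<Rightarrow> 'k::field) \<in> face_cochains (cone_faces G L) (m + int (card G))"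
  shows "\<exists>b\<in>face_cochains L m. twist G b = c"
proof -
  define b where "b H = (if H \<inter> G = {} then twist_sign G H * c (H \<union> G) else 0)" for H
  have "b \<in> face_cochains L m"
    unfolding face_cochains_def mem_Collect_eq
  proof (intro allI impI)
    fix H assume "b H \<noteq> 0"
    then have H: "H \<inter> G = {}" "c (H \<union> G) \<noteq> 0" by (auto simp: b_def split: if_splits)
    then have "H \<union> G \<in> cone_faces G L" "int (card (H \<union> G)) = m + int (card G)" using c by (auto simp: face_cochains_def)
    moreover have "H \<union> G - G = H" using H(1) by blast
    ultimately show "H \<in> L \<and> int (card H) = m" using H(1) by (simp add: cone_faces_def card_Un_disjoint)
  qed
  moreover have "twist G b F = c F" for F
  proof (cases "G \<subseteq> F")
    case True
    then have "F - G \<union> G = F" "(F - G) \<inter> G = {}" by auto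
    then show ?thesis using True by (simp add: twist_def b_def twist_sign_square flip: mult.assoc)
  next
    case False
    then have "F \<notin> cone_faces G L" by (simp add: cone_faces_def)
    then show ?thesis using False c by (auto simp: twist_def face_cochains_def)
  qed
  ultimately show ?thesis by blast
qed

text \<open>Removing an element of \<open>G\<close> leaves a set that does not contain \<open>G\<close>, so only the elements of \<open>H\<close>
  contribute, and for them the extra sign is absorbed by \<open>twist_sign\<close>.\<close>

lemma twist_coboundary:
  "twist G (face_coboundary L c) = face_coboundary (cone_faces G L) (twist G (c :: 'n set \<Rightarrow> 'k::field))"
proof
  fix F
  show "twist G (face_coboundary L c) F = face_coboundary (cone_faces G L) (twist G c) F"
  proof (cases "F \<in> cone_faces G L")
    case False
    then show ?thesis by (auto simp: twist_def face_coboundary_def cone_faces_def)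
  next
    case True
    define H where "H = F - G"
    have H: "G \<subseteq> F" "H \<in> L" "F = G \<union> H" "G \<inter> H = {}" using True by (auto simp: cone_faces_def H_def)
    have summand: "incidence_sign v F * twist G c (F - {v}) = twist_sign G H * (incidence_sign v H * c (H - {v}))"
      if v: "v \<in> H" for v
    proof -
      have "F - {v} - G = H - {v}" "G \<subseteq> F - {v}" using v H by auto
      then have "twist G c (F - {v}) = twist_sign G (H - {v}) * c (H - {v})" by (simp add: twist_def)
      moreover have "(twist_sign G H :: 'k) = incidence_sign v G * twist_sign G (H - {v})"
        unfolding twist_sign_def using v by (simp add: prod.remove)
      moreover have "(incidence_sign v F :: 'k) = incidence_sign v G * incidence_sign v H"
        unfolding H(3) by (rule incidence_sign_union[OF H(4)])
      ultimately show ?thesis by (simp add: mult.assoc mult.left_commute)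
    qed
    have zero: "twist G c (F - {v}) = 0" if "v \<in> G" for v using that by (auto simp: twist_def)
    have "face_coboundary (cone_faces G L) (twist G c) F = (\<Sum>v\<in>F. incidence_sign v F * twist G c (F - {v}))"
      using True by (simp add: face_coboundary_def)
    also have "\<dots> = (\<Sum>v\<in>H. incidence_sign v F * twist G c (F - {v}))"
      by (rule sum.mono_neutral_right) (use H zero in auto)
    also have "\<dots> = twist_sign G H * (\<Sum>v\<in>H. incidence_sign v H * c (H - {v}))"
      unfolding sum_distrib_left by (rule sum.cong) (simp_all add: summand)
    also have "\<dots> = twist G (face_coboundary L c) F"
      using H(1,2) by (simp add: twist_def face_coboundary_def flip: H_def)
    finally show ?thesis by simp
  qed
qed

end

lemma twist_add: "twist G (\<lambda>F. c F + c' F) = (\<lambda>F. twist G c F + twist G c' F)"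
  by (rule ext) (simp add: twist_def distrib_left)

lemma twist_scale: "twist G (\<lambda>F. r * c F) = (\<lambda>F. r * twist G c F)"
  by (rule ext) (simp add: twist_def mult.left_commute)

lemma face_coboundary_cochain:
  fixes L :: "'n::{finite, linorder} set set"
  assumes c: "(c :: 'n set \<Rightarrow> 'k::field) \<in> face_cochains L m"
  shows "face_coboundary L c \<in> face_cochains L (m + 1)"
  unfolding face_cochains_def mem_Collect_eq
proof (intro allI impI)
  fix F assume F: "face_coboundary L c F \<noteq> 0"
  then have "F \<in> L" by (auto simp: face_coboundary_def split: if_splits)
  moreover obtain v where v: "v \<in> F" "c (F - {v}) \<noteq> 0"
  proof -
    have "face_coboundary L c F = 0" if "\<forall>v\<in>F. c (F - {v}) = 0"
      using that by (simp add: face_coboundary_def)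
    then show thesis using that F by blast
  qed
  moreover have "card F = Suc (card (F - {v}))" by (metis card_Suc_Diff1 finite v(1))
  ultimately show "F \<in> L \<and> int (card F) = m + 1" using c by (auto simp: face_cochains_def)
qed

context simplicial_pair begin

abbreviation "rel_coboundaries j \<equiv> coboundaries cochains (relative_coboundary \<Delta> \<Gamma>) j"

lemma coboundaries_cochains: "rel_coboundaries j \<subseteq> carrier (cochains j)"
  using coboundary_cochain[of _ "j - 1"] by (auto simp: coboundaries_def)

lemma coboundaries_closed:
  "\<phi> \<in> rel_coboundaries j \<Longrightarrow> r \<odot>\<^bsub>cochains j\<^esub> \<phi> \<in> rel_coboundaries j"
  "\<phi> \<in> rel_coboundaries j \<Longrightarrow> \<psi> \<in> rel_coboundaries j \<Longrightarrow> \<phi> \<oplus>\<^bsub>cochains j\<^esub> \<psi> \<in> rel_coboundaries j"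
proof -
  show "r \<odot>\<^bsub>cochains j\<^esub> \<phi> \<in> rel_coboundaries j" if \<phi>: "\<phi> \<in> rel_coboundaries j"
  proof -
    have c: "\<phi> \<in> carrier (cochains j)" using \<phi> coboundaries_cochains by blast
    then obtain b where "b \<in> face_cochains (\<Delta> - \<Gamma>) j" "ev j \<phi> = face_coboundary (\<Delta> - \<Gamma>) b"
      using \<phi> coboundary_iff by auto
    then have "(\<lambda>F. r * ev j \<phi> F) = face_coboundary (\<Delta> - \<Gamma>) (\<lambda>F. r * b F)"
      "(\<lambda>F. r * b F) \<in> face_cochains (\<Delta> - \<Gamma>) j"
      by (simp_all add: face_coboundary_scale face_cochains_closed)
    then show ?thesis unfolding coboundary_iff[OF cochains_closed(2)[OF c]] ev_smult by blast
  qed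
  show "\<phi> \<oplus>\<^bsub>cochains j\<^esub> \<psi> \<in> rel_coboundaries j" if \<phi>: "\<phi> \<in> rel_coboundaries j" "\<psi> \<in> rel_coboundaries j"
  proof -
    have c: "\<phi> \<in> carrier (cochains j)" "\<psi> \<in> carrier (cochains j)" using \<phi> coboundaries_cochains by blast+
    then obtain b b' where b: "b \<in> face_cochains (\<Delta> - \<Gamma>) j" "ev j \<phi> = face_coboundary (\<Delta> - \<Gamma>) b"
      "b' \<in> face_cochains (\<Delta> - \<Gamma>) j" "ev j \<psi> = face_coboundary (\<Delta> - \<Gamma>) b'"
      using \<phi> coboundary_iff by auto
    then have "(\<lambda>F. ev j \<phi> F + ev j \<psi> F) = face_coboundary (\<Delta> - \<Gamma>) (\<lambda>F. b F + b' F)"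
      by (simp add: face_coboundary_add)
    then show ?thesis unfolding coboundary_iff[OF cochains_closed(1)[OF c]] ev_add
      using face_cochains_closed(1)[OF b(1,3)] by blast
  qed
qed

lemma cochain_minus:
  assumes "\<phi> \<in> carrier (cochains j)" "\<psi> \<in> carrier (cochains j)"
  shows "\<phi> \<ominus>\<^bsub>cochains j\<^esub> \<psi> = \<phi> \<oplus>\<^bsub>cochains j\<^esub> ((- 1) \<odot>\<^bsub>cochains j\<^esub> \<psi>)"
proof -
  interpret A: abelian_group "cochains j" by (rule cochains_abelian)
  have "\<ominus>\<^bsub>cochains j\<^esub> \<psi> = (- 1) \<odot>\<^bsub>cochains j\<^esub> \<psi>"
  proof (rule A.minus_equality)
    show "(- 1) \<odot>\<^bsub>cochains j\<^esub> \<psi> \<oplus>\<^bsub>cochains j\<^esub> \<psi> = \<zero>\<^bsub>cochains j\<^esub>"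
      by (rule ev_inj[of _ j]) (use cochains_closed assms in \<open>auto simp: ev_add ev_smult ev_zero\<close>)
  qed (use assms cochains_closed in auto)
  then show ?thesis by (simp add: A.minus_eq)
qed

lemma coboundaries_subgroup: "subgroup (rel_coboundaries j) (add_monoid (cochains j))"
proof -
  interpret A: abelian_group "cochains j" by (rule cochains_abelian)
  have zero: "\<zero>\<^bsub>cochains j\<^esub> \<in> rel_coboundaries j"
    unfolding coboundary_iff[OF cochains_closed(3)] ev_zero
    by (rule image_eqI[OF _ face_cochains_closed(3)]) (simp add: face_coboundary_def fun_eq_iff)
  show ?thesis
  proof (rule A.add.subgroupI)
    show "rel_coboundaries j \<subseteq> carrier (cochains j)" by (rule coboundaries_cochains)
    show "rel_coboundaries j \<noteq> {}" using zero by blast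
    show "\<ominus>\<^bsub>cochains j\<^esub> \<phi> \<in> rel_coboundaries j" if \<phi>: "\<phi> \<in> rel_coboundaries j" for \<phi>
    proof -
      have "\<phi> \<in> carrier (cochains j)" using \<phi> coboundaries_cochains by blast
      from cochain_minus[OF cochains_closed(3) this] show ?thesis
        using A.l_zero[OF A.a_inv_closed[OF \<open>\<phi> \<in> carrier (cochains j)\<close>]]
          A.l_zero[OF cochains_closed(2)[OF \<open>\<phi> \<in> carrier (cochains j)\<close>, of "- 1"]] coboundaries_closed(1)[OF \<phi>, of "- 1"]
        by (simp add: A.minus_eq)
    qed
  qed (rule coboundaries_closed(2))
qed

definition coh_class :: "int \<Rightarrow> (('n set \<Rightarrow> 'k) set \<Rightarrow> 'k) \<Rightarrow> (('n set \<Rightarrow> 'k) set \<Rightarrow> 'k) set" where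
  "coh_class j \<phi> = rel_coboundaries j +>\<^bsub>cochains j\<^esub> \<phi>"

lemma relative_cohomology_facts:
  "carrier (relative_cohomology \<Delta> \<Gamma> j) = coh_class j ` cocycles cochains (relative_coboundary \<Delta> \<Gamma>) j"
  "\<phi> \<in> carrier (cochains j) \<Longrightarrow> \<psi> \<in> carrier (cochains j) \<Longrightarrow>
     coh_class j \<phi> \<oplus>\<^bsub>relative_cohomology \<Delta> \<Gamma> j\<^esub> coh_class j \<psi> = coh_class j (\<phi> \<oplus>\<^bsub>cochains j\<^esub> \<psi>)"
  "\<phi> \<in> carrier (cochains j) \<Longrightarrow>
     r \<odot>\<^bsub>relative_cohomology \<Delta> \<Gamma> j\<^esub> coh_class j \<phi> = coh_class j (r \<odot>\<^bsub>cochains j\<^esub> \<phi>)"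
  "\<phi> \<in> carrier (cochains j) \<Longrightarrow> \<psi> \<in> carrier (cochains j) \<Longrightarrow>
     coh_class j \<phi> = coh_class j \<psi> \<longleftrightarrow> \<phi> \<oplus>\<^bsub>cochains j\<^esub> ((- 1) \<odot>\<^bsub>cochains j\<^esub> \<psi>) \<in> rel_coboundaries j"
proof -
  have coset: "H +>\<^bsub>(cochains j)\<lparr>carrier := S\<rparr>\<^esub> \<phi> = H +>\<^bsub>cochains j\<^esub> \<phi>" for H S \<phi>
    by (simp add: a_r_coset_def')
  have "cocycles cochains (relative_coboundary \<Delta> \<Gamma>) j \<subseteq> carrier (cochains j)" by (auto simp: cocycles_def)
  then show "carrier (relative_cohomology \<Delta> \<Gamma> j) = coh_class j ` cocycles cochains (relative_coboundary \<Delta> \<Gamma>) j"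
    by (auto simp: relative_cohomology_def cohomology_def quot_module_def A_RCOSETS_def' coset coh_class_def)
  show "coh_class j \<phi> \<oplus>\<^bsub>relative_cohomology \<Delta> \<Gamma> j\<^esub> coh_class j \<psi> = coh_class j (\<phi> \<oplus>\<^bsub>cochains j\<^esub> \<psi>)"
    if "\<phi> \<in> carrier (cochains j)" "\<psi> \<in> carrier (cochains j)"
    using coset_facts(2)[OF cochains_abelian coboundaries_subgroup that]
    by (simp add: relative_cohomology_def cohomology_def quot_module_def coh_class_def set_add_def')
  show "r \<odot>\<^bsub>relative_cohomology \<Delta> \<Gamma> j\<^esub> coh_class j \<phi> = coh_class j (r \<odot>\<^bsub>cochains j\<^esub> \<phi>)"
    if \<phi>: "\<phi> \<in> carrier (cochains j)"
  proof -
    have "(\<Union>\<psi>\<in>rel_coboundaries j +>\<^bsub>cochains j\<^esub> \<phi>. rel_coboundaries j +>\<^bsub>cochains j\<^esub> (r \<odot>\<^bsub>cochains j\<^esub> \<psi>))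
        = rel_coboundaries j +>\<^bsub>cochains j\<^esub> (r \<odot>\<^bsub>cochains j\<^esub> \<phi>)"
    proof (rule coset_smult[OF cochains_abelian coboundaries_subgroup \<phi>])
      fix \<phi> \<psi> assume \<phi>: "\<phi> \<in> carrier (cochains j)" "\<psi> \<in> carrier (cochains j)"
      show "r \<odot>\<^bsub>cochains j\<^esub> (\<phi> \<oplus>\<^bsub>cochains j\<^esub> \<psi>) = r \<odot>\<^bsub>cochains j\<^esub> \<phi> \<oplus>\<^bsub>cochains j\<^esub> r \<odot>\<^bsub>cochains j\<^esub> \<psi>"
        by (rule ev_inj[of _ j]) (use \<phi> cochains_closed in \<open>auto simp: ev_add ev_smult distrib_left\<close>)
    qed (use cochains_closed coboundaries_closed in auto)
    then show ?thesis
      by (simp add: relative_cohomology_def cohomology_def quot_module_def coh_class_def coset)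
  qed
  show "coh_class j \<phi> = coh_class j \<psi> \<longleftrightarrow> \<phi> \<oplus>\<^bsub>cochains j\<^esub> ((- 1) \<odot>\<^bsub>cochains j\<^esub> \<psi>) \<in> rel_coboundaries j"
    if "\<phi> \<in> carrier (cochains j)" "\<psi> \<in> carrier (cochains j)"
    using coset_facts(1)[OF cochains_abelian coboundaries_subgroup that] cochain_minus[OF that] by (simp add: coh_class_def)
qed

end

section \<open>Torsion cohomology and the comparison\<close>

context graded_module begin

lemma x_pow_mono:
  assumes "x_pow s j \<odot> x = \<zero>" "s \<le> t" "x \<in> carrier M" shows "x_pow t j \<odot> x = \<zero>"
proof -
  have "(x_pow t j :: ('n, 'k) mpoly) = x_pow (t - s) j * x_pow s j" using assms(2) by (simp add: mult_single flip: single_add)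
  then have "x_pow t j \<odot> x = x_pow (t - s) j \<odot> (x_pow s j \<odot> x)"
    using smult_poly_mult[OF assms(3), of "x_pow (t - s) j" "x_pow s j"] by (simp only:)
  then show ?thesis using assms(1) M.smult_r_null[of "x_pow (t - s) j"] by simp
qed

lemma torsion_closed:
  "x \<in> carrier (torsion M) \<Longrightarrow> y \<in> carrier (torsion M) \<Longrightarrow> x \<oplus> y \<in> carrier (torsion M)"
  "x \<in> carrier (torsion M) \<Longrightarrow> r \<odot> x \<in> carrier (torsion M)" "\<zero> \<in> carrier (torsion M)"
proof -
  show "x \<oplus> y \<in> carrier (torsion M)" if "x \<in> carrier (torsion M)" "y \<in> carrier (torsion M)"
  proof -
    obtain s t where x: "x \<in> carrier M" "\<And>j. x_pow s j \<odot> x = \<zero>" and y: "y \<in> carrier M" "\<And>j. x_pow t j \<odot> y = \<zero>"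
      using \<open>x \<in> carrier (torsion M)\<close> \<open>y \<in> carrier (torsion M)\<close> torsion_carrier by blast
    have "x_pow (max s t) j \<odot> (x \<oplus> y) = \<zero>" for j
      using x y x_pow_mono[OF x(2), of "max s t" j] x_pow_mono[OF y(2), of "max s t" j] by (simp add: M.smult_r_distr)
    then show ?thesis using torsion_carrier x y by auto
  qed
  show "r \<odot> x \<in> carrier (torsion M)" if x: "x \<in> carrier (torsion M)"
  proof -
    obtain s where x: "x \<in> carrier M" "\<And>j. x_pow s j \<odot> x = \<zero>" using x torsion_carrier by blast
    have "x_pow s j \<odot> (r \<odot> x) = r \<odot> (x_pow s j \<odot> x)" for j
      using x(1) by (simp add: mult.commute flip: smult_poly_mult)
    then have "x_pow s j \<odot> (r \<odot> x) = \<zero>" for j using x(2) M.smult_r_null[of r] by simp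
    then show ?thesis using torsion_carrier x(1) by auto
  qed
  show "\<zero> \<in> carrier (torsion M)" using torsion_carrier M.smult_r_null by simp
qed

lemma minus_smult: "x \<in> carrier M \<Longrightarrow> \<ominus> x = single 0 (- 1) \<odot> x"
proof -
  assume x: "x \<in> carrier M"
  have "single 0 (- 1) \<odot> x \<oplus> x = (single 0 (- 1) + 1) \<odot> x"
    using x by (simp add: smult_poly_add smult_poly_one)
  also have "single 0 (- 1) + 1 = (0 :: ('n, 'k) mpoly)"
    by (simp add: single_uminus)
  finally have "single 0 (- 1) \<odot> x \<oplus> x = \<zero>" using smult_poly_zero[OF x] by simp
  then show ?thesis using x by (intro M.minus_equality) simp_all
qed

end

context graded_complex begin

abbreviation "tors_cocycles i \<equiv> cocycles (\<lambda>q. torsion (E q)) d i"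
abbreviation "tors_coboundaries i \<equiv> coboundaries (\<lambda>q. torsion (E q)) d i"

lemma tors_carrier: "x \<in> carrier (torsion (E q)) \<Longrightarrow> x \<in> carrier (E q)"
  by (simp add: torsion_def graded_sub_def)

lemma tors_coboundariesE:
  assumes "x \<in> tors_coboundaries i"
  obtains y where "y \<in> carrier (torsion (E (i - 1)))" "y \<in> carrier (E (i - 1))" "x = d (i - 1) y"
  using assms tors_carrier by (auto simp: coboundaries_def)

lemma tors_coboundaries_closed:
  "x \<in> tors_coboundaries i \<Longrightarrow> x \<in> carrier (E i)"
  "x \<in> tors_coboundaries i \<Longrightarrow> r \<odot>\<^bsub>E i\<^esub> x \<in> tors_coboundaries i"
  "x \<in> tors_coboundaries i \<Longrightarrow> y \<in> tors_coboundaries i \<Longrightarrow> x \<oplus>\<^bsub>E i\<^esub> y \<in> tors_coboundaries i"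
  "\<zero>\<^bsub>E i\<^esub> \<in> tors_coboundaries i"
proof -
  show "x \<in> carrier (E i)" if "x \<in> tors_coboundaries i"
    using that d_simps(1)[of _ "i - 1"] by (auto elim: tors_coboundariesE)
  show "r \<odot>\<^bsub>E i\<^esub> x \<in> tors_coboundaries i" if "x \<in> tors_coboundaries i"
    using that
  proof (rule tors_coboundariesE)
    fix y assume y: "y \<in> carrier (torsion (E (i - 1)))" "y \<in> carrier (E (i - 1))" "x = d (i - 1) y"
    have "r \<odot>\<^bsub>E i\<^esub> x = d (i - 1) (r \<odot>\<^bsub>E (i - 1)\<^esub> y)" using d_simps(3)[OF y(2), of r] y(3) by simp
    then show ?thesis using E.torsion_closed(2)[OF y(1), of r] by (auto simp: coboundaries_def)
  qed
  show "x \<oplus>\<^bsub>E i\<^esub> y \<in> tors_coboundaries i" if xy: "x \<in> tors_coboundaries i" "y \<in> tors_coboundaries i"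
  proof -
    obtain x' where x: "x' \<in> carrier (torsion (E (i - 1)))" "x' \<in> carrier (E (i - 1))" "x = d (i - 1) x'"
      using xy(1) by (rule tors_coboundariesE)
    obtain y' where y: "y' \<in> carrier (torsion (E (i - 1)))" "y' \<in> carrier (E (i - 1))" "y = d (i - 1) y'"
      using xy(2) by (rule tors_coboundariesE)
    have "x \<oplus>\<^bsub>E i\<^esub> y = d (i - 1) (x' \<oplus>\<^bsub>E (i - 1)\<^esub> y')" using d_simps(2)[OF x(2) y(2)] x(3) y(3) by simp
    then show ?thesis using E.torsion_closed(1)[OF x(1) y(1)] by (auto simp: coboundaries_def)
  qed
  show "\<zero>\<^bsub>E i\<^esub> \<in> tors_coboundaries i"
    using d_zero[of "i - 1"] E.torsion_closed(3)[of "i - 1"] by (force simp: coboundaries_def)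
qed

lemma tors_coboundaries_subgroup: "subgroup (tors_coboundaries i) (add_monoid (E i))"
proof (rule E.M.add.subgroupI)
  show "\<ominus>\<^bsub>E i\<^esub> x \<in> tors_coboundaries i" if "x \<in> tors_coboundaries i" for x
    using that by (simp add: E.minus_smult tors_coboundaries_closed)
  show "tors_coboundaries i \<noteq> {}" using tors_coboundaries_closed(4) by blast
qed (use tors_coboundaries_closed in auto)

definition loc_class :: "int \<Rightarrow> 'e \<Rightarrow> 'e set" where
  "loc_class i z = tors_coboundaries i +>\<^bsub>E i\<^esub> z"

text \<open>The component of degree \<open>a\<close> consists of the classes of homogeneous cocycles, modulo all coboundaries of
  the torsion complex.\<close>

lemma local_cohomology_facts:
  "carrier (component (local_cohomology E d i) a) = loc_class i ` (tors_cocycles i \<inter> degree_part (E i) a)"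
  "\<zero>\<^bsub>component (local_cohomology E d i) a\<^esub> = tors_coboundaries i"
  "x \<in> carrier (E i) \<Longrightarrow> y \<in> carrier (E i) \<Longrightarrow>
     loc_class i x \<oplus>\<^bsub>component (local_cohomology E d i) a\<^esub> loc_class i y = loc_class i (x \<oplus>\<^bsub>E i\<^esub> y)"
  "x \<in> carrier (E i) \<Longrightarrow>
     r \<odot>\<^bsub>component (local_cohomology E d i) a\<^esub> loc_class i x = loc_class i (single 0 r \<odot>\<^bsub>E i\<^esub> x)"
  "x \<in> carrier (E i) \<Longrightarrow> y \<in> carrier (E i) \<Longrightarrow>
     loc_class i x = loc_class i y \<longleftrightarrow> x \<oplus>\<^bsub>E i\<^esub> (single 0 (- 1) \<odot>\<^bsub>E i\<^esub> y) \<in> tors_coboundaries i"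
proof -
  let ?S = "graded_sub (torsion (E i)) (tors_cocycles i)"
  have S: "ring.add ?S = ring.add (E i)" "module.smult ?S = module.smult (E i)"
    by (simp_all add: graded_sub_def torsion_def)
  have coset: "H +>\<^bsub>?S\<^esub> x = H +>\<^bsub>E i\<^esub> x" for H x by (simp add: a_r_coset_def' S)
  have Z: "tors_cocycles i \<inter> degree_part (torsion (E i)) a = tors_cocycles i \<inter> degree_part (E i) a"
    by (auto simp: cocycles_def torsion_def graded_sub_def)
  have part: "degree_part ?S a = tors_cocycles i \<inter> degree_part (torsion (E i)) a" by (simp add: graded_sub_def)
  note defs = component_def local_cohomology_def graded_cohomology_def graded_quot_def module.extend_def
    gmodule.fields_def quot_module_def
  note E_i = E.M.abelian_group_axioms[of i] tors_coboundaries_subgroup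
  show "carrier (component (local_cohomology E d i) a) = loc_class i ` (tors_cocycles i \<inter> degree_part (E i) a)"
    by (simp add: defs coset part Z loc_class_def)
  show "\<zero>\<^bsub>component (local_cohomology E d i) a\<^esub> = tors_coboundaries i" by (simp add: defs)
  show "loc_class i x \<oplus>\<^bsub>component (local_cohomology E d i) a\<^esub> loc_class i y = loc_class i (x \<oplus>\<^bsub>E i\<^esub> y)"
    if "x \<in> carrier (E i)" "y \<in> carrier (E i)"
    using coset_facts(2)[OF E_i that] by (simp add: defs loc_class_def set_add_def' S)
  show "r \<odot>\<^bsub>component (local_cohomology E d i) a\<^esub> loc_class i x = loc_class i (single 0 r \<odot>\<^bsub>E i\<^esub> x)"
    if x: "x \<in> carrier (E i)"
  proof -
    have "(\<Union>y\<in>tors_coboundaries i +>\<^bsub>E i\<^esub> x. tors_coboundaries i +>\<^bsub>E i\<^esub> (single 0 r \<odot>\<^bsub>E i\<^esub> y))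
        = tors_coboundaries i +>\<^bsub>E i\<^esub> (single 0 r \<odot>\<^bsub>E i\<^esub> x)"
      by (rule coset_smult[OF E_i x]) (simp_all add: E.M.smult_r_distr tors_coboundaries_closed)
    then show ?thesis by (simp add: defs coset S loc_class_def term_of_def)
  qed
  show "loc_class i x = loc_class i y \<longleftrightarrow> x \<oplus>\<^bsub>E i\<^esub> (single 0 (- 1) \<odot>\<^bsub>E i\<^esub> y) \<in> tors_coboundaries i"
    if "x \<in> carrier (E i)" "y \<in> carrier (E i)"
    using coset_facts(1)[OF E_i that] that by (simp add: loc_class_def E.M.minus_eq E.minus_smult)
qed

end

lemma degree_complex_down: "F \<in> degree_complex a K \<Longrightarrow> F' \<subseteq> F \<Longrightarrow> F' \<in> degree_complex a K"
  unfolding degree_complex_def by blast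

theorem theorem3p2:
  fixes I J :: "('n::{finite, linorder}, 'k::field) mpoly set"
    and E :: "int \<Rightarrow> ('n, 'k, 'e) multigraded"
    and d :: "int \<Rightarrow> 'e \<Rightarrow> 'e"
    and \<epsilon> :: "('n, 'k) mpoly set \<Rightarrow> 'e"
    and i :: int
    and a :: "'n \<Rightarrow> int"
  assumes "monomial_ideal I" and "monomial_ideal J" and "J \<subset> I"
    and "injective_resolution (ideal_quotient I J) \<epsilon> E d"
  shows "module_iso base_field (component (local_cohomology E d i) a)
           (relative_cohomology (degree_complex a J) (degree_complex a I)
              (i - int (card (negative_support a)) - 1))
       \<and> (negative_support a \<notin> stanley_reisner_complex (ideal_radical J) \<longrightarrow>
            carrier (component (local_cohomology E d i) a)
              = {\<zero>\<^bsub>component (local_cohomology E d i) a\<^esub>})"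
proof -
  let ?G = "negative_support a" and ?\<Delta> = "degree_complex a J" and ?\<Gamma> = "degree_complex a I"
  let ?H = "component (local_cohomology E d i) a"
  let ?one = "\<lambda>r. single 0 r :: ('n, 'k) mpoly"
  define j where "j = i - int (card ?G) - 1"
  define L where "L = ?\<Delta> - ?\<Gamma>"
  define \<F> where "\<F> = {F. ?G \<subseteq> F \<and> F - ?G \<in> ?\<Delta> - ?\<Gamma>}"
  \<comment> \<open>A relative face with j + 1 elements and the negative support together form a set of i elements.\<close>
  have ij: "j + 1 + int (card ?G) = i" "j + int (card ?G) = i - 1" by (simp_all add: j_def)
  interpret Q: quotient_resolution I J E d \<epsilon>
    using assms by unfold_locales auto
  interpret S: simplicial_pair ?\<Delta> ?\<Gamma> "TYPE('k)"
  proof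
    show "?\<Gamma> \<subseteq> ?\<Delta>" using degree_complex_antimono assms(3) by blast
  qed (rule degree_complex_down, assumption+)+
  have disj: "\<forall>F\<in>L. F \<inter> ?G = {}" by (auto simp: L_def degree_complex_def)
  have cone: "cone_faces ?G L = \<F>" by (auto simp: cone_faces_def \<F>_def L_def)
  note tw = twist_cochain[OF disj, unfolded cone] twist_inj[OF disj] twist_surj[OF disj, unfolded cone]
    twist_coboundary[OF disj, unfolded cone]
  obtain Rel where Rel:
    "\<And>z c. Rel z c \<Longrightarrow> z \<in> degree_part (E i) a \<and> z \<in> Q.tors_cocycles i \<and> c \<in> face_cochains \<F> i \<and> face_coboundary \<F> c = (\<lambda>_. 0)"
    "\<And>z. z \<in> degree_part (E i) a \<Longrightarrow> z \<in> Q.tors_cocycles i \<Longrightarrow> \<exists>c. Rel z c"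
    "\<And>c. c \<in> face_cochains \<F> i \<Longrightarrow> face_coboundary \<F> c = (\<lambda>_. 0) \<Longrightarrow> \<exists>z. Rel z c"
    "\<And>z c z' c'. Rel z c \<Longrightarrow> Rel z' c' \<Longrightarrow> Rel (z \<oplus>\<^bsub>E i\<^esub> z') (\<lambda>F. c F + c' F)"
    "\<And>z c r. Rel z c \<Longrightarrow> Rel (?one r \<odot>\<^bsub>E i\<^esub> z) (\<lambda>F. r * c F)"
    "\<And>z c. Rel z c \<Longrightarrow> z \<in> Q.tors_coboundaries i \<longleftrightarrow> c \<in> face_coboundary \<F> ` face_cochains \<F> (i - 1)"
    by (rule Q.torsion_cochains_comparison[OF \<F>_def, of i]) blast
  define Rel' where "Rel' z \<phi> \<longleftrightarrow> \<phi> \<in> carrier (S.cochains j) \<and> Rel z (twist ?G (S.ev j \<phi>))" for z \<phi>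
  have ev: "S.ev j \<phi> \<in> face_cochains L (j + 1)" for \<phi> unfolding L_def by (rule S.ev_face_cochain)
  have cocycle: "\<phi> \<in> cocycles S.cochains (relative_coboundary ?\<Delta> ?\<Gamma>) j \<longleftrightarrow>
      \<phi> \<in> carrier (S.cochains j) \<and> face_coboundary \<F> (twist ?G (S.ev j \<phi>)) = (\<lambda>F. 0)" for \<phi>
  proof -
    have "face_coboundary L (S.ev j \<phi>) \<in> face_cochains L (j + 1 + 1)"
      by (rule face_coboundary_cochain[OF ev])
    then have "twist ?G (face_coboundary L (S.ev j \<phi>)) = (\<lambda>F. 0) \<longleftrightarrow> face_coboundary L (S.ev j \<phi>) = (\<lambda>F. 0)"
      using twist_inj[OF disj, where c = "face_coboundary L (S.ev j \<phi>)" and m = "j + 1 + 1" and c' = "\<lambda>F. 0"]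
        face_cochains_closed(3)[of L "j + 1 + 1"]
      by (auto simp: twist_def fun_eq_iff)
    then show ?thesis unfolding S.cocycle_iff tw(4)[symmetric] L_def[symmetric] by simp
  qed
  have coboundary: "\<phi> \<in> S.rel_coboundaries j \<longleftrightarrow> twist ?G (S.ev j \<phi>) \<in> face_coboundary \<F> ` face_cochains \<F> (i - 1)"
    if \<phi>: "\<phi> \<in> carrier (S.cochains j)" for \<phi>
    unfolding S.coboundary_iff[OF \<phi>] L_def[symmetric]
  proof
    assume "S.ev j \<phi> \<in> face_coboundary L ` face_cochains L j"
    then obtain b where "b \<in> face_cochains L j" "S.ev j \<phi> = face_coboundary L b" by blast
    then show "twist ?G (S.ev j \<phi>) \<in> face_coboundary \<F> ` face_cochains \<F> (i - 1)"
      using tw(1)[of b j] tw(4)[of b] ij by auto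
  next
    assume "twist ?G (S.ev j \<phi>) \<in> face_coboundary \<F> ` face_cochains \<F> (i - 1)"
    then obtain b' where b': "b' \<in> face_cochains \<F> (j + int (card ?G))" "twist ?G (S.ev j \<phi>) = face_coboundary \<F> b'"
      using ij by auto
    obtain b where b: "b \<in> face_cochains L j" "twist ?G b = b'" using tw(3)[OF b'(1)] by blast
    have "twist ?G (S.ev j \<phi>) = twist ?G (face_coboundary L b)" using b'(2) b(2) tw(4)[of b] by simp
    then have "S.ev j \<phi> = face_coboundary L b" by (rule tw(2)[OF ev face_coboundary_cochain[OF b(1)]])
    then show "S.ev j \<phi> \<in> face_coboundary L ` face_cochains L j" using b(1) by blast
  qed
  have Rel'_add: "Rel' (z \<oplus>\<^bsub>E i\<^esub> z') (\<phi> \<oplus>\<^bsub>S.cochains j\<^esub> \<psi>)" if "Rel' z \<phi>" "Rel' z' \<psi>" for z \<phi> z' \<psi>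
    using that Rel(4) S.cochains_closed(1) by (simp add: Rel'_def S.ev_add twist_add)
  have Rel'_smult: "Rel' (?one r \<odot>\<^bsub>E i\<^esub> z) (r \<odot>\<^bsub>S.cochains j\<^esub> \<phi>)" if "Rel' z \<phi>" for z \<phi> r
    using that Rel(5) S.cochains_closed(2) by (simp add: Rel'_def S.ev_smult twist_scale)
  have dom: "z \<in> carrier (E i) \<and> z \<in> Q.tors_cocycles i \<inter> degree_part (E i) a \<and>
      \<phi> \<in> carrier (S.cochains j) \<and> \<phi> \<in> cocycles S.cochains (relative_coboundary ?\<Delta> ?\<Gamma>) j" if "Rel' z \<phi>" for z \<phi>
    using that Rel(1)[of z "twist ?G (S.ev j \<phi>)"] Q.E.part_carrier[of z i a] by (auto simp: Rel'_def cocycle)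
  have iso: "module_iso base_field ?H (relative_cohomology ?\<Delta> ?\<Gamma> j)"
  proof (rule module_iso_from_relation[where Rel = Rel' and p = "Q.loc_class i" and q = "S.coh_class j"])
    show "carrier ?H = Q.loc_class i ` (Q.tors_cocycles i \<inter> degree_part (E i) a)" by (rule Q.local_cohomology_facts)
    show "carrier (relative_cohomology ?\<Delta> ?\<Gamma> j) = S.coh_class j ` cocycles S.cochains (relative_coboundary ?\<Delta> ?\<Gamma>) j"
      by (rule S.relative_cohomology_facts)
    show "z \<in> Q.tors_cocycles i \<inter> degree_part (E i) a \<and> \<phi> \<in> cocycles S.cochains (relative_coboundary ?\<Delta> ?\<Gamma>) j"
      if "Rel' z \<phi>" for z \<phi> using dom[OF that] by blast
    show "\<exists>\<phi>. Rel' z \<phi>" if z: "z \<in> Q.tors_cocycles i \<inter> degree_part (E i) a" for z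
    proof -
      obtain c where c: "Rel z c" using Rel(2) z by blast
      then have "c \<in> face_cochains \<F> (j + 1 + int (card ?G))" unfolding ij(1) using Rel(1) by blast
      then obtain b where b: "b \<in> face_cochains L (j + 1)" "twist ?G b = c" using tw(3) by blast
      then obtain \<phi> where "\<phi> \<in> carrier (S.cochains j)" "S.ev j \<phi> = b" using S.ev_surj[of b j] by (auto simp: L_def)
      then show ?thesis using b c by (auto simp: Rel'_def)
    qed
    show "\<exists>z. Rel' z \<phi>" if \<phi>: "\<phi> \<in> cocycles S.cochains (relative_coboundary ?\<Delta> ?\<Gamma>) j" for \<phi>
      using \<phi> Rel(3)[OF tw(1)[OF ev, unfolded ij(1)]] unfolding cocycle Rel'_def by blast
    show "Q.loc_class i z = Q.loc_class i z' \<longleftrightarrow> S.coh_class j \<phi> = S.coh_class j \<psi>"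
      if R: "Rel' z \<phi>" "Rel' z' \<psi>" for z \<phi> z' \<psi>
    proof -
      let ?z = "z \<oplus>\<^bsub>E i\<^esub> (?one (- 1) \<odot>\<^bsub>E i\<^esub> z')" and ?\<phi> = "\<phi> \<oplus>\<^bsub>S.cochains j\<^esub> ((- 1) \<odot>\<^bsub>S.cochains j\<^esub> \<psi>)"
      have R': "Rel' ?z ?\<phi>" by (intro Rel'_add Rel'_smult R)
      have "?z \<in> Q.tors_coboundaries i \<longleftrightarrow> ?\<phi> \<in> S.rel_coboundaries j"
        using R' Rel(6) coboundary dom[OF R'] unfolding Rel'_def by blast
      then show ?thesis
        using dom[OF R(1)] dom[OF R(2)] Q.local_cohomology_facts(5)[of z i z'] S.relative_cohomology_facts(4)[of \<phi> j \<psi>] by blast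
    qed
    show "\<exists>w e. Rel' w e \<and> Q.loc_class i z \<oplus>\<^bsub>?H\<^esub> Q.loc_class i z' = Q.loc_class i w \<and>
        S.coh_class j \<phi> \<oplus>\<^bsub>relative_cohomology ?\<Delta> ?\<Gamma> j\<^esub> S.coh_class j \<psi> = S.coh_class j e"
      if R: "Rel' z \<phi>" "Rel' z' \<psi>" for z \<phi> z' \<psi>
      using Rel'_add[OF R] dom[OF R(1)] dom[OF R(2)] Q.local_cohomology_facts(3)[where x = z and y = z' and i = i and a = a]
        S.relative_cohomology_facts(2)[of \<phi> j \<psi>] by blast
    show "\<exists>w e. Rel' w e \<and> r \<odot>\<^bsub>?H\<^esub> Q.loc_class i z = Q.loc_class i w \<and>
        r \<odot>\<^bsub>relative_cohomology ?\<Delta> ?\<Gamma> j\<^esub> S.coh_class j \<phi> = S.coh_class j e"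
      if R: "Rel' z \<phi>" for z \<phi> r
      using Rel'_smult[OF R] dom[OF R] Q.local_cohomology_facts(4)[where x = z and i = i and r = r and a = a]
        S.relative_cohomology_facts(3)[of \<phi> j r] by blast
  qed
  have vanish: "carrier ?H = {\<zero>\<^bsub>?H\<^esub>}" if G: "?G \<notin> stanley_reisner_complex (ideal_radical J)"
  proof -
    have "\<F> = {}" using degree_complex_empty[OF assms(2) G] by (simp add: \<F>_def)
    have class0: "Q.loc_class i z = \<zero>\<^bsub>?H\<^esub>" if z: "z \<in> Q.tors_cocycles i \<inter> degree_part (E i) a" for z
    proof -
      obtain c where c: "Rel z c" using Rel(2) z by blast
      have "c = (\<lambda>F. 0)" using Rel(1)[OF c] \<open>\<F> = {}\<close> by (auto simp: face_cochains_def)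
      then have "c \<in> face_coboundary \<F> ` face_cochains \<F> (i - 1)"
        by (intro image_eqI[OF _ face_cochains_closed(3)]) (simp add: face_coboundary_def fun_eq_iff)
      then have "z \<in> Q.tors_coboundaries i" using Rel(6)[OF c] by simp
      then show ?thesis unfolding Q.loc_class_def Q.local_cohomology_facts(2)
        using Q.E.M.a_coset_join2[of z i "Q.tors_coboundaries i"] Q.tors_coboundaries_subgroup
          Q.tors_coboundaries_closed(1) by blast
    qed
    have "\<zero>\<^bsub>E i\<^esub> \<in> Q.tors_cocycles i \<inter> degree_part (E i) a"
      using Q.E.part_zero[of i a] Q.E.torsion_closed(3)[of i] Q.d_zero[of i]
      by (simp add: cocycles_def) (simp add: torsion_def graded_sub_def)
    then show ?thesis using class0 unfolding Q.local_cohomology_facts(1) by blast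
  qed
  show ?thesis using iso vanish unfolding j_def by blast
qed

end
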